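(* Let $(X,x_0)$ be a pointed operator metric space, $n\in\mathbb{N}$, and let $F=\mathrm{span}\{\delta_x\}_{x\in X}\subset\mathcal{F}^n(X)$. For any $m\in\mathbb{N}$ and $\mu\in\mathrm{M}_m(F)$ we have \[\|\mu\|_{\mathrm{M}_m(\mathcal{F}^n(X))}=\inf\Big\{\|\alpha\|\,\|\beta\|\max_{1\le\ell\le N}|c_\ell|\,\big\|[x^\ell_{ij}-y^\ell_{ij}]\big\|_{\mathrm{M}_n}\Big\},\] where the infimum is taken over all $N\in\mathbb{N}$ and all representations of $\mu$ of the form $\mu=\alpha\cdot D\cdot\beta$, where $\alpha\in\mathrm{M}_{m,Nn}$ and $\beta\in\mathrm{M}_{Nn,m}$ are scalar matrices and $D\in\mathrm{M}_N(\mathrm{M}_n(F))$ is a diagonal matrix whose diagonal entries are of the form $c_\ell[\delta_{x^\ell_{ij}}-\delta_{y^\ell_{ij}}]_{ij}$ with $c_\ell$ a scalar and $[x^\ell_{ij}],[y^\ell_{ij}]\in\mathrm{M}_n(X)$ for $1\le\ell\le N$.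
   Context: An operator metric space is a subset $X\subset\mathcal{B}(H)$, $H$ a (complex) Hilbert space; $\mathrm{M}_n(X)$ is the set of $n\times n$ matrices over $X$ and $\|[x_{ij}-y_{ij}]\|_{\mathrm{M}_n}$ denotes the norm of the difference in $\mathcal{B}(H^{\oplus n})$. A pointed operator metric space is a pair $(X,x_0)$ with $x_0\in X$. For a map $f$, its $n$-th amplification is $f_n([x_{ij}])=[f(x_{ij})]$ and $\mathrm{Lip}_n(f)$ is the Lipschitz constant of $f_n$. Scalar (complex) matrices carry the operator norm; elements of $\mathrm{M}_N(\mathrm{M}_n(F))$ are $N\times N$ matrices of $n\times n$ blocks, identified with elements of $\mathrm{M}_{Nn}(F)$ when multiplied by scalar matrices. $\mathrm{Lip}_0(X,\mathbb{C})$ is the space of Lipschitz maps $f:X\to\mathbb{C}$ with $f(x_0)=0$. $\mathrm{Lip}_0^n(X,\mathbb{C})$ denotes this space with norm $\|f\|_{\mathrm{Lip},n}=\mathrm{Lip}_n(f)$ and operator space structure given, for $[f_{ij}]\in \mathrm{M}_k(\mathrm{Lip}_0(X,\mathbb{C}))$, by $\|[f_{ij}]\|_{\mathrm{Lip},n,k}=\mathrm{Lip}_n\big([f_{ij}]:X\to \mathrm{M}_k\big)$, where $[f_{ij}]$ is viewed as the map $x\mapsto[f_{ij}(x)]$. The dual $E^*$ of an operator space $E$ is an operator space via $\mathrm{M}_k(E^* )\cong\mathrm{CB}(E,\mathrm{M}_k)$. For $x\in X$, $\delta_x\in \mathrm{Lip}_0^n(X,\mathbb{C})^*$ is $\delta_x(f)=f(x)$.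 The $n$-Lipschitz-free operator space is $\mathcal{F}^n(X)=\overline{\mathrm{span}}\{\delta_x: x\in X\}\subset \mathrm{Lip}_0^n(X,\mathbb{C})^*$ with the inherited operator space structure. *)

theory Defs
  imports
    "HOL-Analysis.Bounded_Linear_Function"
    "HOL-Analysis.Lipschitz"
    "HOL-Analysis.L2_Norm"
    "HOL-Library.Function_Algebras"
    "Jordan_Normal_Form.Matrix"
begin

text \<open>Complex Hilbert spaces. The inner product is linear in the second argument.\<close>

class complex_hilbert_space = banach +
  fixes scaleC :: "complex \<Rightarrow> 'a \<Rightarrow> 'a"
    and cinner :: "'a \<Rightarrow> 'a \<Rightarrow> complex"
  assumes scaleC_add_right: "scaleC c (x + y) = scaleC c x + scaleC c y"
    and scaleC_add_left: "scaleC (c + d) x = scaleC c x + scaleC d x"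
    and scaleC_scaleC: "scaleC c (scaleC d x) = scaleC (c * d) x"
    and scaleC_of_real: "scaleC (complex_of_real r) x = r *\<^sub>R x"
    and cinner_commute: "cinner x y = cnj (cinner y x)"
    and cinner_add_right: "cinner x (y + z) = cinner x y + cinner x z"
    and cinner_scaleC_right: "cinner x (scaleC c y) = c * cinner x y"
    and cinner_self: "cinner x x = complex_of_real ((norm x)\<^sup>2)"

text \<open>
  The library type of bounded operators consists of the real-linear ones; \<open>B(H)\<close> is the subset
  of complex-linear operators. The operator norm is the same for both.
\<close>

definition bounded_clinear_ops :: "('h::complex_hilbert_space \<Rightarrow>\<^sub>L 'h) set" where
  "bounded_clinear_ops =
     {T. \<forall>c v. blinfun_apply T (scaleC c v) = scaleC c (blinfun_apply T v)}"

definition pointed_operator_metric_space ::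
    "('h::complex_hilbert_space \<Rightarrow>\<^sub>L 'h) set \<Rightarrow> ('h \<Rightarrow>\<^sub>L 'h) \<Rightarrow> bool" where
  "pointed_operator_metric_space X x0 \<longleftrightarrow> X \<subseteq> bounded_clinear_ops \<and> x0 \<in> X"

definition mats :: "nat \<Rightarrow> 'a set \<Rightarrow> 'a mat set" where
  "mats n X = {A \<in> carrier_mat n n. elements_mat A \<subseteq> X}"

definition l2_norm :: "'a::real_normed_vector vec \<Rightarrow> real" where
  "l2_norm v = L2_set (\<lambda>i. norm (vec_index v i)) {..<dim_vec v}"

text \<open>Operator norm of a scalar matrix.\<close>

definition cmat_norm :: "complex mat \<Rightarrow> real" where
  "cmat_norm A = Sup {l2_norm (A *\<^sub>v v) | v. v \<in> carrier_vec (dim_col A) \<and> l2_norm v \<le> 1}"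

text \<open>Norm of a matrix of operators, acting between finite direct sums of copies of \<open>H\<close>.\<close>

definition op_mat_apply :: "('h::real_normed_vector \<Rightarrow>\<^sub>L 'h) mat \<Rightarrow> 'h vec \<Rightarrow> 'h vec" where
  "op_mat_apply A v =
     vec (dim_row A) (\<lambda>i. \<Sum>j<dim_col A. blinfun_apply (A $$ (i, j)) (vec_index v j))"

definition op_mat_norm :: "('h::real_normed_vector \<Rightarrow>\<^sub>L 'h) mat \<Rightarrow> real" where
  "op_mat_norm A =
     Sup {l2_norm (op_mat_apply A v) | v. v \<in> carrier_vec (dim_col A) \<and> l2_norm v \<le> 1}"

text \<open>
  \<open>flatten_mat k\<close> identifies matrices of \<open>k \<times> k\<close> blocks with scalar matrices, and
  \<open>amplify k F\<close> is the amplification of a map \<open>F\<close> with values in the \<open>k \<times> k\<close> matrices.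
\<close>

definition flatten_mat :: "nat \<Rightarrow> 'a mat mat \<Rightarrow> 'a mat" where
  "flatten_mat k A =
     mat (dim_row A * k) (dim_col A * k) (\<lambda>(p, q). A $$ (p div k, q div k) $$ (p mod k, q mod k))"

definition amplify :: "nat \<Rightarrow> ('a \<Rightarrow> complex mat) \<Rightarrow> 'a mat \<Rightarrow> complex mat" where
  "amplify k F A = flatten_mat k (map_mat F A)"

text \<open>The Lipschitz constant of the \<open>n\<close>-th amplification of \<open>F\<close> mapping \<open>X\<close> to \<open>k \<times> k\<close> matrices.\<close>

definition lip_const ::
    "('h::real_normed_vector \<Rightarrow>\<^sub>L 'h) set \<Rightarrow> nat \<Rightarrow> nat \<Rightarrow> (('h \<Rightarrow>\<^sub>L 'h) \<Rightarrow> complex mat) \<Rightarrow> real" where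
  "lip_const X n k F =
     Inf {C. 0 \<le> C \<and> (\<forall>x\<in>mats n X. \<forall>y\<in>mats n X.
            cmat_norm (amplify k F x - amplify k F y) \<le> C * op_mat_norm (x - y))}"

text \<open>
  All vector spaces below are spaces of complex-valued functions with pointwise operations.
  A function or functional whose mathematical domain is a proper subset of the type is
  represented by its extension by zero.
\<close>

definition scaleF :: "complex \<Rightarrow> ('a \<Rightarrow> complex) \<Rightarrow> ('a \<Rightarrow> complex)" where
  "scaleF c f = (\<lambda>x. c * f x)"

interpretation cfun: vector_space "scaleF :: complex \<Rightarrow> ('a \<Rightarrow> complex) \<Rightarrow> ('a \<Rightarrow> complex)"
  by unfold_locales (auto simp: scaleF_def fun_eq_iff algebra_simps)

text \<open>
  An operator space: the vectors, and the norm of square matrices of vectors (of every size,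
  the size being read off the matrix).
\<close>

record 'a opspace =
  os_carrier :: "('a \<Rightarrow> complex) set"
  os_norm :: "('a \<Rightarrow> complex) mat \<Rightarrow> real"

definition vnorm :: "'a opspace \<Rightarrow> ('a \<Rightarrow> complex) \<Rightarrow> real" where
  "vnorm E f = os_norm E (mat 1 1 (\<lambda>_. f))"

definition lip0_space ::
    "('h::complex_hilbert_space \<Rightarrow>\<^sub>L 'h) set \<Rightarrow> ('h \<Rightarrow>\<^sub>L 'h) \<Rightarrow> nat \<Rightarrow> ('h \<Rightarrow>\<^sub>L 'h) opspace" where
  "lip0_space X x0 n =
     \<lparr>os_carrier = {f. (\<exists>L. L-lipschitz_on X f) \<and> f x0 = 0 \<and> (\<forall>x. x \<notin> X \<longrightarrow> f x = 0)},
      os_norm = (\<lambda>G. lip_const X n (dim_row G) (\<lambda>x. map_mat (\<lambda>f. f x) G))\<rparr>"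

text \<open>
  The dual operator space: a matrix \<open>\<Phi>\<close> of functionals is viewed as the matrix-valued map
  sending \<open>f\<close> to the matrix of the values at \<open>f\<close>, and its norm is the completely bounded norm.
\<close>

definition dual_space :: "'a opspace \<Rightarrow> ('a \<Rightarrow> complex) opspace" where
  "dual_space E =
     \<lparr>os_carrier = {\<phi>.
        (\<forall>f\<in>os_carrier E. \<forall>g\<in>os_carrier E. \<phi> (f + g) = \<phi> f + \<phi> g) \<and>
        (\<forall>c. \<forall>f\<in>os_carrier E. \<phi> (scaleF c f) = c * \<phi> f) \<and>
        (\<exists>C. \<forall>f\<in>os_carrier E. cmod (\<phi> f) \<le> C * vnorm E f) \<and>
        (\<forall>f. f \<notin> os_carrier E \<longrightarrow> \<phi> f = 0)},
      os_norm = (\<lambda>\<Phi>. Sup {cmat_norm (amplify (dim_row \<Phi>) (\<lambda>f. map_mat (\<lambda>\<phi>. \<phi> f) \<Phi>) G) | G k.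
        1 \<le> k \<and> G \<in> mats k (os_carrier E) \<and> os_norm E G \<le> 1})\<rparr>"

definition delta ::
    "('h::complex_hilbert_space \<Rightarrow>\<^sub>L 'h) set \<Rightarrow> ('h \<Rightarrow>\<^sub>L 'h) \<Rightarrow> nat \<Rightarrow> ('h \<Rightarrow>\<^sub>L 'h) \<Rightarrow>
      (('h \<Rightarrow>\<^sub>L 'h) \<Rightarrow> complex) \<Rightarrow> complex" where
  "delta X x0 n x = (\<lambda>f. if f \<in> os_carrier (lip0_space X x0 n) then f x else 0)"

definition delta_span ::
    "('h::complex_hilbert_space \<Rightarrow>\<^sub>L 'h) set \<Rightarrow> ('h \<Rightarrow>\<^sub>L 'h) \<Rightarrow> nat \<Rightarrow>
      ((('h \<Rightarrow>\<^sub>L 'h) \<Rightarrow> complex) \<Rightarrow> complex) set" where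
  "delta_span X x0 n = cfun.span (delta X x0 n ` X)"

definition lip_free_space ::
    "('h::complex_hilbert_space \<Rightarrow>\<^sub>L 'h) set \<Rightarrow> ('h \<Rightarrow>\<^sub>L 'h) \<Rightarrow> nat \<Rightarrow>
      (('h \<Rightarrow>\<^sub>L 'h) \<Rightarrow> complex) opspace" where
  "lip_free_space X x0 n =
     (let D = dual_space (lip0_space X x0 n) in
      \<lparr>os_carrier = {\<psi> \<in> os_carrier D. \<forall>\<epsilon>>0. \<exists>\<phi>\<in>delta_span X x0 n. vnorm D (\<psi> - \<phi>) < \<epsilon>},
       os_norm = os_norm D\<rparr>)"

text \<open>Products of scalar matrices with matrices of vectors.\<close>

definition scalar_mult_left ::
    "complex mat \<Rightarrow> ('a \<Rightarrow> complex) mat \<Rightarrow> ('a \<Rightarrow> complex) mat" (infixr "\<cdot>\<^sub>l" 70) where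
  "\<alpha> \<cdot>\<^sub>l D = mat (dim_row \<alpha>) (dim_col D) (\<lambda>(i, j). \<Sum>p<dim_row D. scaleF (\<alpha> $$ (i, p)) (D $$ (p, j)))"

definition scalar_mult_right ::
    "('a \<Rightarrow> complex) mat \<Rightarrow> complex mat \<Rightarrow> ('a \<Rightarrow> complex) mat" (infixr "\<cdot>\<^sub>r" 70) where
  "D \<cdot>\<^sub>r \<beta> = mat (dim_row D) (dim_col \<beta>) (\<lambda>(i, j). \<Sum>q<dim_col D. scaleF (\<beta> $$ (q, j)) (D $$ (i, q)))"

text \<open>The diagonal block \<open>c [\<delta>\<^sub>x\<^sub>i\<^sub>j - \<delta>\<^sub>y\<^sub>i\<^sub>j]\<close>.\<close>

definition molecule_mat ::
    "('h::complex_hilbert_space \<Rightarrow>\<^sub>L 'h) set \<Rightarrow> ('h \<Rightarrow>\<^sub>L 'h) \<Rightarrow> nat \<Rightarrow> complex \<Rightarrow>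
      ('h \<Rightarrow>\<^sub>L 'h) mat \<Rightarrow> ('h \<Rightarrow>\<^sub>L 'h) mat \<Rightarrow> ((('h \<Rightarrow>\<^sub>L 'h) \<Rightarrow> complex) \<Rightarrow> complex) mat" where
  "molecule_mat X x0 n c x y =
     map_mat (scaleF c) (map_mat (delta X x0 n) x - map_mat (delta X x0 n) y)"

end

theory Submission
  imports Defs
begin

text \<open>
  The norm of \<open>\<mu>\<close> is the supremum of the norms of the matrices \<open>\<mu>(G) = [\<mu>\<^sub>a\<^sub>b(G\<^sub>p\<^sub>q)]\<close>, where
  \<open>G\<close> runs over the square matrices of Lipschitz functions whose \<open>n\<close>-th Lipschitz constant is at
  most 1. If \<open>\<mu> = \<alpha> D \<beta>\<close> is a representation of the required kind, then evaluating the diagonal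
  matrix \<open>D\<close> at \<open>G\<close> gives, up to a permutation of indices, a block diagonal scalar matrix whose
  blocks have norm at most \<open>|c\<^sub>l| \<parallel>x\<^sub>l - y\<^sub>l\<parallel>\<close>. Hence \<open>\<parallel>\<mu>(G)\<parallel>\<close> is at most the cost of the
  representation (\<open>evaluation_le_cost\<close>), and the norm of \<open>\<mu>\<close> is at most the infimum.

  For the other inequality one needs a matrix \<open>G\<close> that almost attains the infimum \<open>I\<close>. An
  \<open>m \<times> m\<close> matrix \<open>G\<close> of Lipschitz functions is the same thing as a linear map \<open>\<phi>\<close> from the
  span of the point evaluations to the \<open>m \<times> m\<close> matrices, and \<open>G\<close> is admissible when the \<open>n\<close>-th
  amplification of \<open>\<phi>\<close> is a contraction on the normalised molecules
  \<open>c[\<delta>(x\<^sub>i\<^sub>j) - \<delta>(y\<^sub>i\<^sub>j)]\<close>. So what is needed is a matricial Hahn--Banach theorem in the style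
  of Effros and Ruan (\<open>matricial_hahn_banach\<close>), which is obtained in two steps.

  First, by the inequality between the arithmetic and the geometric mean, the cost of a
  representation by normalised molecules can be replaced by half the sum of the suprema of the
  quadratic forms \<open>\<parallel>\<xi> \<alpha>\<parallel>\<^sup>2\<close> and \<open>\<parallel>\<beta> \<xi>\<parallel>\<^sup>2\<close> over the unit ball of \<open>\<complex>\<^sup>m\<close>.
  Representations add and scale as a convex cone of triples (quadratic form, quadratic form,
  matrix over the span), and one application of the real Hahn--Banach theorem to this cone
  gives, at the same time, positive functionals \<open>p\<close> and \<open>q\<close> of norm at most 1 on the
  functions on the ball and a complex functional \<open>\<Lambda>\<close> on the matrices with
  \<open>|\<Lambda>(\<alpha> D \<beta>)| \<le> p(\<parallel>\<xi> \<alpha>\<parallel>\<^sup>2) + q(\<parallel>\<beta> \<xi>\<parallel>\<^sup>2)\<close> for every normalised molecule \<open>D\<close>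
  and \<open>Re \<Lambda>(\<mu>) \<ge> 2 I\<close> (\<open>matricial_separation\<close>).

  Second, \<open>p\<close> and \<open>q\<close> define inner products on \<open>\<complex>\<^sup>m\<close>, after adding \<open>\<epsilon>\<close> times the standard
  one to make them definite. With orthonormal bases \<open>u\<close> and \<open>w\<close> for them
  (\<open>orthonormal_frame\<close>), the map \<open>\<phi>\<^sub>i\<^sub>j(v) = \<Lambda>(u\<^sub>i v w\<^sub>j) / 2\<close> is contractive on the molecules,
  because \<open>p\<close> and \<open>q\<close> turn into squared norms of coordinates, and expanding the standard basis
  in \<open>u\<close> and \<open>w\<close> shows \<open>I \<le> (1 + \<epsilon> m) \<parallel>\<phi>(\<mu>)\<parallel>\<close>. Finally \<open>\<epsilon>\<close> tends to 0.
\<close>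

section \<open>The Hahn--Banach theorem for sublinear functionals and cones\<close>

text \<open>
  Scaling is a parameter and the functionals are considered on a subspace, because the theorem
  will be applied to triples of two bounded functions and a matrix over a span, which form a
  proper subspace of a product of function spaces.
\<close>

definition sublinear_on :: "(real \<Rightarrow> 'w \<Rightarrow> 'w) \<Rightarrow> 'w::ab_group_add set \<Rightarrow> ('w \<Rightarrow> real) \<Rightarrow> bool" where
  "sublinear_on sc S q \<longleftrightarrow>
     (\<forall>x\<in>S. \<forall>y\<in>S. q (x + y) \<le> q x + q y) \<and> (\<forall>t>0. \<forall>x\<in>S. q (sc t x) = t * q x)"

lemma sublinear_onD:
  assumes "sublinear_on sc S q" "x \<in> S"
  shows "y \<in> S \<Longrightarrow> q (x + y) \<le> q x + q y" "t > 0 \<Longrightarrow> q (sc t x) = t * q x"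
  using assms by (auto simp: sublinear_on_def)

context
  fixes sc :: "real \<Rightarrow> 'w::ab_group_add \<Rightarrow> 'w" and S :: "'w set"
  assumes vs: "vector_space sc" and S: "module.subspace sc S"
begin

interpretation vector_space sc by (fact vs)

lemma sublinear_on_zero:
  assumes "sublinear_on sc S q"
  shows "q 0 = 0"
proof -
  have "q (sc 2 0) = 2 * q 0"
    using assms subspace_0[OF S] by (intro sublinear_onD(2)) auto
  then show ?thesis by simp
qed

lemma sublinear_on_lower:
  assumes "sublinear_on sc S q" "x \<in> S"
  shows "- q (- x) \<le> q x"
  using sublinear_onD(1)[OF assms, of "- x"] subspace_neg[OF S assms(2)] sublinear_on_zero[OF assms(1)]
  by simp

text \<open>
  The largest sublinear functional below \<open>q\<close> whose value at \<open>- y\<close> is at most \<open>- q y\<close>: it is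
  \<open>q\<close> made linear along the ray through \<open>y\<close>.
\<close>

definition tilt :: "('w \<Rightarrow> real) \<Rightarrow> 'w \<Rightarrow> 'w \<Rightarrow> real" where
  "tilt q y x = (INF t\<in>{0..}. q (x + sc t y) - t * q y)"

lemma tilt:
  assumes q: "sublinear_on sc S q" and y: "y \<in> S"
  shows tilt_le_shift: "\<And>x t. x \<in> S \<Longrightarrow> 0 \<le> t \<Longrightarrow> tilt q y x \<le> q (x + sc t y) - t * q y"
    and sublinear_on_tilt: "sublinear_on sc S (tilt q y)"
proof -
  have homog: "q (sc t y) = t * q y" if "0 \<le> t" for t
    using that sublinear_onD(2)[OF q y, of t] sublinear_on_zero[OF q] by (cases "t = 0") auto
  show le: "tilt q y x \<le> q (x + sc t y) - t * q y" if "x \<in> S" "0 \<le> t" for x t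
    unfolding tilt_def
  proof (rule cINF_lower)
    have "- q (- x) \<le> q (x + sc s y) - s * q y" if "0 \<le> s" for s
    proof -
      have "q ((x + sc s y) + (- x)) \<le> q (x + sc s y) + q (- x)"
        using \<open>x \<in> S\<close> y S by (intro sublinear_onD(1)[OF q]) (auto intro: subspace_add subspace_scale subspace_neg)
      then show ?thesis using homog[OF that] by simp
    qed
    then show "bdd_below ((\<lambda>t. q (x + sc t y) - t * q y) ` {0..})"
      by (auto intro!: bdd_belowI)
  qed (use that in auto)
  have greatest: "z \<le> tilt q y x" if "\<And>t. 0 \<le> t \<Longrightarrow> z \<le> q (x + sc t y) - t * q y" for x z
    unfolding tilt_def using that by (intro cINF_greatest) auto
  have mem: "x + sc t y \<in> S" if "x \<in> S" for x t
    using that y S by (auto intro: subspace_add subspace_scale)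
  have add: "tilt q y (x1 + x2) \<le> tilt q y x1 + tilt q y x2" if x: "x1 \<in> S" "x2 \<in> S" for x1 x2
  proof -
    have "tilt q y (x1 + x2) - (q (x2 + sc t2 y) - t2 * q y) \<le> tilt q y x1"
      if t2: "0 \<le> t2" for t2
    proof (rule greatest)
      fix t1 :: real assume t1: "0 \<le> t1"
      have "q ((x1 + sc t1 y) + (x2 + sc t2 y)) \<le> q (x1 + sc t1 y) + q (x2 + sc t2 y)"
        using mem x by (intro sublinear_onD(1)[OF q]) auto
      moreover have "(x1 + sc t1 y) + (x2 + sc t2 y) = (x1 + x2) + sc (t1 + t2) y"
        by (simp add: scale_left_distrib algebra_simps)
      ultimately show "tilt q y (x1 + x2) - (q (x2 + sc t2 y) - t2 * q y)
          \<le> q (x1 + sc t1 y) - t1 * q y"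
        using le[of "x1 + x2" "t1 + t2"] x t1 t2 S by (auto simp: subspace_add algebra_simps)
    qed
    then have "tilt q y (x1 + x2) - tilt q y x1 \<le> tilt q y x2"
      by (intro greatest) (auto simp: algebra_simps)
    then show ?thesis by simp
  qed
  have scale_le: "s * tilt q y x \<le> tilt q y (sc s x)" if x: "x \<in> S" and s: "0 < s" for s x
  proof (rule greatest)
    fix t :: real assume t: "0 \<le> t"
    have "q (sc s (x + sc (t / s) y)) = s * q (x + sc (t / s) y)"
      using mem x s by (intro sublinear_onD(2)[OF q]) auto
    moreover have "sc s (x + sc (t / s) y) = sc s x + sc t y"
      using s by (simp add: scale_right_distrib)
    moreover have "s * tilt q y x \<le> s * (q (x + sc (t / s) y) - t / s * q y)"
      using le[OF x, of "t / s"] s t by simp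
    ultimately show "s * tilt q y x \<le> q (sc s x + sc t y) - t * q y"
      using s by (simp add: algebra_simps)
  qed
  have "tilt q y (sc s x) = s * tilt q y x" if x: "x \<in> S" and s: "0 < s" for s x
  proof (rule antisym)
    have "(1 / s) * tilt q y (sc s x) \<le> tilt q y (sc (1 / s) (sc s x))"
      using x s S by (intro scale_le) (auto intro: subspace_scale)
    then show "tilt q y (sc s x) \<le> s * tilt q y x"
      using s by (simp add: field_simps)
  qed (rule scale_le[OF x s])
  then show "sublinear_on sc S (tilt q y)"
    using add by (auto simp: sublinear_on_def)
qed

text \<open>
  Zorn's lemma: the pointwise infimum of a chain is again sublinear, since subadditivity for two
  members of the chain follows from that of the smaller one, and it stays finite because \<open>q x \<ge> - \<pi> (- x)\<close> for every
  sublinear \<open>q \<le> \<pi>\<close>. Extending by zero outside \<open>S\<close> makes the pointwise order antisymmetric.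
\<close>

lemma minimal_sublinear_exists:
  assumes \<pi>: "sublinear_on sc S \<pi>"
  shows "\<exists>q. sublinear_on sc S q \<and> (\<forall>x\<in>S. q x \<le> \<pi> x) \<and>
     (\<forall>r. sublinear_on sc S r \<longrightarrow> (\<forall>x\<in>S. r x \<le> q x) \<longrightarrow> (\<forall>x\<in>S. r x = q x))"
proof -
  define A where "A = {q. sublinear_on sc S q \<and> (\<forall>x\<in>S. q x \<le> \<pi> x) \<and> (\<forall>x. x \<notin> S \<longrightarrow> q x = 0)}"
  define P where "P = (\<lambda>a b :: 'w \<Rightarrow> real. \<forall>x. b x \<le> a x)"
  have restr: "sublinear_on sc S (\<lambda>x. if x \<in> S then r x else 0)" if "sublinear_on sc S r" for r
    using that S by (auto simp: sublinear_on_def subspace_add subspace_scale)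
  have "\<exists>q\<in>A. \<forall>r\<in>A. P q r \<longrightarrow> r = q"
  proof (rule predicate_Zorn)
    show "partial_order_on A (relation_of P A)"
      by (rule partial_order_on_relation_ofI)
        (simp_all add: P_def fun_eq_iff, blast intro: order_trans, blast intro: antisym)
  next
    fix C assume C: "C \<in> Chains (relation_of P A)"
    have CA: "C \<subseteq> A" and tot: "\<And>a b. a \<in> C \<Longrightarrow> b \<in> C \<Longrightarrow> P a b \<or> P b a"
      using C by (auto simp: Chains_def relation_of_def)
    show "\<exists>u\<in>A. \<forall>a\<in>C. P a u"
    proof (cases "C = {}")
      case True
      have "(\<lambda>x. if x \<in> S then \<pi> x else 0) \<in> A"
        using restr[OF \<pi>] by (auto simp: A_def)
      then show ?thesis using True by auto
    next
      case False
      define u where "u = (\<lambda>x. INF q\<in>C. q x)"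
      have bdd: "bdd_below ((\<lambda>q. q x) ` C)" for x
      proof (cases "x \<in> S")
        case True
        have "- \<pi> (- x) \<le> q x" if "q \<in> C" for q
          using sublinear_on_lower[of q x] that CA True subspace_neg[OF S True]
          unfolding A_def by fastforce
        then show ?thesis by (auto intro!: bdd_belowI)
      next
        case False
        then have "0 \<le> q x" if "q \<in> C" for q
          using that CA by (auto simp: A_def)
        then show ?thesis by (auto intro!: bdd_belowI)
      qed
      have le: "u x \<le> q x" if "q \<in> C" for q x
        unfolding u_def using bdd that by (rule cINF_lower)
      have greatest: "z \<le> u x" if "\<And>q. q \<in> C \<Longrightarrow> z \<le> q x" for z x
        unfolding u_def using False that by (rule cINF_greatest)
      have sub: "sublinear_on sc S q" if "q \<in> C" for q
        using that CA by (auto simp: A_def)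
      have add: "u (x + y) \<le> u x + u y" if xy: "x \<in> S" "y \<in> S" for x y
      proof -
        have split: "u (x + y) \<le> q1 x + q2 y" if q: "q1 \<in> C" "q2 \<in> C" for q1 q2
        proof (cases "P q1 q2")
          case True
          have "u (x + y) \<le> q2 (x + y)" by (rule le[OF q(2)])
          also have "\<dots> \<le> q2 x + q2 y" by (rule sublinear_onD(1)[OF sub[OF q(2)] xy])
          also have "q2 x \<le> q1 x" using True by (simp add: P_def)
          finally show ?thesis by simp
        next
          case False
          then have "P q2 q1" using tot[OF q] by auto
          have "u (x + y) \<le> q1 (x + y)" by (rule le[OF q(1)])
          moreover have "q1 (x + y) \<le> q1 x + q1 y" by (rule sublinear_onD(1)[OF sub[OF q(1)] xy])
          moreover have "q1 y \<le> q2 y" using \<open>P q2 q1\<close> by (simp add: P_def)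
          ultimately show ?thesis by linarith
        qed
        have "u (x + y) - q1 x \<le> q2 y" if "q1 \<in> C" "q2 \<in> C" for q1 q2
          using split[OF that] by linarith
        then have "u (x + y) - q1 x \<le> u y" if "q1 \<in> C" for q1
          using that by (intro greatest)
        then have "u (x + y) - u y \<le> q1 x" if "q1 \<in> C" for q1
          using that by fastforce
        then have "u (x + y) - u y \<le> u x"
          by (rule greatest)
        then show ?thesis by simp
      qed
      have scale_le: "s * u x \<le> u (sc s x)" if x: "x \<in> S" and s: "0 < s" for s x
      proof (rule greatest)
        fix q assume "q \<in> C"
        then show "s * u x \<le> q (sc s x)"
          using le[of q x] sublinear_onD(2)[OF sub x s, of q] s by simp
      qed
      have "u (sc s x) = s * u x" if x: "x \<in> S" and s: "0 < s" for s x
      proof (rule antisym)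
        have "(1 / s) * u (sc s x) \<le> u (sc (1 / s) (sc s x))"
          using x s S by (intro scale_le) (auto intro: subspace_scale)
        then show "u (sc s x) \<le> s * u x" using s by (simp add: field_simps)
      qed (rule scale_le[OF x s])
      then have "sublinear_on sc S u" using add by (auto simp: sublinear_on_def)
      moreover have "u x \<le> \<pi> x" if "x \<in> S" for x
      proof -
        obtain q where "q \<in> C" using False by auto
        then show ?thesis using le[of q x] CA that unfolding A_def by fastforce
      qed
      moreover have "u x = 0" if "x \<notin> S" for x
      proof -
        have "(\<lambda>q. q x) ` C = {0}" using False CA that by (force simp: A_def)
        then show ?thesis by (simp add: u_def)
      qed
      ultimately have "u \<in> A" by (auto simp: A_def)
      then show ?thesis using le by (auto simp: P_def)
    qed
  qed
  then obtain q where q: "q \<in> A" and min: "\<And>r. r \<in> A \<Longrightarrow> P q r \<Longrightarrow> r = q" by blast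
  have "r x = q x" if r: "sublinear_on sc S r" "\<forall>x\<in>S. r x \<le> q x" and x: "x \<in> S" for r x
  proof -
    let ?r = "\<lambda>x. if x \<in> S then r x else 0"
    have "?r \<in> A" using restr[OF r(1)] r(2) q by (force simp: A_def)
    moreover have "P q ?r" using r(2) q by (auto simp: P_def A_def)
    ultimately have "?r = q" by (rule min)
    from fun_cong[OF this, of x] show ?thesis using x by simp
  qed
  with q show ?thesis unfolding A_def by blast
qed

text \<open>
  A minimal sublinear functional \<open>q\<close> is linear, for it coincides with each of its tilts, which
  forces \<open>q x + q y \<le> q (x + y)\<close>. Minimality is applied below the tilt of \<open>\<pi>\<close> along \<open>w\<close>, so
  that the resulting functional is still as large as \<open>\<pi>\<close> at \<open>w\<close>.
\<close>

theorem hahn_banach_sublinear: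
  assumes \<pi>: "sublinear_on sc S \<pi>" and w: "w \<in> S"
  shows "\<exists>L. (\<forall>x\<in>S. \<forall>y\<in>S. L (x + y) = L x + L y) \<and> (\<forall>t. \<forall>x\<in>S. L (sc t x) = t * L x) \<and>
     (\<forall>x\<in>S. L x \<le> \<pi> x) \<and> \<pi> w \<le> L w"
proof -
  obtain q where q: "sublinear_on sc S q" and q_le: "\<And>x. x \<in> S \<Longrightarrow> q x \<le> tilt \<pi> w x"
    and min: "\<And>r x. sublinear_on sc S r \<Longrightarrow> (\<forall>x\<in>S. r x \<le> q x) \<Longrightarrow> x \<in> S \<Longrightarrow> r x = q x"
    using minimal_sublinear_exists[OF sublinear_on_tilt[OF \<pi> w]] by metis
  have add: "q (x + y) = q x + q y" if x: "x \<in> S" and y: "y \<in> S" for x y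
  proof (rule antisym)
    have "tilt q y x = q x"
    proof (rule min[OF sublinear_on_tilt[OF q y] _ x])
      show "\<forall>x\<in>S. tilt q y x \<le> q x" using tilt_le_shift[OF q y, of _ 0] by simp
    qed
    then show "q x + q y \<le> q (x + y)" using tilt_le_shift[OF q y x, of 1] by simp
  qed (rule sublinear_onD(1)[OF q x y])
  have neg: "q (- x) = - q x" if "x \<in> S" for x
    using add[OF that subspace_neg[OF S that]] sublinear_on_zero[OF q] by simp
  have "q (sc t x) = t * q x" if x: "x \<in> S" for t x
  proof -
    consider "t > 0" | "t = 0" | "- t > 0" by linarith
    then show ?thesis
    proof cases
      case 3
      have "q (sc (- t) x) = - t * q x" using 3 by (intro sublinear_onD(2)[OF q x]) auto
      then show ?thesis using neg[OF subspace_scale[OF S x, of t]] by simp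
    qed (use sublinear_onD(2)[OF q x] sublinear_on_zero[OF q] in auto)
  qed
  moreover have "q x \<le> \<pi> x" if "x \<in> S" for x
    using q_le[OF that] tilt_le_shift[OF \<pi> w that, of 0] by simp
  moreover have "\<pi> w \<le> q w"
    using q_le[OF subspace_neg[OF S w]] tilt_le_shift[OF \<pi> w subspace_neg[OF S w], of 1]
      neg[OF w] sublinear_on_zero[OF \<pi>] by simp
  ultimately show ?thesis using add by blast
qed

text \<open>
  The form in which the theorem is used: \<open>\<Gamma>\<close> is a convex cone of pairs of a vector and a bound
  for it, and its lower envelope \<open>x \<mapsto> Inf {r. \<Gamma> x r}\<close> is sublinear.
\<close>

theorem hahn_banach_cone:
  assumes add: "\<And>x y r s. \<Gamma> x r \<Longrightarrow> \<Gamma> y s \<Longrightarrow> \<Gamma> (x + y) (r + s)"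
    and sc_closed: "\<And>x r t. 0 < t \<Longrightarrow> \<Gamma> x r \<Longrightarrow> \<Gamma> (sc t x) (t * r)"
    and nonneg: "\<And>x r. \<Gamma> x r \<Longrightarrow> 0 \<le> r"
    and total: "\<And>x. x \<in> S \<Longrightarrow> \<exists>r. \<Gamma> x r"
    and w: "w \<in> S" and c: "\<And>r. \<Gamma> w r \<Longrightarrow> c \<le> r"
  shows "\<exists>L. (\<forall>x\<in>S. \<forall>y\<in>S. L (x + y) = L x + L y) \<and> (\<forall>t. \<forall>x\<in>S. L (sc t x) = t * L x) \<and>
     (\<forall>x\<in>S. \<forall>r. \<Gamma> x r \<longrightarrow> L x \<le> r) \<and> c \<le> L w"
proof -
  define \<pi> where "\<pi> x = Inf {r. \<Gamma> x r}" for x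
  have le: "\<pi> x \<le> r" if "\<Gamma> x r" for x r
    unfolding \<pi>_def using that nonneg by (intro cInf_lower bdd_belowI[of _ 0]) auto
  have greatest: "z \<le> \<pi> x" if "x \<in> S" "\<And>r. \<Gamma> x r \<Longrightarrow> z \<le> r" for z x
    unfolding \<pi>_def using that total by (intro cInf_greatest) auto
  have "\<pi> (x + y) \<le> \<pi> x + \<pi> y" if "x \<in> S" "y \<in> S" for x y
  proof -
    have "\<pi> (x + y) - r \<le> \<pi> y" if "\<Gamma> x r" for r
    proof (rule greatest[OF \<open>y \<in> S\<close>])
      fix s assume "\<Gamma> y s"
      show "\<pi> (x + y) - r \<le> s" using le[OF add[OF that \<open>\<Gamma> y s\<close>]] by linarith
    qed
    then have "\<pi> (x + y) - \<pi> y \<le> \<pi> x"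
      using \<open>x \<in> S\<close> by (intro greatest) (auto simp: algebra_simps)
    then show ?thesis by simp
  qed
  moreover have scale_le: "\<pi> (sc t x) \<le> t * \<pi> x" if "x \<in> S" "0 < t" for t x
  proof -
    have "\<pi> (sc t x) / t \<le> \<pi> x"
      using that le[OF sc_closed[OF that(2)]] by (intro greatest) (auto simp: field_simps)
    then show ?thesis using that by (simp add: field_simps)
  qed
  moreover have "t * \<pi> x \<le> \<pi> (sc t x)" if "x \<in> S" "0 < t" for t x
    using scale_le[of "sc t x" "1 / t"] that subspace_scale[OF S, of x t] by (simp add: field_simps)
  ultimately have sub: "sublinear_on sc S \<pi>" unfolding sublinear_on_def by (meson antisym)
  then obtain L where L: "\<forall>x\<in>S. \<forall>y\<in>S. L (x + y) = L x + L y" "\<forall>t. \<forall>x\<in>S. L (sc t x) = t * L x"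
     "\<forall>x\<in>S. L x \<le> \<pi> x" "\<pi> w \<le> L w"
    using hahn_banach_sublinear[OF sub w] by blast
  have "\<forall>x\<in>S. \<forall>r. \<Gamma> x r \<longrightarrow> L x \<le> r" using L(3) le by (meson order_trans)
  moreover have "c \<le> L w" using greatest[OF w c] L(4) by simp
  ultimately show ?thesis using L(1,2) by blast
qed

end

section \<open>Bounds for bilinear forms\<close>

abbreviation l2 :: "'i set \<Rightarrow> ('i \<Rightarrow> complex) \<Rightarrow> real" where
  "l2 I \<xi> \<equiv> L2_set (\<lambda>i. cmod (\<xi> i)) I"

text \<open>
  Operator norm bounds for scalar matrices are handled as bounds of bilinear forms with arbitrary
  index sets. Block matrices are then indexed by pairs, and the permutations of rows and columns
  that identify different block structures are mere reindexings. The forms are bilinear instead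
  of sesquilinear, which does not change the bound.
\<close>

definition bilin_le :: "'i set \<Rightarrow> 'j set \<Rightarrow> ('i \<Rightarrow> 'j \<Rightarrow> complex) \<Rightarrow> real \<Rightarrow> bool" where
  "bilin_le I J A C \<longleftrightarrow>
     (\<forall>\<eta> \<xi>. cmod (\<Sum>i\<in>I. \<Sum>j\<in>J. \<eta> i * A i j * \<xi> j) \<le> C * l2 I \<eta> * l2 J \<xi>)"

lemma l2_scale: "l2 I (\<lambda>i. c * \<xi> i) = cmod c * l2 I \<xi>"
  by (simp add: L2_set_right_distrib norm_mult)

lemma l2_power2: "(l2 I \<xi>)\<^sup>2 = (\<Sum>i\<in>I. (cmod (\<xi> i))\<^sup>2)"
  by (simp add: L2_set_def sum_nonneg)

lemma l2_le_iff: "0 \<le> C \<Longrightarrow> l2 I \<xi> \<le> C \<longleftrightarrow> (\<Sum>i\<in>I. (cmod (\<xi> i))\<^sup>2) \<le> C\<^sup>2"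
  by (metis L2_set_nonneg abs_of_nonneg l2_power2 power2_le_iff_abs_le power_mono)

lemma cauchy_schwarz_sum: "cmod (\<Sum>i\<in>I. \<eta> i * \<xi> i) \<le> l2 I \<eta> * l2 I \<xi>"
proof -
  have "cmod (\<Sum>i\<in>I. \<eta> i * \<xi> i) \<le> (\<Sum>i\<in>I. \<bar>cmod (\<eta> i)\<bar> * \<bar>cmod (\<xi> i)\<bar>)"
    by (rule order_trans[OF norm_sum]) (simp add: norm_mult)
  also have "\<dots> \<le> l2 I \<eta> * l2 I \<xi>" by (rule L2_set_mult_ineq)
  finally show ?thesis .
qed

lemma bilin_leD:
  "bilin_le I J A C \<Longrightarrow> cmod (\<Sum>i\<in>I. \<Sum>j\<in>J. \<eta> i * A i j * \<xi> j) \<le> C * l2 I \<eta> * l2 J \<xi>"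
  by (simp add: bilin_le_def)

lemma bilin_le_mono: "bilin_le I J A C \<Longrightarrow> C \<le> C' \<Longrightarrow> bilin_le I J A C'"
  unfolding bilin_le_def by (meson L2_set_nonneg mult_right_mono order_trans)

lemma bilin_le_cong:
  "(\<And>i j. i \<in> I \<Longrightarrow> j \<in> J \<Longrightarrow> A i j = B i j) \<Longrightarrow> bilin_le I J A C = bilin_le I J B C"
  unfolding bilin_le_def by (simp cong: sum.cong)

lemma bilin_le_unitI:
  assumes fin: "finite I" "finite J" and C: "0 \<le> C"
    and unit: "\<And>\<eta> \<xi>. (\<Sum>i\<in>I. (cmod (\<eta> i))\<^sup>2) \<le> 1 \<Longrightarrow> (\<Sum>j\<in>J. (cmod (\<xi> j))\<^sup>2) \<le> 1 \<Longrightarrow>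
      cmod (\<Sum>i\<in>I. \<Sum>j\<in>J. \<eta> i * A i j * \<xi> j) \<le> C"
  shows "bilin_le I J A C"
  unfolding bilin_le_def
proof (intro allI)
  fix \<eta> \<xi>
  show "cmod (\<Sum>i\<in>I. \<Sum>j\<in>J. \<eta> i * A i j * \<xi> j) \<le> C * l2 I \<eta> * l2 J \<xi>"
  proof (cases "l2 I \<eta> = 0 \<or> l2 J \<xi> = 0")
    case True
    then have "(\<forall>i\<in>I. \<eta> i = 0) \<or> (\<forall>j\<in>J. \<xi> j = 0)"
      using fin by (auto simp: L2_set_eq_0_iff)
    then have "(\<Sum>i\<in>I. \<Sum>j\<in>J. \<eta> i * A i j * \<xi> j) = 0"
      by (auto intro!: sum.neutral)
    then show ?thesis using True by auto
  next
    case False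
    define s where "s = l2 I \<eta>"
    define t where "t = l2 J \<xi>"
    have st: "0 < s" "0 < t" using False by (auto simp: s_def t_def less_le)
    have n1: "(\<Sum>i\<in>I. (cmod (of_real (1 / s) * \<eta> i))\<^sup>2) \<le> 1"
      using st unfolding l2_power2[symmetric] l2_scale by (simp add: s_def[symmetric] t_def[symmetric] norm_divide)
    have n2: "(\<Sum>i\<in>J. (cmod (of_real (1 / t) * \<xi> i))\<^sup>2) \<le> 1"
      using st unfolding l2_power2[symmetric] l2_scale by (simp add: s_def[symmetric] t_def[symmetric] norm_divide)
    have "(\<Sum>i\<in>I. \<Sum>j\<in>J. (of_real (1 / s) * \<eta> i) * A i j * (of_real (1 / t) * \<xi> j))
        = of_real (1 / (s * t)) * (\<Sum>i\<in>I. \<Sum>j\<in>J. \<eta> i * A i j * \<xi> j)"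
      by (simp add: sum_distrib_left algebra_simps)
    with unit[OF n1 n2] st have "cmod (\<Sum>i\<in>I. \<Sum>j\<in>J. \<eta> i * A i j * \<xi> j) / (s * t) \<le> C"
      by (simp add: norm_mult norm_divide)
    then show ?thesis
      using st unfolding s_def[symmetric] t_def[symmetric] by (simp add: field_simps)
  qed
qed

text \<open>
  Test the bilinear form on the conjugate of the image vector.
\<close>

lemma bilin_le_row:
  assumes "bilin_le I J A C" "0 \<le> C"
  shows "l2 I (\<lambda>i. \<Sum>j\<in>J. A i j * \<xi> j) \<le> C * l2 J \<xi>"
proof (cases "l2 I (\<lambda>i. \<Sum>j\<in>J. A i j * \<xi> j) = 0")
  case True
  then show ?thesis using assms(2) by simp
next
  case False
  let ?v = "\<lambda>i. \<Sum>j\<in>J. A i j * \<xi> j"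
  have eq: "of_real ((l2 I ?v)\<^sup>2) = (\<Sum>i\<in>I. \<Sum>j\<in>J. cnj (?v i) * A i j * \<xi> j)"
  proof -
    have "of_real ((cmod z)\<^sup>2) = cnj z * z" for z
      by (metis complex_norm_square mult.commute)
    then show ?thesis
      unfolding l2_power2 of_real_sum by (simp add: sum_distrib_left mult.assoc)
  qed
  have "(l2 I ?v)\<^sup>2 = cmod (of_real ((l2 I ?v)\<^sup>2))"
    unfolding norm_of_real by simp
  also have "\<dots> = cmod (\<Sum>i\<in>I. \<Sum>j\<in>J. cnj (?v i) * A i j * \<xi> j)"
    unfolding eq ..
  also have "\<dots> \<le> C * l2 I ?v * l2 J \<xi>"
    using bilin_leD[OF assms(1), of "\<lambda>i. cnj (?v i)" \<xi>] unfolding complex_mod_cnj .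
  finally have "l2 I ?v * l2 I ?v \<le> l2 I ?v * (C * l2 J \<xi>)"
    by (simp add: power2_eq_square mult_ac)
  moreover have "0 < l2 I ?v" using False by (simp add: less_le)
  ultimately show ?thesis by simp
qed

lemma bilin_le_scale:
  assumes "bilin_le I J A C"
  shows "bilin_le I J (\<lambda>i j. c * A i j) (cmod c * C)"
  unfolding bilin_le_def
proof (intro allI)
  fix \<eta> \<xi>
  have "cmod (\<Sum>i\<in>I. \<Sum>j\<in>J. \<eta> i * (c * A i j) * \<xi> j) = cmod c * cmod (\<Sum>i\<in>I. \<Sum>j\<in>J. \<eta> i * A i j * \<xi> j)"
    unfolding norm_mult[symmetric] sum_distrib_left by (simp add: mult_ac)
  also have "\<dots> \<le> cmod c * (C * l2 I \<eta> * l2 J \<xi>)"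
    by (intro mult_left_mono bilin_leD assms) simp
  finally show "cmod (\<Sum>i\<in>I. \<Sum>j\<in>J. \<eta> i * (c * A i j) * \<xi> j) \<le> cmod c * C * l2 I \<eta> * l2 J \<xi>"
    by (simp only: mult.assoc)
qed

lemma bilin_le_entry:
  assumes "bilin_le I J A C" "finite I" "finite J" "i \<in> I" "j \<in> J"
  shows "cmod (A i j) \<le> C"
proof -
  have l2_1: "l2 K (\<lambda>x. if x = y then 1 else 0) = 1" if "finite K" "y \<in> K" for K and y :: 'x
  proof -
    have "(\<Sum>x\<in>K. (cmod (if x = y then 1 else 0))\<^sup>2) = (\<Sum>x\<in>K. if x = y then 1 else 0)"
      by (intro sum.cong) auto
    then show ?thesis using that by (simp add: L2_set_def)
  qed
  have "(\<Sum>x\<in>I. \<Sum>y\<in>J. (if x = i then 1 else 0) * A x y * (if y = j then 1 else 0))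
      = (\<Sum>x\<in>I. \<Sum>y\<in>J. if y = j then (if x = i then A i j else 0) else 0)"
    by (intro sum.cong refl) auto
  also have "\<dots> = A i j" using assms by simp
  finally show ?thesis
    using bilin_leD[OF assms(1), of "\<lambda>x. if x = i then 1 else 0" "\<lambda>y. if y = j then 1 else 0"] assms
    by (simp add: l2_1)
qed

lemma bilin_le_transpose:
  assumes "bilin_le I J A C"
  shows "bilin_le J I (\<lambda>j i. A i j) C"
  unfolding bilin_le_def
proof (intro allI)
  fix \<eta> \<xi>
  have "(\<Sum>j\<in>J. \<Sum>i\<in>I. \<eta> j * A i j * \<xi> i) = (\<Sum>i\<in>I. \<Sum>j\<in>J. \<xi> i * A i j * \<eta> j)"
    by (subst sum.swap) (simp add: mult_ac)
  then show "cmod (\<Sum>j\<in>J. \<Sum>i\<in>I. \<eta> j * A i j * \<xi> i) \<le> C * l2 J \<eta> * l2 I \<xi>"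
    using bilin_leD[OF assms, of \<xi> \<eta>] by (simp add: mult_ac)
qed

lemma bilin_le_rowI:
  assumes "\<And>\<xi>. l2 I (\<lambda>i. \<Sum>j\<in>J. A i j * \<xi> j) \<le> C * l2 J \<xi>"
  shows "bilin_le I J A C"
  unfolding bilin_le_def
proof (intro allI)
  fix \<eta> \<xi>
  have "cmod (\<Sum>i\<in>I. \<Sum>j\<in>J. \<eta> i * A i j * \<xi> j) = cmod (\<Sum>i\<in>I. \<eta> i * (\<Sum>j\<in>J. A i j * \<xi> j))"
    by (simp add: sum_distrib_left mult_ac)
  also have "\<dots> \<le> l2 I \<eta> * l2 I (\<lambda>i. \<Sum>j\<in>J. A i j * \<xi> j)" by (rule cauchy_schwarz_sum)
  also have "\<dots> \<le> l2 I \<eta> * (C * l2 J \<xi>)" by (intro mult_left_mono assms) simp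
  finally show "cmod (\<Sum>i\<in>I. \<Sum>j\<in>J. \<eta> i * A i j * \<xi> j) \<le> C * l2 I \<eta> * l2 J \<xi>"
    by (simp add: mult_ac)
qed

lemma bilin_le_sum_entries:
  assumes "finite I" "finite J"
  shows "bilin_le I J A (\<Sum>i\<in>I. \<Sum>j\<in>J. cmod (A i j))"
  unfolding bilin_le_def
proof (intro allI)
  fix \<eta> \<xi>
  have "cmod (\<Sum>i\<in>I. \<Sum>j\<in>J. \<eta> i * A i j * \<xi> j) \<le> (\<Sum>i\<in>I. \<Sum>j\<in>J. cmod (\<eta> i * A i j * \<xi> j))"
    by (intro order_trans[OF norm_sum] sum_mono) simp
  also have "\<dots> \<le> (\<Sum>i\<in>I. \<Sum>j\<in>J. cmod (A i j) * (l2 I \<eta> * l2 J \<xi>))"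
  proof (intro sum_mono)
    fix i j assume "i \<in> I" "j \<in> J"
    then have "cmod (\<eta> i) * cmod (\<xi> j) \<le> l2 I \<eta> * l2 J \<xi>"
      using assms by (intro mult_mono member_le_L2_set) auto
    from mult_left_mono[OF this, of "cmod (A i j)"]
    show "cmod (\<eta> i * A i j * \<xi> j) \<le> cmod (A i j) * (l2 I \<eta> * l2 J \<xi>)"
      by (simp add: norm_mult mult_ac)
  qed
  finally show "cmod (\<Sum>i\<in>I. \<Sum>j\<in>J. \<eta> i * A i j * \<xi> j)
      \<le> (\<Sum>i\<in>I. \<Sum>j\<in>J. cmod (A i j)) * l2 I \<eta> * l2 J \<xi>"
    by (simp add: sum_distrib_right mult.assoc)
qed

lemma bilin_le_reindex:
  fixes f :: "'c \<Rightarrow> 'a" and g :: "'d \<Rightarrow> 'b" and A :: "'a \<Rightarrow> 'b \<Rightarrow> complex"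
  assumes f: "bij_betw f I' I" and g: "bij_betw g J' J"
  shows "bilin_le I' J' (\<lambda>i j. A (f i) (g j)) C \<longleftrightarrow> bilin_le I J A C"
proof -
  have L2: "l2 I \<eta> = l2 I' (\<lambda>i. \<eta> (f i))" "l2 J \<xi> = l2 J' (\<lambda>j. \<xi> (g j))" for \<eta> \<xi>
    unfolding L2_set_def by (subst sum.reindex_bij_betw[symmetric, OF f] sum.reindex_bij_betw[symmetric, OF g], rule refl)+
  have B: "(\<Sum>i\<in>I. \<Sum>j\<in>J. \<eta> i * A i j * \<xi> j)
      = (\<Sum>i\<in>I'. \<Sum>j\<in>J'. \<eta> (f i) * A (f i) (g j) * \<xi> (g j))" for \<eta> \<xi>
    by (subst sum.reindex_bij_betw[symmetric, OF f], subst sum.reindex_bij_betw[symmetric, OF g]) (rule refl)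
  show ?thesis
  proof
    assume "bilin_le I' J' (\<lambda>i j. A (f i) (g j)) C"
    then show "bilin_le I J A C"
      unfolding bilin_le_def L2 B by (simp add: bilin_le_def)
  next
    assume A: "bilin_le I J A C"
    show "bilin_le I' J' (\<lambda>i j. A (f i) (g j)) C"
      unfolding bilin_le_def
    proof (intro allI)
      fix \<eta> :: "'c \<Rightarrow> complex" and \<xi> :: "'d \<Rightarrow> complex"
      let ?\<eta> = "\<lambda>i. \<eta> (inv_into I' f i)" and ?\<xi> = "\<lambda>j. \<xi> (inv_into J' g j)"
      have i1: "i \<in> I' \<Longrightarrow> inv_into I' f (f i) = i" and i2: "j \<in> J' \<Longrightarrow> inv_into J' g (g j) = j" for i j
        using f g by (auto simp: bij_betw_def)
      show "cmod (\<Sum>i\<in>I'. \<Sum>j\<in>J'. \<eta> i * A (f i) (g j) * \<xi> j) \<le> C * l2 I' \<eta> * l2 J' \<xi>"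
        using bilin_leD[OF A, of ?\<eta> ?\<xi>] unfolding L2 B by (simp add: i1 i2 cong: sum.cong L2_set_cong)
    qed
  qed
qed

lemma bilin_le_prod_swap:
  "bilin_le (K \<times> I) (L \<times> J) (\<lambda>(k, i) (l, j). A k i l j) C \<longleftrightarrow>
   bilin_le (I \<times> K) (J \<times> L) (\<lambda>(i, k) (j, l). A k i l j) C"
proof -
  have "bij_betw prod.swap (K \<times> I) (I \<times> K)" "bij_betw prod.swap (L \<times> J) (J \<times> L)"
    by (auto intro!: bij_betw_imageI inj_onI simp: image_iff)
  from bilin_le_reindex[OF this, of "\<lambda>(i, k) (j, l). A k i l j" C] show ?thesis
    by (simp add: case_prod_unfold)
qed

lemma bij_betw_div_mod:
  "bij_betw (\<lambda>(i, a). i * k + a) ({..<N} \<times> {..<k}) {..<N * k :: nat}"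
proof (rule bij_betw_byWitness[where f' = "\<lambda>p. (p div k, p mod k)"])
  show "(\<lambda>(i, a). i * k + a) ` ({..<N} \<times> {..<k}) \<subseteq> {..<N * k}"
  proof clarsimp
    fix i a assume "i < N" "a < k"
    then have "i * k + a < Suc i * k" by simp
    also have "\<dots> \<le> N * k" using \<open>i < N\<close> by (intro mult_right_mono) auto
    finally show "i * k + a < N * k" .
  qed
  show "(\<lambda>p. (p div k, p mod k)) ` {..<N * k} \<subseteq> {..<N} \<times> {..<k}"
    by (auto simp: less_mult_imp_div_less intro!: mod_less_divisor gr0I)
qed (auto)

lemma div_mod_less: "i * k + p < N * k" if "i < N" "p < k" for i k p N :: nat
  using bij_betw_apply[OF bij_betw_div_mod, of "(i, p)" N k] that by simp

lemma sum_div_mod: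
  "(\<Sum>p<N * k. g p) = (\<Sum>i<N. \<Sum>a<k. g (i * k + a))" for g :: "nat \<Rightarrow> 'a::comm_monoid_add"
  using sum.reindex_bij_betw[OF bij_betw_div_mod, of g k N]
  by (simp add: sum.cartesian_product case_prod_unfold)

lemma bilin_le_div_mod:
  fixes N k M l :: nat
  shows
  "bilin_le {..<N * k} {..<M * l} A C \<longleftrightarrow>
   bilin_le ({..<N} \<times> {..<k}) ({..<M} \<times> {..<l}) (\<lambda>(i, a) (j, b). A (i * k + a) (j * l + b)) C"
  using bilin_le_reindex[where A = A and C = C, OF bij_betw_div_mod[of k N] bij_betw_div_mod[of l M]]
  by (simp add: case_prod_unfold)

lemma sum_swap_triple:
  "(\<Sum>a\<in>A. \<Sum>b\<in>B. \<Sum>t\<in>T. f a b t) = (\<Sum>t\<in>T. \<Sum>a\<in>A. \<Sum>b\<in>B. f a b t)"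
proof -
  have "(\<Sum>a\<in>A. \<Sum>b\<in>B. \<Sum>t\<in>T. f a b t) = (\<Sum>a\<in>A. \<Sum>t\<in>T. \<Sum>b\<in>B. f a b t)"
    by (intro sum.cong refl sum.swap)
  also have "\<dots> = (\<Sum>t\<in>T. \<Sum>a\<in>A. \<Sum>b\<in>B. f a b t)" by (rule sum.swap)
  finally show ?thesis .
qed

lemma sum_swap_pairs:
  "(\<Sum>x\<in>A. \<Sum>y\<in>B. \<Sum>z\<in>C. \<Sum>w\<in>E. f x y z w) = (\<Sum>z\<in>C. \<Sum>w\<in>E. \<Sum>x\<in>A. \<Sum>y\<in>B. f x y z w)"
proof -
  have "(\<Sum>x\<in>A. \<Sum>y\<in>B. \<Sum>z\<in>C. \<Sum>w\<in>E. f x y z w)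
      = (\<Sum>p\<in>A \<times> B. \<Sum>q\<in>C \<times> E. f (fst p) (snd p) (fst q) (snd q))"
    by (simp add: sum.cartesian_product')
  also have "\<dots> = (\<Sum>q\<in>C \<times> E. \<Sum>p\<in>A \<times> B. f (fst p) (snd p) (fst q) (snd q))"
    by (rule sum.swap)
  finally show ?thesis by (simp add: sum.cartesian_product')
qed

text \<open>
  A block diagonal matrix is bounded by any common bound of its blocks, by the Cauchy--Schwarz
  inequality for the sum over the blocks.
\<close>

lemma bilin_le_block_diag:
  assumes "\<And>l. l \<in> L \<Longrightarrow> bilin_le I J (A l) C" "0 \<le> C"
  shows "cmod (\<Sum>l\<in>L. \<Sum>i\<in>I. \<Sum>j\<in>J. \<eta> l i * A l i j * \<xi> l j)
     \<le> C * l2 (L \<times> I) (\<lambda>(l, i). \<eta> l i) * l2 (L \<times> J) (\<lambda>(l, j). \<xi> l j)"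
proof -
  have prod: "L2_set (\<lambda>l. l2 K (\<zeta> l)) L = l2 (L \<times> K) (\<lambda>(l, i). \<zeta> l i)" for K and \<zeta> :: "'a \<Rightarrow> 'd \<Rightarrow> complex"
    unfolding L2_set_def by (simp add: sum_nonneg sum.cartesian_product case_prod_unfold)
  have prod': "L2_set (\<lambda>l. l2 K (\<zeta> l)) L = l2 (L \<times> K) (\<lambda>(l, i). \<zeta> l i)" for K and \<zeta> :: "'a \<Rightarrow> 'c \<Rightarrow> complex"
    unfolding L2_set_def by (simp add: sum_nonneg sum.cartesian_product case_prod_unfold)
  have "cmod (\<Sum>l\<in>L. \<Sum>i\<in>I. \<Sum>j\<in>J. \<eta> l i * A l i j * \<xi> l j)
      \<le> (\<Sum>l\<in>L. C * (\<bar>l2 I (\<eta> l)\<bar> * \<bar>l2 J (\<xi> l)\<bar>))"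
  proof (rule order_trans[OF norm_sum], rule sum_mono)
    fix l assume "l \<in> L"
    from bilin_leD[OF assms(1)[OF this], of "\<eta> l" "\<xi> l"]
    show "cmod (\<Sum>i\<in>I. \<Sum>j\<in>J. \<eta> l i * A l i j * \<xi> l j) \<le> C * (\<bar>l2 I (\<eta> l)\<bar> * \<bar>l2 J (\<xi> l)\<bar>)"
      by (simp only: abs_of_nonneg[OF L2_set_nonneg] mult.assoc)
  qed
  also have "\<dots> \<le> C * (l2 (L \<times> I) (\<lambda>(l, i). \<eta> l i) * l2 (L \<times> J) (\<lambda>(l, j). \<xi> l j))"
    unfolding sum_distrib_left[symmetric] prod[symmetric] prod'[symmetric]
    by (intro mult_left_mono L2_set_mult_ineq assms(2))
  finally show ?thesis by (simp add: mult_ac)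
qed

text \<open>
  Tensoring a matrix with the identity of size \<open>k\<close> does not increase its norm.
\<close>

lemma l2_amplified:
  fixes N n m k :: nat
  assumes M: "\<And>\<zeta>. l2 {..<N * n} (\<lambda>r. \<Sum>a<m. M r a * \<zeta> a) \<le> C * l2 {..<m} \<zeta>" and C: "0 \<le> C"
  shows "l2 ({..<N} \<times> {..<n} \<times> {..<k}) (\<lambda>(l, i, p). \<Sum>a<m. M (l * n + i) a * \<eta> (p, a))
    \<le> C * l2 ({..<k} \<times> {..<m}) \<eta>" (is "?L \<le> _")
proof (rule power2_le_imp_le)
  have "?L\<^sup>2 = (\<Sum>l<N. \<Sum>i<n. \<Sum>p<k. (cmod (\<Sum>a<m. M (l * n + i) a * \<eta> (p, a)))\<^sup>2)"
    by (simp add: l2_power2 sum.cartesian_product')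
  also have "\<dots> = (\<Sum>p<k. \<Sum>l<N. \<Sum>i<n. (cmod (\<Sum>a<m. M (l * n + i) a * \<eta> (p, a)))\<^sup>2)"
    by (rule sum_swap_triple)
  also have "\<dots> = (\<Sum>p<k. (l2 {..<N * n} (\<lambda>r. \<Sum>a<m. M r a * \<eta> (p, a)))\<^sup>2)"
    unfolding l2_power2 sum_div_mod ..
  also have "\<dots> \<le> (\<Sum>p<k. (C * l2 {..<m} (\<lambda>a. \<eta> (p, a)))\<^sup>2)"
    by (intro sum_mono power_mono M) simp
  also have "\<dots> = (C * l2 ({..<k} \<times> {..<m}) \<eta>)\<^sup>2"
    by (simp add: power_mult_distrib l2_power2 sum.cartesian_product' sum_distrib_left)
  finally show "?L\<^sup>2 \<le> (C * l2 ({..<k} \<times> {..<m}) \<eta>)\<^sup>2" .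
qed (use C in simp)

section \<open>Orthonormal frames for positive functionals\<close>

abbreviation std_basis :: "nat \<Rightarrow> nat \<Rightarrow> complex" where
  "std_basis k \<equiv> (\<lambda>b. if b = k then 1 else 0)"

lemma sum_fun_apply: "(\<Sum>i\<in>I. f i) x = (\<Sum>i\<in>I. f i x)"
  by (induction I rule: infinite_finite_induct) auto

text \<open>
  Gram--Schmidt applied to the standard basis of \<open>\<complex>\<^sup>m\<close> for an arbitrary definite Hermitian form
  \<open>h\<close>, with the orthonormality of the result expressed as Parseval's identity.
\<close>

lemma gram_schmidt_std_basis:
  fixes h :: "(nat \<Rightarrow> complex) \<Rightarrow> (nat \<Rightarrow> complex) \<Rightarrow> complex"
  assumes add: "\<And>u v w. h (u + v) w = h u w + h v w"
    and scale: "\<And>c u w. h (scaleF c u) w = c * h u w"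
    and herm: "\<And>u v. h v u = cnj (h u v)"
    and pos: "\<And>v b. b < m \<Longrightarrow> v b \<noteq> 0 \<Longrightarrow> 0 < Re (h v v)"
  shows "\<exists>u a. (\<forall>c. Re (h (\<Sum>i<m. scaleF (c i) (u i)) (\<Sum>i<m. scaleF (c i) (u i))) = (\<Sum>i<m. (cmod (c i))\<^sup>2)) \<and>
     (\<forall>k<m. std_basis k = (\<Sum>i<m. scaleF (a k i) (u i)))"
proof -
  have zero: "h 0 w = 0" for w using scale[of 0 0 w] by (simp add: scaleF_def zero_fun_def)
  have sum_l: "h (\<Sum>i\<in>F. scaleF (c i) (u i)) w = (\<Sum>i\<in>F. c i * h (u i) w)" if "finite F" for F c u w
    using that
  proof induction
    case (insert x F)
    then show ?case unfolding sum.insert[OF insert(1,2)] add scale by simp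
  qed (simp only: sum.empty zero)
  have minus: "h (u - v) w = h u w - h v w" for u v w
    using add[of "u - v" v w] unfolding diff_add_cancel by simp
  have scale_r: "h w (scaleF c u) = cnj c * h w u" for c u w
    unfolding herm[where u = "scaleF c u" and v = w] herm[where u = u and v = w] scale by simp
  have "k \<le> m \<Longrightarrow> \<exists>u a. (\<forall>i<k. \<forall>j<k. h (u i) (u j) = (if i = j then 1 else 0)) \<and>
     (\<forall>i<k. \<forall>b\<ge>k. u i b = 0) \<and> (\<forall>l<k. std_basis l = (\<Sum>i<k. scaleF (a l i) (u i)))" for k
  proof (induction k)
    case (Suc k)
    have "k \<le> m" using Suc.prems by simp
    from Suc.IH[OF this] obtain u a where IH: "\<forall>i<k. \<forall>j<k. h (u i) (u j) = (if i = j then 1 else 0)"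
      "\<forall>i<k. \<forall>b\<ge>k. u i b = 0" "\<forall>l<k. std_basis l = (\<Sum>i<k. scaleF (a l i) (u i))"
      by (elim exE conjE) (rule that)
    have orth: "h (u i) (u j) = (if i = j then 1 else 0)" if "i < k" "j < k" for i j
      using IH(1) that by blast
    have supp: "u i b = 0" if "i < k" "b \<ge> k" for i b
      using IH(2) that by blast
    have exp: "std_basis l = (\<Sum>i<k. scaleF (a l i) (u i))" if "l < k" for l
      using IH(3) that by blast
    define r where "r = std_basis k - (\<Sum>i<k. scaleF (h (std_basis k) (u i)) (u i))"
    have rb: "r b = (if b = k then 1 else 0)" if "b \<ge> k" for b
      using that supp by (simp add: r_def scaleF_def sum_fun_apply)
    have r_orth: "h r (u j) = 0" if "j < k" for j
      using that by (simp add: r_def minus sum_l orth if_distrib cong: if_cong)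
    define s where "s = sqrt (Re (h r r))"
    have "0 < Re (h r r)" using Suc.prems rb[of k] by (intro pos[of k]) auto
    then have s: "s > 0" "s\<^sup>2 = Re (h r r)" by (auto simp: s_def)
    have "Im (h r r) = 0" using herm[of r r] by (simp add: complex_eq_iff)
    then have hr: "h r r = of_real (s\<^sup>2)" using s by (simp add: complex_eq_iff)
    define u' where "u' = u(k := scaleF (of_real (1 / s)) r)"
    define a' where "a' = (\<lambda>l i. if l < k then (if i < k then a l i else 0)
        else if i < k then h (std_basis k) (u i) else of_real s)"
    have "h (u' i) (u' j) = (if i = j then 1 else 0)" if "i < Suc k" "j < Suc k" for i j
    proof -
      have "h (u j) r = 0" if "j < k" for j using r_orth[OF that] herm[of r "u j"] by simp
      then show ?thesis using that orth r_orth s hr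
        by (auto simp: u'_def less_Suc_eq scale scale_r power2_eq_square)
    qed
    moreover have "u' i b = 0" if "i < Suc k" "b \<ge> Suc k" for i b
      using that supp rb by (auto simp: u'_def scaleF_def less_Suc_eq)
    moreover have "std_basis l = (\<Sum>i<Suc k. scaleF (a' l i) (u' i))" if "l < Suc k" for l
    proof (cases "l < k")
      case True
      have "(\<Sum>i<Suc k. scaleF (a' l i) (u' i)) = (\<Sum>i<k. scaleF (a l i) (u i))"
        using True by (simp add: a'_def u'_def)
      then show ?thesis using exp[OF True] by simp
    next
      case False
      then have "l = k" using that by simp
      have "(\<Sum>i<Suc k. scaleF (a' k i) (u' i)) = (\<Sum>i<k. scaleF (h (std_basis k) (u i)) (u i)) + r"
        using s by (simp add: a'_def u'_def)
      then show ?thesis using \<open>l = k\<close> by (simp add: r_def)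
    qed
    ultimately show ?case by blast
  qed auto
  from this[of m] obtain u a where orth: "\<forall>i<m. \<forall>j<m. h (u i) (u j) = (if i = j then 1 else 0)"
    and exp: "\<forall>l<m. std_basis l = (\<Sum>i<m. scaleF (a l i) (u i))" by blast
  have "Re (h (\<Sum>i<m. scaleF (c i) (u i)) (\<Sum>i<m. scaleF (c i) (u i))) = (\<Sum>i<m. (cmod (c i))\<^sup>2)" for c
  proof -
    let ?v = "\<Sum>i<m. scaleF (c i) (u i)"
    have "h (u i) ?v = cnj (c i)" if "i < m" for i
    proof -
      have "h ?v (u i) = c i"
      proof -
        have "h ?v (u i) = (\<Sum>j<m. c j * h (u j) (u i))" by (rule sum_l) simp
        also have "\<dots> = (\<Sum>j<m. if j = i then c i else 0)"
          using that orth by (intro sum.cong) auto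
        finally show ?thesis using that by simp
      qed
      then show ?thesis using herm[where u = ?v and v = "u i"] by simp
    qed
    then have "h ?v ?v = (\<Sum>i<m. c i * cnj (c i))"
      by (subst sum_l) (auto intro: sum.cong)
    then show ?thesis by (simp add: complex_mult_cnj cmod_power2)
  qed
  then show ?thesis using exp by blast
qed

definition l2_ball :: "nat \<Rightarrow> (nat \<Rightarrow> complex) set" where
  "l2_ball m = {\<xi>. (\<Sum>a<m. (cmod (\<xi> a))\<^sup>2) \<le> 1}"

text \<open>
  The linear functional of \<open>\<xi>\<close> given by the column \<open>v\<close>. The functions \<open>sqsum\<close> built from it are
  the quadratic forms \<open>\<xi> \<mapsto> \<parallel>\<xi> \<alpha>\<parallel>\<^sup>2\<close> of a scalar matrix whose columns are the \<open>\<alpha> k\<close>; their supremum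
  over the unit ball is the square of the operator norm.
\<close>

definition pairing :: "nat \<Rightarrow> (nat \<Rightarrow> complex) \<Rightarrow> (nat \<Rightarrow> complex) \<Rightarrow> complex" where
  "pairing m v \<xi> = (\<Sum>a<m. \<xi> a * v a)"

definition sqsum :: "nat \<Rightarrow> 'k set \<Rightarrow> ('k \<Rightarrow> nat \<Rightarrow> complex) \<Rightarrow> (nat \<Rightarrow> complex) \<Rightarrow> real" where
  "sqsum m K \<alpha> = (\<lambda>\<xi>. \<Sum>k\<in>K. (cmod (pairing m (\<alpha> k) \<xi>))\<^sup>2)"

definition ball_bounded :: "nat \<Rightarrow> ((nat \<Rightarrow> complex) \<Rightarrow> real) set" where
  "ball_bounded m = {g. \<exists>C. \<forall>\<xi>\<in>l2_ball m. \<bar>g \<xi>\<bar> \<le> C}"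

lemma pairing_bound:
  assumes "\<xi> \<in> l2_ball m"
  shows "cmod (pairing m v \<xi>) \<le> l2 {..<m} v"
proof -
  have "cmod (pairing m v \<xi>) \<le> l2 {..<m} \<xi> * l2 {..<m} v"
    unfolding pairing_def by (rule cauchy_schwarz_sum)
  also have "\<dots> \<le> 1 * l2 {..<m} v"
    using assms by (intro mult_right_mono) (auto simp: l2_le_iff l2_ball_def)
  finally show ?thesis by simp
qed

lemma bilin_le_sqrtI:
  fixes R m :: nat
  assumes "\<And>\<xi>. \<xi> \<in> l2_ball m \<Longrightarrow> (\<Sum>r<R. (cmod (\<Sum>a<m. \<xi> a * M r a))\<^sup>2) \<le> s" "0 \<le> s"
  shows "bilin_le {..<R} {..<m} M (sqrt s)"
proof (rule bilin_le_unitI)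
  fix \<eta> \<xi> assume *: "(\<Sum>i<R. (cmod (\<eta> i))\<^sup>2) \<le> 1" "(\<Sum>j<m. (cmod (\<xi> j))\<^sup>2) \<le> 1"
  have "cmod (\<Sum>i<R. \<Sum>j<m. \<eta> i * M i j * \<xi> j) = cmod (\<Sum>i<R. \<eta> i * (\<Sum>j<m. \<xi> j * M i j))"
    by (simp add: sum_distrib_left mult_ac)
  also have "\<dots> \<le> l2 {..<R} \<eta> * l2 {..<R} (\<lambda>i. \<Sum>j<m. \<xi> j * M i j)" by (rule cauchy_schwarz_sum)
  also have "\<dots> \<le> 1 * sqrt s"
    using * assms(1)[of \<xi>] assms(2) by (intro mult_mono) (auto simp: l2_ball_def l2_le_iff)
  finally show "cmod (\<Sum>i<R. \<Sum>j<m. \<eta> i * M i j * \<xi> j) \<le> sqrt s" by simp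
qed (use assms in auto)

lemma ball_bounded_intros:
  shows ball_bounded_const: "(\<lambda>\<xi>. r) \<in> ball_bounded m"
    and ball_bounded_add: "f \<in> ball_bounded m \<Longrightarrow> g \<in> ball_bounded m \<Longrightarrow> (\<lambda>\<xi>. f \<xi> + g \<xi>) \<in> ball_bounded m"
    and ball_bounded_scale: "f \<in> ball_bounded m \<Longrightarrow> (\<lambda>\<xi>. t * f \<xi>) \<in> ball_bounded m"
proof -
  show "(\<lambda>\<xi>. r) \<in> ball_bounded m" by (auto simp: ball_bounded_def)
next
  assume "f \<in> ball_bounded m" "g \<in> ball_bounded m"
  then obtain C D where CD: "\<forall>\<xi>\<in>l2_ball m. \<bar>f \<xi>\<bar> \<le> C" "\<forall>\<xi>\<in>l2_ball m. \<bar>g \<xi>\<bar> \<le> D"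
    by (auto simp: ball_bounded_def)
  have "\<bar>f \<xi> + g \<xi>\<bar> \<le> C + D" if "\<xi> \<in> l2_ball m" for \<xi>
    using CD that by (intro order_trans[OF abs_triangle_ineq] add_mono) auto
  then show "(\<lambda>\<xi>. f \<xi> + g \<xi>) \<in> ball_bounded m" unfolding ball_bounded_def by blast
next
  assume "f \<in> ball_bounded m"
  then obtain C where C: "\<forall>\<xi>\<in>l2_ball m. \<bar>f \<xi>\<bar> \<le> C" by (auto simp: ball_bounded_def)
  have "\<bar>t * f \<xi>\<bar> \<le> \<bar>t\<bar> * C" if "\<xi> \<in> l2_ball m" for \<xi>
    using C that by (simp add: abs_mult mult_left_mono)
  then show "(\<lambda>\<xi>. t * f \<xi>) \<in> ball_bounded m" unfolding ball_bounded_def by blast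
qed

lemma ball_bounded_sum:
  "(\<And>k. k \<in> K \<Longrightarrow> f k \<in> ball_bounded m) \<Longrightarrow> (\<lambda>\<xi>. \<Sum>k\<in>K. f k \<xi>) \<in> ball_bounded m"
  by (induction K rule: infinite_finite_induct) (auto intro: ball_bounded_intros)

lemma pairing_product_bounded:
  shows "(\<lambda>\<xi>. Re (pairing m v \<xi> * cnj (pairing m w \<xi>))) \<in> ball_bounded m"
    and "(\<lambda>\<xi>. Im (pairing m v \<xi> * cnj (pairing m w \<xi>))) \<in> ball_bounded m"
    and "(\<lambda>\<xi>. (cmod (pairing m v \<xi>))\<^sup>2) \<in> ball_bounded m"
proof -
  have *: "cmod (pairing m v \<xi> * cnj (pairing m w \<xi>)) \<le> l2 {..<m} v * l2 {..<m} w"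
    if "\<xi> \<in> l2_ball m" for \<xi> and v w :: "nat \<Rightarrow> complex"
    using that unfolding norm_mult complex_mod_cnj by (intro mult_mono pairing_bound) auto
  show "(\<lambda>\<xi>. Re (pairing m v \<xi> * cnj (pairing m w \<xi>))) \<in> ball_bounded m"
    unfolding ball_bounded_def using * abs_Re_le_cmod by (blast intro: order_trans)
  show "(\<lambda>\<xi>. Im (pairing m v \<xi> * cnj (pairing m w \<xi>))) \<in> ball_bounded m"
    unfolding ball_bounded_def using * abs_Im_le_cmod by (blast intro: order_trans)
  have "\<bar>(cmod (pairing m v \<xi>))\<^sup>2\<bar> \<le> l2 {..<m} v * l2 {..<m} v" if "\<xi> \<in> l2_ball m" for \<xi>
    using *[OF that, of v v] by (simp add: norm_mult power2_eq_square)
  then show "(\<lambda>\<xi>. (cmod (pairing m v \<xi>))\<^sup>2) \<in> ball_bounded m"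
    unfolding ball_bounded_def by blast
qed

lemma sqsum_bounded: "sqsum m K \<alpha> \<in> ball_bounded m"
  unfolding sqsum_def by (intro ball_bounded_sum pairing_product_bounded)

text \<open>
  Testing only against bounds \<open>s \<ge> 0\<close> makes a single inequality express both positivity
  (\<open>s = 0\<close>, applied to \<open>- f\<close>) and \<open>p 1 \<le> 1\<close>.
\<close>

definition positive_contraction :: "nat \<Rightarrow> (((nat \<Rightarrow> complex) \<Rightarrow> real) \<Rightarrow> real) \<Rightarrow> bool" where
  "positive_contraction m p \<longleftrightarrow>
     (\<forall>f\<in>ball_bounded m. \<forall>g\<in>ball_bounded m. p (\<lambda>\<xi>. f \<xi> + g \<xi>) = p f + p g) \<and>
     (\<forall>t. \<forall>f\<in>ball_bounded m. p (\<lambda>\<xi>. t * f \<xi>) = t * p f) \<and>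
     (\<forall>f\<in>ball_bounded m. \<forall>s\<ge>0. (\<forall>\<xi>\<in>l2_ball m. f \<xi> \<le> s) \<longrightarrow> p f \<le> s)"

text \<open>
  The form \<open>h v w = p (\<langle>v, \<xi>\<rangle> \<langle>w, \<xi>\<rangle>*) + \<epsilon> \<langle>v, w\<rangle>\<close> is a definite inner product on \<open>\<complex>\<^sup>m\<close>, where
  \<open>p\<close> is extended to complex functions through real and imaginary parts. In an \<open>h\<close>-orthonormal
  basis \<open>u\<close> the values of \<open>p\<close> at quadratic forms are bounded by sums of squared coordinates. The
  coordinates \<open>a k\<close> of the standard basis vectors have total square
  \<open>\<Sum> h (e k) (e k) = p (\<parallel>\<xi>\<parallel>\<^sup>2) + \<epsilon> m\<close>; the \<open>\<epsilon>\<close> is the price for definiteness.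
\<close>

lemma orthonormal_frame:
  fixes \<epsilon> :: real
  assumes p: "positive_contraction m p" and \<epsilon>: "0 < \<epsilon>"
  shows "\<exists>u a. (\<forall>k<m. std_basis k = (\<Sum>i<m. scaleF (a k i) (u i))) \<and>
     (\<forall>(K :: nat set) c. finite K \<longrightarrow>
        p (sqsum m K (\<lambda>k b. \<Sum>i<m. c k i * u i b)) \<le> (\<Sum>k\<in>K. \<Sum>i<m. (cmod (c k i))\<^sup>2)) \<and>
     (\<Sum>k<m. \<Sum>i<m. (cmod (a k i))\<^sup>2) \<le> 1 + \<epsilon> * m"
proof -
  have p_add: "p (\<lambda>\<xi>. f \<xi> + g \<xi>) = p f + p g" if "f \<in> ball_bounded m" "g \<in> ball_bounded m" for f g
    using p that by (auto simp: positive_contraction_def)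
  have p_scale: "p (\<lambda>\<xi>. t * f \<xi>) = t * p f" if "f \<in> ball_bounded m" for f t
    using p that by (auto simp: positive_contraction_def)
  have p_le: "p f \<le> s" if "f \<in> ball_bounded m" "0 \<le> s" "\<And>\<xi>. \<xi> \<in> l2_ball m \<Longrightarrow> f \<xi> \<le> s" for f s
    using p that by (auto simp: positive_contraction_def)
  have p_nonneg: "0 \<le> p f" if f: "f \<in> ball_bounded m" "\<And>\<xi>. 0 \<le> f \<xi>" for f
  proof -
    have "p (\<lambda>\<xi>. -1 * f \<xi>) \<le> 0"
      using f by (intro p_le ball_bounded_scale) auto
    then show ?thesis unfolding p_scale[OF f(1)] by simp
  qed
  have p_sum: "p (\<lambda>\<xi>. \<Sum>k\<in>K. f k \<xi>) = (\<Sum>k\<in>K. p (f k))"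
    if "finite K" "\<And>k. k \<in> K \<Longrightarrow> f k \<in> ball_bounded m" for f and K :: "nat set"
    using that
  proof (induction K rule: finite_induct)
    case empty
    show ?case using p_scale[OF ball_bounded_const, of 0 0] by simp
  next
    case (insert k K)
    then show ?case by (simp add: p_add ball_bounded_sum)
  qed
  define \<phi> where "\<phi> v w \<xi> = pairing m v \<xi> * cnj (pairing m w \<xi>)" for v w \<xi>
  have R: "(\<lambda>\<xi>. Re (\<phi> v w \<xi>)) \<in> ball_bounded m" and I: "(\<lambda>\<xi>. Im (\<phi> v w \<xi>)) \<in> ball_bounded m" for v w
    unfolding \<phi>_def by (intro pairing_product_bounded)+
  define P where "P v w = Complex (p (\<lambda>\<xi>. Re (\<phi> v w \<xi>))) (p (\<lambda>\<xi>. Im (\<phi> v w \<xi>)))" for v w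
  define h where "h v w = P v w + of_real \<epsilon> * (\<Sum>a<m. v a * cnj (w a))" for v w
  have \<phi>_add: "\<phi> (u + v) w \<xi> = \<phi> u w \<xi> + \<phi> v w \<xi>" for u v w \<xi>
    by (simp add: \<phi>_def pairing_def algebra_simps sum.distrib)
  have \<phi>_scale: "\<phi> (scaleF c u) w \<xi> = c * \<phi> u w \<xi>" for c u w \<xi>
    by (simp add: \<phi>_def pairing_def scaleF_def sum_distrib_left algebra_simps)
  have h_add: "h (u + v) w = h u w + h v w" for u v w
    unfolding h_def P_def \<phi>_add
    by (simp add: complex_eq_iff p_add R I algebra_simps sum.distrib)
  have h_scale: "h (scaleF c u) w = c * h u w" for c u w
  proof -
    have "P (scaleF c u) w = c * P u w"
    proof -
      have "p (\<lambda>\<xi>. Re c * Re (\<phi> u w \<xi>) + - Im c * Im (\<phi> u w \<xi>))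
          = Re c * p (\<lambda>\<xi>. Re (\<phi> u w \<xi>)) + - Im c * p (\<lambda>\<xi>. Im (\<phi> u w \<xi>))"
        by (simp only: p_add p_scale R I ball_bounded_scale)
      moreover have "p (\<lambda>\<xi>. Re c * Im (\<phi> u w \<xi>) + Im c * Re (\<phi> u w \<xi>))
          = Re c * p (\<lambda>\<xi>. Im (\<phi> u w \<xi>)) + Im c * p (\<lambda>\<xi>. Re (\<phi> u w \<xi>))"
        by (simp only: p_add p_scale R I ball_bounded_scale)
      ultimately show ?thesis
        unfolding P_def \<phi>_scale by (simp add: complex_eq_iff)
    qed
    then show ?thesis
      by (simp add: h_def scaleF_def sum_distrib_left algebra_simps)
  qed
  have h_herm: "h v u = cnj (h u v)" for u v
  proof -
    have "\<phi> v u \<xi> = cnj (\<phi> u v \<xi>)" for \<xi> by (simp add: \<phi>_def)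
    then show ?thesis
      using p_scale[OF I, of "-1" u v] by (simp add: h_def P_def complex_eq_iff mult_ac)
  qed
  have h_diag: "Re (h v v) = p (\<lambda>\<xi>. (cmod (pairing m v \<xi>))\<^sup>2) + \<epsilon> * (\<Sum>a<m. (cmod (v a))\<^sup>2)" for v
    by (simp add: h_def P_def \<phi>_def complex_mult_cnj cmod_power2)
  have h_ge: "p (\<lambda>\<xi>. (cmod (pairing m v \<xi>))\<^sup>2) \<le> Re (h v v)" for v
    using \<epsilon> by (simp add: h_diag sum_nonneg)
  have h_pos: "0 < Re (h v v)" if "b < m" "v b \<noteq> 0" for v b
  proof -
    have "0 < (\<Sum>a<m. (cmod (v a))\<^sup>2)"
      using that by (intro sum_pos2[where i = b]) auto
    moreover have "0 \<le> p (\<lambda>\<xi>. (cmod (pairing m v \<xi>))\<^sup>2)"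
      by (intro p_nonneg pairing_product_bounded) auto
    ultimately show ?thesis using \<epsilon> by (simp add: h_diag add_nonneg_pos)
  qed
  have "\<exists>u a. (\<forall>c. Re (h (\<Sum>i<m. scaleF (c i) (u i)) (\<Sum>i<m. scaleF (c i) (u i))) = (\<Sum>i<m. (cmod (c i))\<^sup>2)) \<and>
     (\<forall>k<m. std_basis k = (\<Sum>i<m. scaleF (a k i) (u i)))"
    by (rule gram_schmidt_std_basis[OF h_add h_scale h_herm]) (rule h_pos)
  then obtain u a where
    parseval: "\<forall>c. Re (h (\<Sum>i<m. scaleF (c i) (u i)) (\<Sum>i<m. scaleF (c i) (u i))) = (\<Sum>i<m. (cmod (c i))\<^sup>2)"
    and exp: "\<forall>k<m. std_basis k = (\<Sum>i<m. scaleF (a k i) (u i))"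
    by (elim exE conjE) (rule that)
  have "p (sqsum m K (\<lambda>k b. \<Sum>i<m. c k i * u i b)) \<le> (\<Sum>k\<in>K. \<Sum>i<m. (cmod (c k i))\<^sup>2)"
    if "finite K" for K :: "nat set" and c
  proof -
    have eq: "(\<lambda>b. \<Sum>i<m. c k i * u i b) = (\<Sum>i<m. scaleF (c k i) (u i))" for k
      by (simp add: fun_eq_iff sum_fun_apply scaleF_def)
    have "p (sqsum m K (\<lambda>k b. \<Sum>i<m. c k i * u i b))
        = (\<Sum>k\<in>K. p (\<lambda>\<xi>. (cmod (pairing m (\<Sum>i<m. scaleF (c k i) (u i)) \<xi>))\<^sup>2))"
      unfolding sqsum_def eq by (intro p_sum that pairing_product_bounded)
    also have "\<dots> \<le> (\<Sum>k\<in>K. \<Sum>i<m. (cmod (c k i))\<^sup>2)"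
      using parseval by (intro sum_mono order_trans[OF h_ge]) simp
    finally show ?thesis .
  qed
  moreover have "(\<Sum>k<m. \<Sum>i<m. (cmod (a k i))\<^sup>2) \<le> 1 + \<epsilon> * m"
  proof -
    have "(\<Sum>i<m. (cmod (a k i))\<^sup>2) = p (\<lambda>\<xi>. (cmod (\<xi> k))\<^sup>2) + \<epsilon>" if "k < m" for k
    proof -
      have "(\<Sum>i<m. (cmod (a k i))\<^sup>2) = Re (h (std_basis k) (std_basis k))"
        using parseval exp that by simp
      also have "\<dots> = p (\<lambda>\<xi>. (cmod (pairing m (std_basis k) \<xi>))\<^sup>2) + \<epsilon> * (\<Sum>a<m. (cmod (std_basis k a))\<^sup>2)"
        by (rule h_diag)
      also have "pairing m (std_basis k) = (\<lambda>\<xi>. \<xi> k)"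
        using that by (simp add: pairing_def fun_eq_iff if_distrib cong: if_cong)
      also have "(\<Sum>a<m. (cmod (std_basis k a))\<^sup>2) = (\<Sum>a<m. if a = k then 1 else 0)"
        by (intro sum.cong) auto
      finally show ?thesis using that by simp
    qed
    then have "(\<Sum>k<m. \<Sum>i<m. (cmod (a k i))\<^sup>2) = (\<Sum>k<m. p (\<lambda>\<xi>. (cmod (\<xi> k))\<^sup>2)) + \<epsilon> * m"
      by (simp add: sum.distrib mult.commute)
    also have "(\<Sum>k<m. p (\<lambda>\<xi>. (cmod (\<xi> k))\<^sup>2)) = p (\<lambda>\<xi>. \<Sum>k<m. (cmod (\<xi> k))\<^sup>2)"
    proof (rule p_sum[symmetric])
      fix k assume "k \<in> {..<m}"
      then have "(\<lambda>\<xi>. (cmod (pairing m (std_basis k) \<xi>))\<^sup>2) = (\<lambda>\<xi>. (cmod (\<xi> k))\<^sup>2)"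
        by (simp add: pairing_def if_distrib cong: if_cong)
      then show "(\<lambda>\<xi>. (cmod (\<xi> k))\<^sup>2) \<in> ball_bounded m"
        using pairing_product_bounded(3)[of m "std_basis k"] by simp
    qed simp
    also have "\<dots> \<le> 1"
    proof (rule p_le)
      show "(\<lambda>\<xi>. \<Sum>k<m. (cmod (\<xi> k))\<^sup>2) \<in> ball_bounded m"
        unfolding ball_bounded_def by (auto simp: l2_ball_def sum_nonneg intro!: exI[of _ 1])
    qed (auto simp: l2_ball_def)
    finally show ?thesis by simp
  qed
  ultimately show ?thesis using exp by blast
qed

section \<open>A matricial Hahn--Banach theorem\<close>

text \<open>
  The product \<open>\<alpha> D \<beta>\<close>, where \<open>\<alpha> i\<close> is the \<open>i\<close>-th column of an \<open>m \<times> n\<close> matrix and \<open>\<beta> j\<close> the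
  \<open>j\<close>-th row of an \<open>n \<times> m\<close> matrix. Matrices over the vector space are functions of two
  indices that vanish outside the range, so that they form a vector space for each \<open>m\<close>.
\<close>

definition sandwich :: "nat \<Rightarrow> nat \<Rightarrow> (nat \<Rightarrow> nat \<Rightarrow> complex) \<Rightarrow> (nat \<Rightarrow> nat \<Rightarrow> 'e \<Rightarrow> complex) \<Rightarrow>
    (nat \<Rightarrow> nat \<Rightarrow> complex) \<Rightarrow> nat \<Rightarrow> nat \<Rightarrow> 'e \<Rightarrow> complex" where
  "sandwich m n \<alpha> D \<beta> = (\<lambda>a b. if a < m \<and> b < m
     then \<Sum>i<n. \<Sum>j<n. scaleF (\<alpha> i a * \<beta> j b) (D i j) else 0)"

text \<open>
  The cone of all sums of products \<open>\<alpha>\<^sub>l D\<^sub>l \<beta>\<^sub>l\<close> with \<open>D\<^sub>l\<close> in a given set, recorded together with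
  the quadratic forms of the block row \<open>[\<alpha>\<^sub>1, \<dots>, \<alpha>\<^sub>N]\<close> and the block column \<open>[\<beta>\<^sub>1, \<dots>, \<beta>\<^sub>N]\<close>. Keeping the
  forms instead of \<open>N\<close>, \<open>\<alpha>\<close> and \<open>\<beta>\<close> is what makes concatenation of representations additive.
\<close>

inductive sandwich_cone :: "nat \<Rightarrow> nat \<Rightarrow> (nat \<Rightarrow> nat \<Rightarrow> 'e \<Rightarrow> complex) set \<Rightarrow>
    ((nat \<Rightarrow> complex) \<Rightarrow> real) \<Rightarrow> ((nat \<Rightarrow> complex) \<Rightarrow> real) \<Rightarrow> (nat \<Rightarrow> nat \<Rightarrow> 'e \<Rightarrow> complex) \<Rightarrow> bool"
  for m n \<D> where
  zero: "sandwich_cone m n \<D> 0 0 0"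
| step: "sandwich_cone m n \<D> A B M \<Longrightarrow> D \<in> \<D> \<Longrightarrow>
    sandwich_cone m n \<D> (A + sqsum m {..<n} \<alpha>) (B + sqsum m {..<n} \<beta>) (M + sandwich m n \<alpha> D \<beta>)"

lemma sandwich_cone_single:
  "D \<in> \<D> \<Longrightarrow> sandwich_cone m n \<D> (sqsum m {..<n} \<alpha>) (sqsum m {..<n} \<beta>) (sandwich m n \<alpha> D \<beta>)"
  using sandwich_cone.step[OF sandwich_cone.zero] by simp

lemma sandwich_cone_add:
  "sandwich_cone m n \<D> A B M \<Longrightarrow> sandwich_cone m n \<D> A' B' M' \<Longrightarrow>
   sandwich_cone m n \<D> (A + A') (B + B') (M + M')"
proof (induction rule: sandwich_cone.induct)
  case (step A B M D \<alpha> \<beta>)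
  from sandwich_cone.step[OF step.IH[OF step.prems] step.hyps(2), of \<alpha> \<beta>]
  show ?case by (simp only: ac_simps)
qed simp

lemma pairing_scale: "pairing m (\<lambda>a. c * v a) \<xi> = c * pairing m v \<xi>"
  by (simp add: pairing_def sum_distrib_left mult_ac)

lemma sqsum_scale: "sqsum m K (\<lambda>k a. c * \<alpha> k a) = (\<lambda>\<xi>. (cmod c)\<^sup>2 * sqsum m K \<alpha> \<xi>)"
  by (simp add: sqsum_def pairing_scale norm_mult power_mult_distrib sum_distrib_left)

definition scale_triple :: "real \<Rightarrow>
    ((nat \<Rightarrow> complex) \<Rightarrow> real) \<times> ((nat \<Rightarrow> complex) \<Rightarrow> real) \<times> (nat \<Rightarrow> nat \<Rightarrow> 'e \<Rightarrow> complex) \<Rightarrow>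
    ((nat \<Rightarrow> complex) \<Rightarrow> real) \<times> ((nat \<Rightarrow> complex) \<Rightarrow> real) \<times> (nat \<Rightarrow> nat \<Rightarrow> 'e \<Rightarrow> complex)" where
  "scale_triple t = (\<lambda>(A, B, M). (\<lambda>\<xi>. t * A \<xi>, \<lambda>\<xi>. t * B \<xi>, \<lambda>a b. scaleF (of_real t) (M a b)))"

lemma vector_space_scale_triple: "vector_space scale_triple"
  by unfold_locales
    (simp_all add: scale_triple_def case_prod_beta prod_eq_iff scaleF_def fun_eq_iff algebra_simps)

text \<open>
  Scaling a product by \<open>t\<close> scales both factors \<open>\<alpha>\<close> and \<open>\<beta>\<close> by the square root of \<open>t\<close>, hence
  both quadratic forms by \<open>t\<close>.
\<close>

lemma sandwich_cone_scale:
  assumes "sandwich_cone m n \<D> A B M" "0 < t"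
  shows "sandwich_cone m n \<D> (\<lambda>\<xi>. t * A \<xi>) (\<lambda>\<xi>. t * B \<xi>) (\<lambda>a b. scaleF (of_real t) (M a b))"
  using assms(1)
proof (induction rule: sandwich_cone.induct)
  case zero
  show ?case using sandwich_cone.zero by (simp add: scaleF_def zero_fun_def)
next
  case (step A B M D \<alpha> \<beta>)
  let ?c = "of_real (sqrt t) :: complex"
  have c: "?c * ?c = of_real t" "(cmod ?c)\<^sup>2 = t"
    using \<open>0 < t\<close> by (simp_all flip: of_real_mult)
  have "sandwich m n (\<lambda>k a. ?c * \<alpha> k a) D (\<lambda>k a. ?c * \<beta> k a)
      = (\<lambda>a b. scaleF (of_real t) (sandwich m n \<alpha> D \<beta> a b))"
    unfolding c(1)[symmetric]
    by (auto simp: sandwich_def fun_eq_iff scaleF_def sum_fun_apply sum_distrib_left mult_ac)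
  from sandwich_cone.step[OF step.IH step.hyps(2), of "\<lambda>k a. ?c * \<alpha> k a" "\<lambda>k a. ?c * \<beta> k a",
      unfolded sqsum_scale c(2) this]
  show ?case
    by (simp add: plus_fun_def distrib_left scaleF_def)
qed

lemma sandwich_cone_bounded:
  assumes "sandwich_cone m n \<D> A B M"
  shows "A \<in> ball_bounded m" "B \<in> ball_bounded m"
  using assms
  by (induction rule: sandwich_cone.induct)
    (auto simp: plus_fun_def zero_fun_def intro!: ball_bounded_const ball_bounded_add sqsum_bounded)

definition single_entry :: "nat \<Rightarrow> nat \<Rightarrow> ('e \<Rightarrow> complex) \<Rightarrow> nat \<Rightarrow> nat \<Rightarrow> 'e \<Rightarrow> complex" where
  "single_entry a b v = (\<lambda>a' b'. if a' = a \<and> b' = b then v else 0)"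

lemma single_entry_add: "single_entry a b (v + w) = single_entry a b v + single_entry a b w"
  by (auto simp: single_entry_def fun_eq_iff)

definition mats_over :: "nat \<Rightarrow> ('e \<Rightarrow> complex) set \<Rightarrow> (nat \<Rightarrow> nat \<Rightarrow> 'e \<Rightarrow> complex) set" where
  "mats_over m V = {M. (\<forall>a b. M a b \<in> V) \<and> (\<forall>a b. \<not> (a < m \<and> b < m) \<longrightarrow> M a b = 0)}"

lemma mats_over_decomp:
  assumes "M \<in> mats_over m V"
  shows "M = (\<Sum>a<m. \<Sum>b<m. single_entry a b (M a b))"
proof (intro ext)
  fix a b e
  have "(\<Sum>a'<m. \<Sum>b'<m. single_entry a' b' (M a' b') a b e)
      = (\<Sum>a'<m. if a' = a then \<Sum>b'<m. if b' = b then M a b e else 0 else 0)"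
    by (intro sum.cong refl) (auto simp: single_entry_def if_distrib[of "\<lambda>f. f e"] cong: if_cong)
  also have "\<dots> = (if a < m \<and> b < m then M a b e else 0)" by auto
  also have "\<dots> = M a b e" using assms by (auto simp: mats_over_def)
  finally show "M a b e = (\<Sum>a<m. \<Sum>b<m. single_entry a b (M a b)) a b e"
    by (simp add: sum_fun_apply)
qed

lemma sandwich_cone_exists:
  assumes gen: "\<And>v a b. v \<in> V \<Longrightarrow> a < m \<Longrightarrow> b < m \<Longrightarrow> \<exists>A B. sandwich_cone m n \<D> A B (single_entry a b v)"
    and M: "M \<in> mats_over m V"
  shows "\<exists>A B. sandwich_cone m n \<D> A B M"
proof -
  have *: "\<exists>A B. sandwich_cone m n \<D> A B (\<Sum>i\<in>I. f i)"
    if "finite I" "\<And>i. i \<in> I \<Longrightarrow> \<exists>A B. sandwich_cone m n \<D> A B (f i)"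
    for I :: "nat set" and f
    using that
  proof (induction I rule: finite_induct)
    case empty
    show ?case by (intro exI) (simp only: sum.empty, rule sandwich_cone.zero)
  next
    case (insert i I)
    then obtain A B A' B' where "sandwich_cone m n \<D> A B (f i)" "sandwich_cone m n \<D> A' B' (\<Sum>i\<in>I. f i)"
      by (meson insertCI)
    from sandwich_cone_add[OF this] show ?case unfolding sum.insert[OF insert.hyps] by blast
  qed
  have "\<exists>A B. sandwich_cone m n \<D> A B (\<Sum>a<m. \<Sum>b<m. single_entry a b (M a b))"
    using M by (intro * gen) (auto simp: mats_over_def)
  then show ?thesis using mats_over_decomp[OF M] by simp
qed

text \<open>
  Unfolds an element of the cone into an explicit sum. The set must be inhabited because the zero
  element, too, is to be written with at least one summand.
\<close>

lemma sandwich_cone_representation: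
  assumes "sandwich_cone m n \<D> A B M" and ne: "\<D> \<noteq> {}"
  shows "\<exists>(N :: nat) \<alpha> D \<beta>. 1 \<le> N \<and> (\<forall>l. D l \<in> \<D>) \<and> A = (\<lambda>\<xi>. \<Sum>l<N. sqsum m {..<n} (\<alpha> l) \<xi>) \<and>
     B = (\<lambda>\<xi>. \<Sum>l<N. sqsum m {..<n} (\<beta> l) \<xi>) \<and> M = (\<lambda>a b. \<Sum>l<N. sandwich m n (\<alpha> l) (D l) (\<beta> l) a b)"
  using assms(1)
proof (induction rule: sandwich_cone.induct)
  case zero
  from ne obtain D where D: "D \<in> \<D>" by blast
  let ?z = "\<lambda>(l :: nat) (i :: nat) (a :: nat). 0 :: complex"
  have sq: "sqsum m {..<n} (?z 0) = 0" by (simp add: sqsum_def pairing_def zero_fun_def)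
  have sw: "sandwich m n (?z 0) D (?z 0) = 0"
    by (simp add: sandwich_def scaleF_def fun_eq_iff sum_fun_apply)
  have "(1 :: nat) \<le> 1 \<and> (\<forall>l :: nat. D \<in> \<D>) \<and> 0 = (\<lambda>\<xi>. \<Sum>l<1. sqsum m {..<n} (?z l) \<xi>) \<and>
      0 = (\<lambda>\<xi>. \<Sum>l<1. sqsum m {..<n} (?z l) \<xi>) \<and> 0 = (\<lambda>a b. \<Sum>l<1. sandwich m n (?z l) D (?z l) a b)"
    using D by (simp add: sq sw fun_eq_iff)
  then show ?case by (intro exI)
next
  case (step A B M D \<alpha> \<beta>)
  from step.IH obtain N :: nat and \<alpha>' D' \<beta>' where IH: "1 \<le> N" "\<forall>l. D' l \<in> \<D>"
    "A = (\<lambda>\<xi>. \<Sum>l<N. sqsum m {..<n} (\<alpha>' l) \<xi>)" "B = (\<lambda>\<xi>. \<Sum>l<N. sqsum m {..<n} (\<beta>' l) \<xi>)"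
    "M = (\<lambda>a b. \<Sum>l<N. sandwich m n (\<alpha>' l) (D' l) (\<beta>' l) a b)" by (elim exE conjE) (rule that)
  show ?case
  proof (rule exI[of _ "Suc N"], rule exI[of _ "\<alpha>'(N := \<alpha>)"], rule exI[of _ "D'(N := D)"],
      rule exI[of _ "\<beta>'(N := \<beta>)"], intro conjI)
    show "\<forall>l. (D'(N := D)) l \<in> \<D>" using IH(2) step.hyps by simp
  qed (simp_all add: IH(3-5) fun_eq_iff)
qed

lemma linear_on_sum:
  fixes \<Lambda> :: "('e \<Rightarrow> complex) \<Rightarrow> complex"
  assumes V: "cfun.subspace V"
    and add: "\<And>v w. v \<in> V \<Longrightarrow> w \<in> V \<Longrightarrow> \<Lambda> (v + w) = \<Lambda> v + \<Lambda> w"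
    and scale: "\<And>z v. v \<in> V \<Longrightarrow> \<Lambda> (scaleF z v) = z * \<Lambda> v"
    and fV: "\<And>i. i \<in> I \<Longrightarrow> f i \<in> V" and fin: "finite I"
  shows "\<Lambda> (\<Sum>i\<in>I. scaleF (c i) (f i)) = (\<Sum>i\<in>I. c i * \<Lambda> (f i))"
  using fin fV
proof (induction I rule: finite_induct)
  case empty
  have "\<Lambda> (scaleF 0 0) = 0" using scale[OF cfun.subspace_0[OF V], of 0] by simp
  then show ?case by (simp only: sum.empty cfun.scale_zero_left)
next
  case (insert i I)
  have "scaleF (c i) (f i) \<in> V" "(\<Sum>i\<in>I. scaleF (c i) (f i)) \<in> V"
    using insert.prems by (auto intro!: cfun.subspace_scale[OF V] cfun.subspace_sum[OF V])
  from add[OF this] show ?case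
    unfolding sum.insert[OF insert.hyps] using insert.IH[OF insert.prems] scale[OF insert.prems, of i "c i"]
    by (simp only: insertI1 insertI2)
qed

text \<open>
  The cone \<open>\<Gamma>\<close> consists of the triples \<open>(A, B, M)\<close> with bounds \<open>s + t\<close> such that \<open>M\<close> has a
  representation with quadratic forms \<open>A'\<close> and \<open>B'\<close> for which \<open>A + A' \<le> s\<close> and \<open>B + B' \<le> t\<close> on
  the unit ball. A functional \<open>L\<close> below \<open>\<Gamma>\<close> splits into \<open>p\<close>, \<open>q\<close> and a real functional on
  matrices: the triples \<open>(f, 0, 0)\<close> show that \<open>p\<close> is a positive contraction, and a product
  \<open>\<alpha> D \<beta>\<close> together with the negatives of its own forms has bound 0, which gives the estimate by
  \<open>p + q\<close>. The functionals \<open>\<Lambda> a b\<close> are the entries of the complexification.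
\<close>

lemma matricial_separation:
  fixes V :: "('e \<Rightarrow> complex) set"
  assumes V: "cfun.subspace V"
    and D: "\<And>D i j. D \<in> \<D> \<Longrightarrow> i < n \<Longrightarrow> j < n \<Longrightarrow> D i j \<in> V"
    and gen: "\<And>v a b. v \<in> V \<Longrightarrow> a < m \<Longrightarrow> b < m \<Longrightarrow> \<exists>A B. sandwich_cone m n \<D> A B (single_entry a b v)"
    and \<mu>: "\<mu> \<in> mats_over m V"
    and c: "\<And>A B s t. sandwich_cone m n \<D> A B \<mu> \<Longrightarrow> 0 \<le> s \<Longrightarrow> 0 \<le> t \<Longrightarrow>
        (\<forall>\<xi>\<in>l2_ball m. A \<xi> \<le> s) \<Longrightarrow> (\<forall>\<xi>\<in>l2_ball m. B \<xi> \<le> t) \<Longrightarrow> c \<le> s + t"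
  shows "\<exists>p q \<Lambda>. positive_contraction m p \<and> positive_contraction m q \<and>
     (\<forall>a b. \<forall>v\<in>V. \<forall>w\<in>V. \<Lambda> a b (v + w) = \<Lambda> a b v + \<Lambda> a b w) \<and>
     (\<forall>a b z. \<forall>v\<in>V. \<Lambda> a b (scaleF z v) = z * \<Lambda> a b v) \<and>
     (\<forall>D\<in>\<D>. \<forall>\<alpha> \<beta>. cmod (\<Sum>a<m. \<Sum>b<m. \<Lambda> a b (sandwich m n \<alpha> D \<beta> a b))
         \<le> p (sqsum m {..<n} \<alpha>) + q (sqsum m {..<n} \<beta>)) \<and>
     c \<le> Re (\<Sum>a<m. \<Sum>b<m. \<Lambda> a b (\<mu> a b))"
proof -
  have V0: "0 \<in> V" and Vadd: "\<And>v w. v \<in> V \<Longrightarrow> w \<in> V \<Longrightarrow> v + w \<in> V"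
    and Vscale: "\<And>z v. v \<in> V \<Longrightarrow> scaleF z v \<in> V"
    using V by (auto intro: cfun.subspace_0 cfun.subspace_add cfun.subspace_scale)
  have Vsum: "(\<And>i. i \<in> I \<Longrightarrow> f i \<in> V) \<Longrightarrow> (\<Sum>i\<in>I. f i) \<in> V" for f :: "nat \<Rightarrow> 'e \<Rightarrow> complex" and I
    by (rule cfun.subspace_sum[OF V])
  define S where "S = ball_bounded m \<times> ball_bounded m \<times> mats_over m V"
  define \<Gamma> where "\<Gamma> w r \<longleftrightarrow> w \<in> S \<and> (case w of (A, B, M) \<Rightarrow> \<exists>A' B' s t. sandwich_cone m n \<D> A' B' M \<and>
      0 \<le> s \<and> 0 \<le> t \<and> r = s + t \<and> (\<forall>\<xi>\<in>l2_ball m. A \<xi> + A' \<xi> \<le> s) \<and> (\<forall>\<xi>\<in>l2_ball m. B \<xi> + B' \<xi> \<le> t))" for w r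
  have \<Gamma>I: "\<Gamma> (A, B, M) (s + t)" if "(A, B, M) \<in> S" "sandwich_cone m n \<D> A' B' M" "0 \<le> s" "0 \<le> t"
    "\<And>\<xi>. \<xi> \<in> l2_ball m \<Longrightarrow> A \<xi> + A' \<xi> \<le> s" "\<And>\<xi>. \<xi> \<in> l2_ball m \<Longrightarrow> B \<xi> + B' \<xi> \<le> t" for A B M A' B' s t
    using that unfolding \<Gamma>_def by blast
  have zero_M: "0 \<in> mats_over m V" using V0 by (simp add: mats_over_def)
  have zero_b: "0 \<in> ball_bounded m" using ball_bounded_const[of 0] by (simp add: zero_fun_def)
  have MV_add: "M + N \<in> mats_over m V" if "M \<in> mats_over m V" "N \<in> mats_over m V" for M N
    using that by (auto simp: mats_over_def intro: Vadd)
  have bb_add: "f + g \<in> ball_bounded m" if "f \<in> ball_bounded m" "g \<in> ball_bounded m" for f g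
    unfolding plus_fun_def using that by (rule ball_bounded_add)
  interpret W: vector_space "scale_triple :: real \<Rightarrow> _ \<times> _ \<times> (nat \<Rightarrow> nat \<Rightarrow> 'e \<Rightarrow> complex) \<Rightarrow> _"
    by (rule vector_space_scale_triple)
  have S_sub: "W.subspace S"
  proof (rule W.subspaceI)
    show "0 \<in> S" using zero_M zero_b by (simp add: S_def zero_prod_def)
    show "x + y \<in> S" if "x \<in> S" "y \<in> S" for x y
      using that by (auto simp: S_def MV_add bb_add)
    show "scale_triple t x \<in> S" if "x \<in> S" for t x
      using that by (auto simp: S_def mats_over_def scale_triple_def Vscale ball_bounded_scale scaleF_def
          zero_fun_def intro: Vscale[unfolded scaleF_def])
  qed
  have "\<exists>L. (\<forall>x\<in>S. \<forall>y\<in>S. L (x + y) = L x + L y) \<and> (\<forall>t. \<forall>x\<in>S. L (scale_triple t x) = t * L x) \<and>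
     (\<forall>x\<in>S. \<forall>r. \<Gamma> x r \<longrightarrow> L x \<le> r) \<and> c \<le> L (0, 0, \<mu>)"
  proof (rule hahn_banach_cone[OF vector_space_scale_triple S_sub])
    fix x y r s assume x: "\<Gamma> x r" and y: "\<Gamma> y s"
    obtain A B M A1 B1 M1 where xy: "x = (A, B, M)" "y = (A1, B1, M1)" by (cases x, cases y)
    from x y obtain A' B' s' t' A1' B1' s1' t1' where
      *: "sandwich_cone m n \<D> A' B' M" "0 \<le> s'" "0 \<le> t'" "r = s' + t'"
        "\<forall>\<xi>\<in>l2_ball m. A \<xi> + A' \<xi> \<le> s'" "\<forall>\<xi>\<in>l2_ball m. B \<xi> + B' \<xi> \<le> t'"
        "sandwich_cone m n \<D> A1' B1' M1" "0 \<le> s1'" "0 \<le> t1'" "s = s1' + t1'"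
        "\<forall>\<xi>\<in>l2_ball m. A1 \<xi> + A1' \<xi> \<le> s1'" "\<forall>\<xi>\<in>l2_ball m. B1 \<xi> + B1' \<xi> \<le> t1'"
      unfolding \<Gamma>_def xy by auto
    have "x + y \<in> S" using x y S_sub by (auto simp: \<Gamma>_def intro: W.subspace_add)
    moreover have "(A + A1) \<xi> + (A' + A1') \<xi> \<le> s' + s1'" "(B + B1) \<xi> + (B' + B1') \<xi> \<le> t' + t1'"
      if "\<xi> \<in> l2_ball m" for \<xi>
      using *(5,6,11,12)[rule_format, OF that] by simp_all
    ultimately have "\<Gamma> (A + A1, B + B1, M + M1) ((s' + s1') + (t' + t1'))"
      using sandwich_cone_add[OF *(1,7)] *(2,3,8,9) unfolding xy by (intro \<Gamma>I) auto
    then show "\<Gamma> (x + y) (r + s)" using *(4,10) by (simp add: xy ac_simps)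
  next
    fix x r and t :: real assume t: "0 < t" and x: "\<Gamma> x r"
    obtain A B M where x': "x = (A, B, M)" by (cases x)
    from x obtain A' B' s' t' where
      *: "sandwich_cone m n \<D> A' B' M" "0 \<le> s'" "0 \<le> t'" "r = s' + t'"
        "\<forall>\<xi>\<in>l2_ball m. A \<xi> + A' \<xi> \<le> s'" "\<forall>\<xi>\<in>l2_ball m. B \<xi> + B' \<xi> \<le> t'"
      unfolding \<Gamma>_def x' by auto
    have "scale_triple t x \<in> S" using x S_sub by (auto simp: \<Gamma>_def intro: W.subspace_scale)
    moreover have "t * A \<xi> + t * A' \<xi> \<le> t * s'" "t * B \<xi> + t * B' \<xi> \<le> t * t'" if "\<xi> \<in> l2_ball m" for \<xi>
      using *(5,6)[rule_format, OF that] t by (simp_all flip: distrib_left)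
    ultimately have "\<Gamma> (\<lambda>\<xi>. t * A \<xi>, \<lambda>\<xi>. t * B \<xi>, \<lambda>a b. scaleF (of_real t) (M a b)) (t * s' + t * t')"
      using *(2,3) t unfolding x' scale_triple_def
      by (intro \<Gamma>I[OF _ sandwich_cone_scale[OF *(1) t]]) auto
    then show "\<Gamma> (scale_triple t x) (t * r)"
      by (simp add: x' scale_triple_def distrib_left *(4))
  next
    fix x r assume "\<Gamma> x r"
    then show "0 \<le> r" by (auto simp: \<Gamma>_def)
  next
    fix x assume x: "x \<in> S"
    obtain A B M where x': "x = (A, B, M)" by (cases x)
    have "M \<in> mats_over m V" using x by (simp add: S_def x')
    then have "\<exists>A' B'. sandwich_cone m n \<D> A' B' M" by (rule sandwich_cone_exists[rotated]) (rule gen)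
    then obtain A' B' where K: "sandwich_cone m n \<D> A' B' M" by blast
    have "(\<lambda>\<xi>. A \<xi> + A' \<xi>) \<in> ball_bounded m" "(\<lambda>\<xi>. B \<xi> + B' \<xi>) \<in> ball_bounded m"
      using x sandwich_cone_bounded[OF K] by (auto simp: S_def x' intro: ball_bounded_add)
    then obtain s t where st: "\<forall>\<xi>\<in>l2_ball m. \<bar>A \<xi> + A' \<xi>\<bar> \<le> s" "\<forall>\<xi>\<in>l2_ball m. \<bar>B \<xi> + B' \<xi>\<bar> \<le> t"
      unfolding ball_bounded_def by blast
    have "\<forall>\<xi>\<in>l2_ball m. A \<xi> + A' \<xi> \<le> \<bar>s\<bar>" "\<forall>\<xi>\<in>l2_ball m. B \<xi> + B' \<xi> \<le> \<bar>t\<bar>"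
      using st by force+
    then have "\<Gamma> x (\<bar>s\<bar> + \<bar>t\<bar>)"
      using x unfolding x' by (intro \<Gamma>I[OF _ K]) auto
    then show "\<exists>r. \<Gamma> x r" ..
  next
    show "(0, 0, \<mu>) \<in> S" using zero_b \<mu> by (simp add: S_def)
  next
    fix r assume "\<Gamma> (0, 0, \<mu>) r"
    then show "c \<le> r" unfolding \<Gamma>_def using c by auto
  qed
  then obtain L where L: "\<forall>x\<in>S. \<forall>y\<in>S. L (x + y) = L x + L y"
    "\<forall>t. \<forall>x\<in>S. L (scale_triple t x) = t * L x" "\<forall>x\<in>S. \<forall>r. \<Gamma> x r \<longrightarrow> L x \<le> r"
    and L_\<mu>: "c \<le> L (0, 0, \<mu>)"
    by (elim exE conjE) (rule that)
  have L_add: "L (x + y) = L x + L y" if "x \<in> S" "y \<in> S" for x y using L(1) that by blast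
  have L_scale: "L (scale_triple t x) = t * L x" if "x \<in> S" for t x using L(2) that by blast
  have L_le: "L x \<le> r" if "\<Gamma> x r" for x r
  proof -
    have "x \<in> S" using that by (simp add: \<Gamma>_def)
    then show ?thesis using L(3) that by blast
  qed
  define p where "p g = L (g, 0, 0)" for g
  define q where "q g = L (0, g, 0)" for g
  define LM where "LM M = L (0, 0, M)" for M
  have p: "positive_contraction m p"
    unfolding positive_contraction_def
  proof (intro conjI ballI allI impI)
    fix f g assume "f \<in> ball_bounded m" "g \<in> ball_bounded m"
    then have "p (f + g) = p f + p g"
      using L_add[of "(f, 0, 0)" "(g, 0, 0)"] zero_b zero_M by (simp add: S_def p_def)
    then show "p (\<lambda>\<xi>. f \<xi> + g \<xi>) = p f + p g" unfolding plus_fun_def .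
  next
    fix t f assume "f \<in> ball_bounded m"
    then show "p (\<lambda>\<xi>. t * f \<xi>) = t * p f"
      using L_scale[of "(f, 0, 0)" t] zero_b zero_M
      by (simp add: S_def p_def scale_triple_def scaleF_def zero_fun_def)
  next
    fix f and s :: real assume "f \<in> ball_bounded m" "0 \<le> s" "\<forall>\<xi>\<in>l2_ball m. f \<xi> \<le> s"
    then have "\<Gamma> (f, 0, 0) (s + 0)"
      using zero_b zero_M by (intro \<Gamma>I[OF _ sandwich_cone.zero]) (auto simp: S_def)
    then have "\<Gamma> (f, 0, 0) s" by simp
    then show "p f \<le> s" unfolding p_def by (rule L_le)
  qed
  have q: "positive_contraction m q"
    unfolding positive_contraction_def
  proof (intro conjI ballI allI impI)
    fix f g assume "f \<in> ball_bounded m" "g \<in> ball_bounded m"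
    then have "q (f + g) = q f + q g"
      using L_add[of "(0, f, 0)" "(0, g, 0)"] zero_b zero_M by (simp add: S_def q_def)
    then show "q (\<lambda>\<xi>. f \<xi> + g \<xi>) = q f + q g" unfolding plus_fun_def .
  next
    fix t f assume "f \<in> ball_bounded m"
    then show "q (\<lambda>\<xi>. t * f \<xi>) = t * q f"
      using L_scale[of "(0, f, 0)" t] zero_b zero_M
      by (simp add: S_def q_def scale_triple_def scaleF_def zero_fun_def)
  next
    fix f and s :: real assume "f \<in> ball_bounded m" "0 \<le> s" "\<forall>\<xi>\<in>l2_ball m. f \<xi> \<le> s"
    then have "\<Gamma> (0, f, 0) (0 + s)"
      using zero_b zero_M by (intro \<Gamma>I[OF _ sandwich_cone.zero]) (auto simp: S_def)
    then have "\<Gamma> (0, f, 0) s" by simp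
    then show "q f \<le> s" unfolding q_def by (rule L_le)
  qed
  have LM_add: "LM (M + N) = LM M + LM N" if "M \<in> mats_over m V" "N \<in> mats_over m V" for M N
    using L_add[of "(0, 0, M)" "(0, 0, N)"] that zero_b by (simp add: S_def LM_def)
  have LM_scale: "LM (\<lambda>a b. scaleF (of_real t) (M a b)) = t * LM M" if "M \<in> mats_over m V" for M t
    using L_scale[of "(0, 0, M)" t] that zero_b by (simp add: S_def LM_def scale_triple_def zero_fun_def)
  have LM_sum: "LM (\<Sum>i\<in>I. f i) = (\<Sum>i\<in>I. LM (f i)) \<and> (\<Sum>i\<in>I. f i) \<in> mats_over m V"
    if "finite I" "\<And>i. i \<in> I \<Longrightarrow> f i \<in> mats_over m V" for I :: "nat set" and f
    using that
  proof (induction I rule: finite_induct)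
    case empty
    have "LM 0 = 0" using LM_scale[OF zero_M, of 0] by (simp add: scaleF_def zero_fun_def)
    then show ?case using zero_M unfolding sum.empty by (intro conjI)
  next
    case (insert i I)
    then have *: "f i \<in> mats_over m V" "(\<Sum>i\<in>I. f i) \<in> mats_over m V"
      and eq: "LM (\<Sum>i\<in>I. f i) = (\<Sum>i\<in>I. LM (f i))" by blast+
    show ?case unfolding sum.insert[OF insert.hyps] LM_add[OF *] eq using MV_add[OF *] by (intro conjI refl)
  qed
  have sandwich_V: "sandwich m n \<alpha> D \<beta> \<in> mats_over m V" if "D \<in> \<D>" for \<alpha> D \<beta>
    using that D unfolding mats_over_def sandwich_def
    by (auto intro!: Vsum Vscale V0)
  have LM_sandwich: "LM (sandwich m n \<alpha> D \<beta>) \<le> p (sqsum m {..<n} \<alpha>) + q (sqsum m {..<n} \<beta>)"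
    if "D \<in> \<D>" for \<alpha> D \<beta>
  proof -
    let ?A = "sqsum m {..<n} \<alpha>" and ?B = "sqsum m {..<n} \<beta>" and ?M = "sandwich m n \<alpha> D \<beta>"
    have bA: "(\<lambda>\<xi>. - 1 * ?A \<xi>) \<in> ball_bounded m" and bB: "(\<lambda>\<xi>. - 1 * ?B \<xi>) \<in> ball_bounded m"
      by (intro ball_bounded_scale sqsum_bounded)+
    have "\<Gamma> (\<lambda>\<xi>. - 1 * ?A \<xi>, \<lambda>\<xi>. - 1 * ?B \<xi>, ?M) (0 + 0)"
      using bA bB sandwich_V[OF that] by (intro \<Gamma>I[OF _ sandwich_cone_single[OF that]]) (auto simp: S_def)
    then have "\<Gamma> (\<lambda>\<xi>. - 1 * ?A \<xi>, \<lambda>\<xi>. - 1 * ?B \<xi>, ?M) 0" by simp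
    then have "L (\<lambda>\<xi>. - 1 * ?A \<xi>, \<lambda>\<xi>. - 1 * ?B \<xi>, ?M) \<le> 0" by (rule L_le)
    moreover have "L (\<lambda>\<xi>. - 1 * ?A \<xi>, \<lambda>\<xi>. - 1 * ?B \<xi>, ?M)
        = p (\<lambda>\<xi>. - 1 * ?A \<xi>) + (q (\<lambda>\<xi>. - 1 * ?B \<xi>) + LM ?M)"
    proof -
      have "L ((\<lambda>\<xi>. - 1 * ?A \<xi>, 0, 0) + ((0, \<lambda>\<xi>. - 1 * ?B \<xi>, 0) + (0, 0, ?M)))
          = L (\<lambda>\<xi>. - 1 * ?A \<xi>, 0, 0) + L ((0, \<lambda>\<xi>. - 1 * ?B \<xi>, 0) + (0, 0, ?M))"
        using bA bB sandwich_V[OF that] zero_b zero_M by (intro L_add) (simp_all add: S_def)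
      also have "L ((0, \<lambda>\<xi>. - 1 * ?B \<xi>, 0) + (0, 0, ?M)) = L (0, \<lambda>\<xi>. - 1 * ?B \<xi>, 0) + L (0, 0, ?M)"
        using bB sandwich_V[OF that] zero_b zero_M by (intro L_add) (simp_all add: S_def)
      finally show ?thesis by (simp only: p_def q_def LM_def add_Pair add_0_left add_0_right)
    qed
    moreover have "p (\<lambda>\<xi>. - 1 * ?A \<xi>) = - 1 * p ?A"
      using p sqsum_bounded unfolding positive_contraction_def by blast
    moreover have "q (\<lambda>\<xi>. - 1 * ?B \<xi>) = - 1 * q ?B"
      using q sqsum_bounded unfolding positive_contraction_def by blast
    ultimately show ?thesis by simp
  qed
  define \<Lambda> where "\<Lambda> a b v = (if a < m \<and> b < m then
    Complex (LM (single_entry a b v)) (- LM (single_entry a b (scaleF \<i> v))) else 0)" for a b v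
  have single_V: "single_entry a b v \<in> mats_over m V" if "v \<in> V" "a < m" "b < m" for a b v
    using that V0 by (auto simp: mats_over_def single_entry_def)
  have single_scale: "single_entry a b (scaleF z v) = (\<lambda>a' b'. scaleF z (single_entry a b v a' b'))" for a b z and v :: "'e \<Rightarrow> complex"
    by (auto simp: single_entry_def fun_eq_iff scaleF_def)
  have scaleF_add: "scaleF z (v + w) = scaleF z v + scaleF z w" for z and v w :: "'e \<Rightarrow> complex"
    by (rule cfun.scale_right_distrib)
  have \<Lambda>_add: "\<Lambda> a b (v + w) = \<Lambda> a b v + \<Lambda> a b w" if "v \<in> V" "w \<in> V" for a b v w
    using that by (simp add: \<Lambda>_def scaleF_add single_entry_add LM_add single_V Vscale complex_eq_iff)
  have \<Lambda>_scale: "\<Lambda> a b (scaleF z v) = z * \<Lambda> a b v" if v: "v \<in> V" for a b z v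
  proof (cases "a < m \<and> b < m")
    case True
    have real: "LM (single_entry a b (scaleF (of_real t) v)) = t * LM (single_entry a b v)" if "v \<in> V" for t v
      unfolding single_scale using True that by (intro LM_scale single_V) auto
    have "scaleF z v = scaleF (of_real (Re z)) v + scaleF (of_real (Im z)) (scaleF \<i> v)"
      by (simp add: fun_eq_iff scaleF_def complex_eq_iff algebra_simps)
    then have 1: "LM (single_entry a b (scaleF z v))
        = Re z * LM (single_entry a b v) + Im z * LM (single_entry a b (scaleF \<i> v))"
      by (simp only: single_entry_add LM_add single_V Vscale real v conjunct1[OF True] conjunct2[OF True])
    have "scaleF \<i> (scaleF z v) = scaleF (of_real (Re z)) (scaleF \<i> v) + scaleF (of_real (- Im z)) v"
      by (simp add: fun_eq_iff scaleF_def complex_eq_iff algebra_simps)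
    then have 2: "LM (single_entry a b (scaleF \<i> (scaleF z v)))
        = Re z * LM (single_entry a b (scaleF \<i> v)) + - Im z * LM (single_entry a b v)"
      by (simp only: single_entry_add LM_add single_V Vscale real v conjunct1[OF True] conjunct2[OF True])
    show ?thesis
      unfolding \<Lambda>_def if_P[OF True] 1 2 by (simp add: complex_eq_iff algebra_simps)
  qed (auto simp: \<Lambda>_def)
  have Re_\<Lambda>: "Re (\<Sum>a<m. \<Sum>b<m. \<Lambda> a b (M a b)) = LM M" if M: "M \<in> mats_over m V" for M
  proof -
    have MV: "M a b \<in> V" for a b using M by (auto simp: mats_over_def)
    have "LM M = LM (\<Sum>a<m. \<Sum>b<m. single_entry a b (M a b))"
      using mats_over_decomp[OF M] by simp
    also have "\<dots> = (\<Sum>a<m. LM (\<Sum>b<m. single_entry a b (M a b)))"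
      by (intro conjunct1[OF LM_sum] conjunct2[OF LM_sum]) (auto intro: single_V MV)
    also have "\<dots> = (\<Sum>a<m. \<Sum>b<m. LM (single_entry a b (M a b)))"
      by (intro sum.cong refl conjunct1[OF LM_sum]) (auto intro: single_V MV)
    finally show ?thesis by (simp add: \<Lambda>_def)
  qed
  have bound: "cmod (\<Sum>a<m. \<Sum>b<m. \<Lambda> a b (sandwich m n \<alpha> D \<beta> a b))
         \<le> p (sqsum m {..<n} \<alpha>) + q (sqsum m {..<n} \<beta>)" if DD: "D \<in> \<D>" for D \<alpha> \<beta>
  proof -
    define z where "z = (\<Sum>a<m. \<Sum>b<m. \<Lambda> a b (sandwich m n \<alpha> D \<beta> a b))"
    \<comment> \<open>rotating \<open>\<alpha>\<close> by a phase makes the value of the functional real and leaves its form unchanged\<close>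
    define \<theta> where "\<theta> = (if z = 0 then 1 else cnj z / of_real (cmod z))"
    have \<theta>: "cmod \<theta> = 1" "\<theta> * z = of_real (cmod z)"
      by (auto simp: \<theta>_def norm_divide complex_norm_square[symmetric] power2_eq_square mult.commute)
    have sw: "sandwich m n (\<lambda>k a. \<theta> * \<alpha> k a) D \<beta> a b = scaleF \<theta> (sandwich m n \<alpha> D \<beta> a b)" for a b
      by (auto simp: sandwich_def fun_eq_iff scaleF_def sum_fun_apply sum_distrib_left mult_ac)
    have inV: "sandwich m n \<alpha> D \<beta> a b \<in> V" for a b
      using sandwich_V[OF DD] by (auto simp: mats_over_def)
    have "cmod z = Re (\<theta> * z)" unfolding \<theta>(2) by simp
    also have "\<theta> * z = (\<Sum>a<m. \<Sum>b<m. \<Lambda> a b (sandwich m n (\<lambda>k a. \<theta> * \<alpha> k a) D \<beta> a b))"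
      unfolding sw z_def by (simp add: \<Lambda>_scale inV sum_distrib_left)
    also have "Re \<dots> = LM (sandwich m n (\<lambda>k a. \<theta> * \<alpha> k a) D \<beta>)"
      by (rule Re_\<Lambda>[OF sandwich_V[OF DD]])
    also have "\<dots> \<le> p (sqsum m {..<n} (\<lambda>k a. \<theta> * \<alpha> k a)) + q (sqsum m {..<n} \<beta>)"
      by (rule LM_sandwich[OF DD])
    finally show ?thesis by (simp add: z_def sqsum_scale \<theta>(1))
  qed
  have "c \<le> Re (\<Sum>a<m. \<Sum>b<m. \<Lambda> a b (\<mu> a b))"
    using L_\<mu> Re_\<Lambda>[OF \<mu>] by (simp add: LM_def)
  with p q \<Lambda>_add \<Lambda>_scale bound show ?thesis
    by (intro exI[of _ p] exI[of _ q] exI[of _ \<Lambda>] conjI) blast+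
qed

text \<open>
  The functional \<open>\<Lambda>\<close> from the separation is pulled back along bases that are orthonormal for
  \<open>p\<close> and for \<open>q\<close>. Pairing the amplification of \<open>\<phi>\<close> at \<open>D\<close> with coordinate vectors \<open>\<eta>\<close> and
  \<open>\<xi>\<close> is half of \<open>\<Lambda>\<close> at \<open>\<alpha> D \<beta>\<close>, where \<open>\<alpha>\<close> and \<open>\<beta>\<close> have these coordinates; conversely the
  coordinates of the standard basis reproduce \<open>\<Lambda>\<close> at \<open>\<mu>\<close>. The factor 2 in front of \<open>c\<close> comes
  from replacing a product of norms by a sum of squares.
\<close>

theorem matricial_hahn_banach:
  fixes V :: "('e \<Rightarrow> complex) set" and \<epsilon> :: real
  assumes V: "cfun.subspace V"
    and D: "\<And>D i j. D \<in> \<D> \<Longrightarrow> i < n \<Longrightarrow> j < n \<Longrightarrow> D i j \<in> V"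
    and gen: "\<And>v a b. v \<in> V \<Longrightarrow> a < m \<Longrightarrow> b < m \<Longrightarrow> \<exists>A B. sandwich_cone m n \<D> A B (single_entry a b v)"
    and \<mu>: "\<mu> \<in> mats_over m V"
    and c: "\<And>A B s t. sandwich_cone m n \<D> A B \<mu> \<Longrightarrow> 0 \<le> s \<Longrightarrow> 0 \<le> t \<Longrightarrow>
        (\<forall>\<xi>\<in>l2_ball m. A \<xi> \<le> s) \<Longrightarrow> (\<forall>\<xi>\<in>l2_ball m. B \<xi> \<le> t) \<Longrightarrow> 2 * c \<le> s + t"
    and \<epsilon>: "0 < \<epsilon>"
  shows "\<exists>\<phi>. (\<forall>i j. \<forall>v\<in>V. \<forall>w\<in>V. \<phi> i j (v + w) = \<phi> i j v + \<phi> i j w) \<and>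
     (\<forall>i j z. \<forall>v\<in>V. \<phi> i j (scaleF z v) = z * \<phi> i j v) \<and>
     (\<forall>D\<in>\<D>. bilin_le ({..<n} \<times> {..<m}) ({..<n} \<times> {..<m}) (\<lambda>(k, i) (l, j). \<phi> i j (D k l)) 1) \<and>
     (\<forall>C\<ge>0. bilin_le ({..<m} \<times> {..<m}) ({..<m} \<times> {..<m}) (\<lambda>(k, i) (l, j). \<phi> i j (\<mu> k l)) C \<longrightarrow>
        c \<le> C * (1 + \<epsilon> * m))"
proof -
  have "\<exists>p q \<Lambda>. positive_contraction m p \<and> positive_contraction m q \<and>
     (\<forall>a b. \<forall>v\<in>V. \<forall>w\<in>V. \<Lambda> a b (v + w) = \<Lambda> a b v + \<Lambda> a b w) \<and>
     (\<forall>a b z. \<forall>v\<in>V. \<Lambda> a b (scaleF z v) = z * \<Lambda> a b v) \<and>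
     (\<forall>D\<in>\<D>. \<forall>\<alpha> \<beta>. cmod (\<Sum>a<m. \<Sum>b<m. \<Lambda> a b (sandwich m n \<alpha> D \<beta> a b))
         \<le> p (sqsum m {..<n} \<alpha>) + q (sqsum m {..<n} \<beta>)) \<and>
     2 * c \<le> Re (\<Sum>a<m. \<Sum>b<m. \<Lambda> a b (\<mu> a b))"
    by (rule matricial_separation[OF V _ _ \<mu>]) (fact D gen c)+
  then obtain p q \<Lambda> where p: "positive_contraction m p" and q: "positive_contraction m q"
    and \<Lambda>_add: "\<forall>a b. \<forall>v\<in>V. \<forall>w\<in>V. \<Lambda> a b (v + w) = \<Lambda> a b v + \<Lambda> a b w"
    and \<Lambda>_scale: "\<forall>a b z. \<forall>v\<in>V. \<Lambda> a b (scaleF z v) = z * \<Lambda> a b v"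
    and bound: "\<forall>D\<in>\<D>. \<forall>\<alpha> \<beta>. cmod (\<Sum>a<m. \<Sum>b<m. \<Lambda> a b (sandwich m n \<alpha> D \<beta> a b))
         \<le> p (sqsum m {..<n} \<alpha>) + q (sqsum m {..<n} \<beta>)"
    and lower: "2 * c \<le> Re (\<Sum>a<m. \<Sum>b<m. \<Lambda> a b (\<mu> a b))"
    by (elim exE conjE) (rule that)
  obtain u x where u: "\<forall>k<m. std_basis k = (\<Sum>i<m. scaleF (x k i) (u i))"
    and pu: "\<forall>(K :: nat set) c. finite K \<longrightarrow>
        p (sqsum m K (\<lambda>k b. \<Sum>i<m. c k i * u i b)) \<le> (\<Sum>k\<in>K. \<Sum>i<m. (cmod (c k i))\<^sup>2)"
    and x: "(\<Sum>k<m. \<Sum>i<m. (cmod (x k i))\<^sup>2) \<le> 1 + \<epsilon> * m"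
    using orthonormal_frame[OF p \<epsilon>] by (elim exE conjE) (rule that)
  obtain w y where w: "\<forall>k<m. std_basis k = (\<Sum>i<m. scaleF (y k i) (w i))"
    and qw: "\<forall>(K :: nat set) c. finite K \<longrightarrow>
        q (sqsum m K (\<lambda>k b. \<Sum>i<m. c k i * w i b)) \<le> (\<Sum>k\<in>K. \<Sum>i<m. (cmod (c k i))\<^sup>2)"
    and y: "(\<Sum>k<m. \<Sum>i<m. (cmod (y k i))\<^sup>2) \<le> 1 + \<epsilon> * m"
    using orthonormal_frame[OF q \<epsilon>] by (elim exE conjE) (rule that)
  define \<phi> where "\<phi> i j v = 1 / 2 * (\<Sum>a<m. \<Sum>b<m. u i a * w j b * \<Lambda> a b v)" for i j v
  have expand: "(\<Sum>p\<in>{..<N} \<times> {..<m}. \<Sum>q\<in>{..<N} \<times> {..<m}.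
        \<eta> p * (\<lambda>(k, i) (l, j). \<phi> i j (D k l)) p q * \<xi> q)
      = 1 / 2 * (\<Sum>a<m. \<Sum>b<m. \<Sum>k<N. \<Sum>l<N.
          (\<Sum>i<m. \<eta> (k, i) * u i a) * (\<Sum>j<m. \<xi> (l, j) * w j b) * \<Lambda> a b (D k l))"
    for N \<eta> \<xi> D
  proof -
    have "(\<Sum>p\<in>{..<N} \<times> {..<m}. \<Sum>q\<in>{..<N} \<times> {..<m}.
        \<eta> p * (\<lambda>(k, i) (l, j). \<phi> i j (D k l)) p q * \<xi> q)
      = (\<Sum>k<N. \<Sum>i<m. \<Sum>l<N. \<Sum>j<m. \<eta> (k, i) * \<phi> i j (D k l) * \<xi> (l, j))"
      by (simp add: sum.cartesian_product')
    also have "\<dots> = (\<Sum>k<N. \<Sum>l<N. \<Sum>i<m. \<Sum>j<m. \<eta> (k, i) * \<phi> i j (D k l) * \<xi> (l, j))"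
      by (intro sum.cong refl sum.swap)
    also have "\<dots> = (\<Sum>k<N. \<Sum>l<N. \<Sum>i<m. \<Sum>j<m. \<Sum>a<m. \<Sum>b<m.
        1 / 2 * ((\<eta> (k, i) * u i a) * (\<xi> (l, j) * w j b) * \<Lambda> a b (D k l)))"
      unfolding \<phi>_def by (simp add: sum_distrib_left sum_distrib_right mult_ac)
    also have "\<dots> = (\<Sum>k<N. \<Sum>l<N. \<Sum>a<m. \<Sum>b<m. \<Sum>i<m. \<Sum>j<m.
        1 / 2 * ((\<eta> (k, i) * u i a) * (\<xi> (l, j) * w j b) * \<Lambda> a b (D k l)))"
      by (intro sum.cong refl sum_swap_pairs)
    also have "\<dots> = (\<Sum>k<N. \<Sum>l<N. \<Sum>a<m. \<Sum>b<m.
        1 / 2 * ((\<Sum>i<m. \<eta> (k, i) * u i a) * (\<Sum>j<m. \<xi> (l, j) * w j b) * \<Lambda> a b (D k l)))"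
      unfolding sum_product unfolding sum_distrib_left sum_distrib_right ..
    also have "\<dots> = (\<Sum>a<m. \<Sum>b<m. \<Sum>k<N. \<Sum>l<N.
        1 / 2 * ((\<Sum>i<m. \<eta> (k, i) * u i a) * (\<Sum>j<m. \<xi> (l, j) * w j b) * \<Lambda> a b (D k l)))"
      by (rule sum_swap_pairs)
    finally show ?thesis by (simp only: sum_distrib_left)
  qed
  have "bilin_le ({..<n} \<times> {..<m}) ({..<n} \<times> {..<m}) (\<lambda>(k, i) (l, j). \<phi> i j (D k l)) 1"
    if DD: "D \<in> \<D>" for D
  proof (rule bilin_le_unitI)
    fix \<eta> \<xi> :: "nat \<times> nat \<Rightarrow> complex"
    assume \<eta>: "(\<Sum>p\<in>{..<n} \<times> {..<m}. (cmod (\<eta> p))\<^sup>2) \<le> 1" and \<xi>: "(\<Sum>p\<in>{..<n} \<times> {..<m}. (cmod (\<xi> p))\<^sup>2) \<le> 1"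
    define \<alpha> where "\<alpha> k a = (\<Sum>i<m. \<eta> (k, i) * u i a)" for k a
    define \<beta> where "\<beta> l b = (\<Sum>j<m. \<xi> (l, j) * w j b)" for l b
    have "\<Lambda> a b (sandwich m n \<alpha> D \<beta> a b) = (\<Sum>k<n. \<Sum>l<n. \<alpha> k a * \<beta> l b * \<Lambda> a b (D k l))"
      if "a < m" "b < m" for a b
    proof -
      have eq: "sandwich m n \<alpha> D \<beta> a b
          = (\<Sum>p\<in>{..<n} \<times> {..<n}. scaleF (\<alpha> (fst p) a * \<beta> (snd p) b) (D (fst p) (snd p)))"
        using that unfolding sandwich_def
        by (simp only: if_True simp_thms sum.cartesian_product' fst_conv snd_conv)
      have "\<Lambda> a b (sandwich m n \<alpha> D \<beta> a b) = (\<Sum>p\<in>{..<n} \<times> {..<n}. \<alpha> (fst p) a * \<beta> (snd p) b * \<Lambda> a b (D (fst p) (snd p)))"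
        unfolding eq by (rule linear_on_sum[OF V])
          (rule \<Lambda>_add[rule_format], assumption+, rule \<Lambda>_scale[rule_format], assumption, auto intro: D[OF DD])
      then show ?thesis by (simp only: sum.cartesian_product' fst_conv snd_conv)
    qed
    then have "(\<Sum>a<m. \<Sum>b<m. \<Lambda> a b (sandwich m n \<alpha> D \<beta> a b))
        = (\<Sum>a<m. \<Sum>b<m. \<Sum>k<n. \<Sum>l<n. \<alpha> k a * \<beta> l b * \<Lambda> a b (D k l))"
      by (intro sum.cong refl) simp
    then have "cmod (\<Sum>p\<in>{..<n} \<times> {..<m}. \<Sum>q\<in>{..<n} \<times> {..<m}.
        \<eta> p * (\<lambda>(k, i) (l, j). \<phi> i j (D k l)) p q * \<xi> q)
        = 1 / 2 * cmod (\<Sum>a<m. \<Sum>b<m. \<Lambda> a b (sandwich m n \<alpha> D \<beta> a b))"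
      unfolding expand \<alpha>_def[symmetric] \<beta>_def[symmetric] by (simp add: norm_mult norm_divide)
    also have "\<dots> \<le> 1 / 2 * (p (sqsum m {..<n} \<alpha>) + q (sqsum m {..<n} \<beta>))"
      using bound DD by (intro mult_left_mono) auto
    also have "p (sqsum m {..<n} \<alpha>) \<le> (\<Sum>k<n. \<Sum>i<m. (cmod (\<eta> (k, i)))\<^sup>2)"
      using pu[rule_format, of "{..<n}" "\<lambda>k i. \<eta> (k, i)"] by (simp add: \<alpha>_def[abs_def])
    also have "(\<Sum>k<n. \<Sum>i<m. (cmod (\<eta> (k, i)))\<^sup>2) \<le> 1"
      using \<eta> by (simp add: sum.cartesian_product')
    also have "q (sqsum m {..<n} \<beta>) \<le> (\<Sum>k<n. \<Sum>i<m. (cmod (\<xi> (k, i)))\<^sup>2)"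
      using qw[rule_format, of "{..<n}" "\<lambda>k i. \<xi> (k, i)"] by (simp add: \<beta>_def[abs_def])
    also have "(\<Sum>k<n. \<Sum>i<m. (cmod (\<xi> (k, i)))\<^sup>2) \<le> 1"
      using \<xi> by (simp add: sum.cartesian_product')
    finally show "cmod (\<Sum>p\<in>{..<n} \<times> {..<m}. \<Sum>q\<in>{..<n} \<times> {..<m}.
        \<eta> p * (\<lambda>(k, i) (l, j). \<phi> i j (D k l)) p q * \<xi> q) \<le> 1"
      by simp
  qed auto
  moreover have "c \<le> C * (1 + \<epsilon> * m)"
    if C: "0 \<le> C" and B: "bilin_le ({..<m} \<times> {..<m}) ({..<m} \<times> {..<m}) (\<lambda>(k, i) (l, j). \<phi> i j (\<mu> k l)) C" for C
  proof -
    have ux: "(\<Sum>i<m. x k i * u i a) = std_basis k a" if "k < m" for k a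
      using fun_cong[OF u[rule_format, OF that], of a] by (simp add: sum_fun_apply scaleF_def)
    have wy: "(\<Sum>i<m. y k i * w i a) = std_basis k a" if "k < m" for k a
      using fun_cong[OF w[rule_format, OF that], of a] by (simp add: sum_fun_apply scaleF_def)
    have "(\<Sum>k<m. \<Sum>l<m. (\<Sum>i<m. x k i * u i a) * (\<Sum>j<m. y l j * w j b) * \<Lambda> a b (\<mu> k l)) = \<Lambda> a b (\<mu> a b)"
      if "a < m" "b < m" for a b
    proof -
      have "(\<Sum>k<m. \<Sum>l<m. (\<Sum>i<m. x k i * u i a) * (\<Sum>j<m. y l j * w j b) * \<Lambda> a b (\<mu> k l))
          = (\<Sum>k<m. \<Sum>l<m. if l = b then (if k = a then \<Lambda> a b (\<mu> k l) else 0) else 0)"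
        by (intro sum.cong refl) (simp add: ux wy)
      then show ?thesis using that by simp
    qed
    then have eq: "1 / 2 * (\<Sum>a<m. \<Sum>b<m. \<Lambda> a b (\<mu> a b)) = (\<Sum>p\<in>{..<m} \<times> {..<m}. \<Sum>q\<in>{..<m} \<times> {..<m}.
        (case p of (k, i) \<Rightarrow> x k i) * (\<lambda>(k, i) (l, j). \<phi> i j (\<mu> k l)) p q * (case q of (l, j) \<Rightarrow> y l j))"
      unfolding expand by (intro arg_cong2[where f = "(*)"] refl sum.cong) simp
    have "1 / 2 * cmod (\<Sum>a<m. \<Sum>b<m. \<Lambda> a b (\<mu> a b)) = cmod (1 / 2 * (\<Sum>a<m. \<Sum>b<m. \<Lambda> a b (\<mu> a b)))"
      by (simp add: norm_mult norm_divide)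
    also have "\<dots> \<le> C * l2 ({..<m} \<times> {..<m}) (\<lambda>(k, i). x k i) * l2 ({..<m} \<times> {..<m}) (\<lambda>(l, j). y l j)"
      unfolding eq by (rule bilin_leD[OF B])
    also have "\<dots> \<le> C * sqrt (1 + \<epsilon> * m) * sqrt (1 + \<epsilon> * m)"
    proof -
      have "l2 ({..<m} \<times> {..<m}) (\<lambda>(k, i). x k i) \<le> sqrt (1 + \<epsilon> * m)"
           "l2 ({..<m} \<times> {..<m}) (\<lambda>(k, i). y k i) \<le> sqrt (1 + \<epsilon> * m)"
        using x y unfolding L2_set_def by (simp_all add: sum.cartesian_product')
      then show ?thesis using C \<epsilon> by (intro mult_mono) auto
    qed
    also have "\<dots> = C * (1 + \<epsilon> * m)" using \<epsilon> by simp
    finally have "cmod (\<Sum>a<m. \<Sum>b<m. \<Lambda> a b (\<mu> a b)) \<le> 2 * (C * (1 + \<epsilon> * m))" by simp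
    then show ?thesis using lower complex_Re_le_cmod[of "\<Sum>a<m. \<Sum>b<m. \<Lambda> a b (\<mu> a b)"] by linarith
  qed
  moreover have "\<phi> i j (v + v') = \<phi> i j v + \<phi> i j v'" if "v \<in> V" "v' \<in> V" for i j v v'
    using \<Lambda>_add that by (simp add: \<phi>_def algebra_simps sum.distrib)
  moreover have "\<phi> i j (scaleF z v) = z * \<phi> i j v" if "v \<in> V" for i j z v
    using \<Lambda>_scale that by (simp add: \<phi>_def algebra_simps sum_distrib_left)
  ultimately show ?thesis by (intro exI[of _ \<phi>] conjI) blast+
qed

section \<open>Matrix norms and Lipschitz constants\<close>

lemma l2_norm_vec: "l2_norm (vec d f) = L2_set (\<lambda>i. norm (f i)) {..<d}"
  unfolding l2_norm_def by (intro L2_set_cong) auto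

lemma mult_mat_vec_index:
  "i < dim_row A \<Longrightarrow> dim_vec v = dim_col A \<Longrightarrow>
   (A *\<^sub>v v) $ i = (\<Sum>j<dim_col A. A $$ (i, j) * v $ j)"
  by (auto simp: scalar_prod_def lessThan_atLeast0 intro!: sum.cong)

lemma l2_norm_mult_mat_vec:
  assumes "dim_vec v = dim_col A"
  shows "l2_norm (A *\<^sub>v v) = l2 {..<dim_row A} (\<lambda>i. \<Sum>j<dim_col A. A $$ (i, j) * v $ j)"
  unfolding l2_norm_def using assms by (intro L2_set_cong) (simp_all add: mult_mat_vec_index del: index_mult_mat_vec)

lemma cmat_norm_bound:
  assumes "bilin_le {..<dim_row A} {..<dim_col A} (\<lambda>i j. A $$ (i, j)) C" "0 \<le> C"
    and v: "v \<in> carrier_vec (dim_col A)" "l2_norm v \<le> 1"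
  shows "l2_norm (A *\<^sub>v v) \<le> C"
proof -
  have "l2_norm (A *\<^sub>v v) \<le> C * l2 {..<dim_col A} (\<lambda>j. v $ j)"
    using bilin_le_row[OF assms(1,2)] v(1) by (simp add: l2_norm_mult_mat_vec)
  also have "l2 {..<dim_col A} (\<lambda>j. v $ j) = l2_norm v" using v(1) by (simp add: l2_norm_def)
  also have "C * l2_norm v \<le> C * 1" using v assms(2) by (intro mult_left_mono)
  finally show ?thesis by simp
qed

lemma cmat_norm_le:
  assumes "bilin_le {..<dim_row A} {..<dim_col A} (\<lambda>i j. A $$ (i, j)) C" "0 \<le> C"
  shows "cmat_norm A \<le> C"
  unfolding cmat_norm_def
proof (rule cSup_least)
  have "l2_norm (0\<^sub>v (dim_col A) :: complex vec) \<le> 1" by (simp add: l2_norm_def L2_set_def)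
  then show "{l2_norm (A *\<^sub>v v) |v. v \<in> carrier_vec (dim_col A) \<and> l2_norm v \<le> 1} \<noteq> {}"
    using zero_carrier_vec by blast
qed (use cmat_norm_bound[OF assms] in auto)

lemma cmat_norm_upper:
  assumes "v \<in> carrier_vec (dim_col A)" "l2_norm v \<le> 1"
  shows "l2_norm (A *\<^sub>v v) \<le> cmat_norm A"
  unfolding cmat_norm_def
proof (rule cSup_upper)
  show "bdd_above {l2_norm (A *\<^sub>v v) |v. v \<in> carrier_vec (dim_col A) \<and> l2_norm v \<le> 1}"
    using cmat_norm_bound[OF bilin_le_sum_entries] by (intro bdd_aboveI) (auto simp: sum_nonneg)
qed (use assms in auto)

lemma cmat_norm_nonneg: "0 \<le> cmat_norm A"
proof -
  have "0 \<le> l2_norm (A *\<^sub>v 0\<^sub>v (dim_col A))" by (simp add: l2_norm_def)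
  also have "\<dots> \<le> cmat_norm A"
    by (rule cmat_norm_upper) (auto simp: l2_norm_def L2_set_def)
  finally show ?thesis .
qed

lemma bilin_le_cmat_norm:
  "bilin_le {..<dim_row A} {..<dim_col A} (\<lambda>i j. A $$ (i, j)) (cmat_norm A)"
proof (rule bilin_le_rowI)
  fix \<xi> :: "nat \<Rightarrow> complex"
  let ?J = "{..<dim_col A}"
  show "l2 {..<dim_row A} (\<lambda>i. \<Sum>j\<in>?J. A $$ (i, j) * \<xi> j) \<le> cmat_norm A * l2 ?J \<xi>"
  proof (cases "l2 ?J \<xi> = 0")
    case True
    then have "\<forall>j\<in>?J. \<xi> j = 0" by (simp add: L2_set_eq_0_iff)
    then show ?thesis using True by (simp add: L2_set_def)
  next
    case False
    define s where "s = l2 ?J \<xi>"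
    have s: "0 < s" using False by (simp add: s_def less_le)
    define v where "v = vec (dim_col A) (\<lambda>j. of_real (1 / s) * \<xi> j)"
    have "l2_norm v = 1"
      using s unfolding v_def l2_norm_vec l2_scale s_def[symmetric] by (simp add: norm_divide)
    then have "l2_norm (A *\<^sub>v v) \<le> cmat_norm A" by (intro cmat_norm_upper) (auto simp: v_def)
    also have "l2_norm (A *\<^sub>v v) = l2 {..<dim_row A} (\<lambda>i. of_real (1 / s) * (\<Sum>j\<in>?J. A $$ (i, j) * \<xi> j))"
      by (subst l2_norm_mult_mat_vec) (auto simp: v_def sum_distrib_left mult_ac intro!: L2_set_cong arg_cong[where f = cmod] sum.cong)
    also have "\<dots> = 1 / s * l2 {..<dim_row A} (\<lambda>i. \<Sum>j\<in>?J. A $$ (i, j) * \<xi> j)"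
      using s unfolding l2_scale by (simp add: norm_divide)
    finally show ?thesis using s unfolding s_def[symmetric] by (simp add: field_simps)
  qed
qed

text \<open>
  A crude bound, whose purpose is that the supremum in the operator norm is a real one and that
  the operator norm is controlled by the norms of the entries.
\<close>

lemma op_mat_apply_bound:
  assumes v: "v \<in> carrier_vec (dim_col A)" "l2_norm v \<le> 1"
  shows "l2_norm (op_mat_apply A v) \<le> (\<Sum>i<dim_row A. \<Sum>j<dim_col A. norm (A $$ (i, j)))"
proof -
  have "l2_norm (op_mat_apply A v)
      \<le> (\<Sum>i<dim_row A. norm (\<Sum>j<dim_col A. blinfun_apply (A $$ (i, j)) (v $ j)))"
    unfolding op_mat_apply_def l2_norm_vec by (rule L2_set_le_sum) simp
  also have "\<dots> \<le> (\<Sum>i<dim_row A. \<Sum>j<dim_col A. norm (A $$ (i, j)))"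
  proof (rule sum_mono, rule order_trans[OF norm_sum], rule sum_mono)
    fix i j assume "j \<in> {..<dim_col A}"
    then have "norm (v $ j) \<le> l2_norm v"
      unfolding l2_norm_def using v(1) member_le_L2_set[of "{..<dim_vec v}" j "\<lambda>j. norm (v $ j)"] by auto
    then have "norm (v $ j) \<le> 1" using v(2) by simp
    have "norm (blinfun_apply (A $$ (i, j)) (v $ j)) \<le> norm (A $$ (i, j)) * norm (v $ j)"
      by (rule norm_blinfun)
    also have "\<dots> \<le> norm (A $$ (i, j)) * 1" by (rule mult_left_mono[OF \<open>norm (v $ j) \<le> 1\<close> norm_ge_zero])
    finally show "norm (blinfun_apply (A $$ (i, j)) (v $ j)) \<le> norm (A $$ (i, j))" by simp
  qed
  finally show ?thesis .
qed

lemma op_mat_norm_upper: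
  assumes "v \<in> carrier_vec (dim_col A)" "l2_norm v \<le> 1"
  shows "l2_norm (op_mat_apply A v) \<le> op_mat_norm A"
  unfolding op_mat_norm_def
proof (rule cSup_upper)
  show "bdd_above {l2_norm (op_mat_apply A v) |v. v \<in> carrier_vec (dim_col A) \<and> l2_norm v \<le> 1}"
    using op_mat_apply_bound by (intro bdd_aboveI) auto
qed (use assms in blast)

lemma op_mat_norm_le_sum: "op_mat_norm A \<le> (\<Sum>i<dim_row A. \<Sum>j<dim_col A. norm (A $$ (i, j)))"
  unfolding op_mat_norm_def
proof (rule cSup_least)
  have "l2_norm (0\<^sub>v (dim_col A)) \<le> 1" by (simp add: l2_norm_def L2_set_def)
  then show "{l2_norm (op_mat_apply A v) |v. v \<in> carrier_vec (dim_col A) \<and> l2_norm v \<le> 1} \<noteq> {}"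
    using zero_carrier_vec by blast
qed (use op_mat_apply_bound in auto)

lemma op_mat_norm_nonneg: "0 \<le> op_mat_norm A"
proof -
  have "0 \<le> l2_norm (op_mat_apply A (0\<^sub>v (dim_col A)))" by (simp add: l2_norm_def)
  also have "\<dots> \<le> op_mat_norm A"
    by (rule op_mat_norm_upper) (auto simp: l2_norm_def L2_set_def)
  finally show ?thesis .
qed

lemma norm_entry_le_op_mat_norm:
  assumes "i < dim_row A" "j < dim_col A"
  shows "norm (A $$ (i, j)) \<le> op_mat_norm A"
proof (rule norm_blinfun_bound[OF op_mat_norm_nonneg])
  fix x
  show "norm (blinfun_apply (A $$ (i, j)) x) \<le> op_mat_norm A * norm x"
  proof (cases "x = 0")
    case False
    define y where "y = (1 / norm x) *\<^sub>R x"
    have y: "norm y = 1" using False by (simp add: y_def)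
    define v where "v = vec (dim_col A) (\<lambda>k. if k = j then y else 0)"
    have "l2_norm v = sqrt (\<Sum>k<dim_col A. if k = j then 1 else 0)"
      unfolding v_def l2_norm_vec L2_set_def by (intro arg_cong[where f = sqrt] sum.cong) (auto simp: y)
    then have v: "l2_norm v \<le> 1" using assms by simp
    have "(\<Sum>k<dim_col A. blinfun_apply (A $$ (i, k)) (v $ k)) = (\<Sum>k<dim_col A. if k = j then blinfun_apply (A $$ (i, j)) y else 0)"
      by (intro sum.cong) (auto simp: v_def blinfun.zero_right)
    then have "blinfun_apply (A $$ (i, j)) y = op_mat_apply A v $ i"
      using assms by (simp add: op_mat_apply_def)
    also have "norm \<dots> \<le> l2_norm (op_mat_apply A v)"
      unfolding l2_norm_def using assms
      by (intro member_le_L2_set) (auto simp: op_mat_apply_def)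
    also have "\<dots> \<le> op_mat_norm A" using v by (intro op_mat_norm_upper) (simp_all add: v_def)
    finally have "norm (blinfun_apply (A $$ (i, j)) y) \<le> op_mat_norm A" .
    then have "norm (blinfun_apply (A $$ (i, j)) x) / norm x \<le> op_mat_norm A"
      by (simp add: y_def blinfun.scaleR_right)
    then show ?thesis using False by (simp add: pos_divide_le_eq)
  qed (simp add: blinfun.zero_right)
qed

lemma matsD:
  assumes "A \<in> mats n X"
  shows "dim_row A = n" "dim_col A = n" "i < n \<Longrightarrow> j < n \<Longrightarrow> A $$ (i, j) \<in> X"
proof -
  show "dim_row A = n" "dim_col A = n" using assms by (auto simp: mats_def)
  show "A $$ (i, j) \<in> X" if "i < n" "j < n"
    using assms that by (auto simp: mats_def)
qed

lemma matsI: "(\<And>i j. i < n \<Longrightarrow> j < n \<Longrightarrow> f (i, j) \<in> X) \<Longrightarrow> mat n n f \<in> mats n X"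
  by (auto simp: mats_def elements_mat_def)

lemma amplify_dim [simp]:
  "dim_row (amplify k F A) = dim_row A * k" "dim_col (amplify k F A) = dim_col A * k"
  by (simp_all add: amplify_def flatten_mat_def)

lemma amplify_index:
  assumes "i < dim_row A" "j < dim_col A" "p < k" "q < k"
  shows "amplify k F A $$ (i * k + p, j * k + q) = F (A $$ (i, j)) $$ (p, q)"
proof -
  have "i * k + p < dim_row A * k" "j * k + q < dim_col A * k"
    using assms by (auto intro: div_mod_less)
  then show ?thesis using assms by (simp add: amplify_def flatten_mat_def)
qed

text \<open>
  Index pairs \<open>(i, p)\<close> are encoded as \<open>i * k + p\<close> by block matrices; the norm is the bound of the
  form indexed by pairs.
\<close>

lemma cmat_norm_flat:
  assumes dim: "dim_row A = N * k" "dim_col A = M * l"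
    and entries: "\<And>i p j q. i < N \<Longrightarrow> p < k \<Longrightarrow> j < M \<Longrightarrow> q < l \<Longrightarrow> A $$ (i * k + p, j * l + q) = f i p j q"
  shows cmat_norm_flat_le: "bilin_le ({..<N} \<times> {..<k}) ({..<M} \<times> {..<l}) (\<lambda>(i, p) (j, q). f i p j q) C \<Longrightarrow>
      0 \<le> C \<Longrightarrow> cmat_norm A \<le> C"
    and bilin_le_cmat_norm_flat:
      "bilin_le ({..<N} \<times> {..<k}) ({..<M} \<times> {..<l}) (\<lambda>(i, p) (j, q). f i p j q) (cmat_norm A)"
proof -
  have *: "bilin_le ({..<N} \<times> {..<k}) ({..<M} \<times> {..<l}) (\<lambda>(i, p) (j, q). f i p j q) C
      \<longleftrightarrow> bilin_le {..<dim_row A} {..<dim_col A} (\<lambda>i j. A $$ (i, j)) C" for C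
    unfolding dim bilin_le_div_mod by (rule bilin_le_cong) (auto simp: entries)
  show "bilin_le ({..<N} \<times> {..<k}) ({..<M} \<times> {..<l}) (\<lambda>(i, p) (j, q). f i p j q) C \<Longrightarrow>
      0 \<le> C \<Longrightarrow> cmat_norm A \<le> C"
    unfolding * by (rule cmat_norm_le)
  show "bilin_le ({..<N} \<times> {..<k}) ({..<M} \<times> {..<l}) (\<lambda>(i, p) (j, q). f i p j q) (cmat_norm A)"
    unfolding * by (rule bilin_le_cmat_norm)
qed

lemma cmat_norm_amplify_diff:
  fixes F :: "'a \<Rightarrow> complex mat"
  assumes x: "x \<in> mats n X" and y: "y \<in> mats n X"
    and F: "\<And>z p q. p < k \<Longrightarrow> q < k \<Longrightarrow> F z $$ (p, q) = f p q z"
  shows cmat_norm_amplify_diff_le: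
      "bilin_le ({..<n} \<times> {..<k}) ({..<n} \<times> {..<k})
         (\<lambda>(i, p) (j, q). f p q (x $$ (i, j)) - f p q (y $$ (i, j))) C \<Longrightarrow> 0 \<le> C \<Longrightarrow>
       cmat_norm (amplify k F x - amplify k F y) \<le> C"
    and bilin_le_amplify_diff:
      "bilin_le ({..<n} \<times> {..<k}) ({..<n} \<times> {..<k})
         (\<lambda>(i, p) (j, q). f p q (x $$ (i, j)) - f p q (y $$ (i, j))) (cmat_norm (amplify k F x - amplify k F y))"
proof -
  have dim: "dim_row (amplify k F x - amplify k F y) = n * k" "dim_col (amplify k F x - amplify k F y) = n * k"
    using matsD[OF y] by simp_all
  have ent: "(amplify k F x - amplify k F y) $$ (i * k + p, j * k + q) = f p q (x $$ (i, j)) - f p q (y $$ (i, j))"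
    if "i < n" "p < k" "j < n" "q < k" for i p j q
    using that matsD[OF x] matsD[OF y] div_mod_less by (simp add: amplify_index F)
  show "bilin_le ({..<n} \<times> {..<k}) ({..<n} \<times> {..<k})
         (\<lambda>(i, p) (j, q). f p q (x $$ (i, j)) - f p q (y $$ (i, j))) C \<Longrightarrow> 0 \<le> C \<Longrightarrow>
       cmat_norm (amplify k F x - amplify k F y) \<le> C"
    by (rule cmat_norm_flat_le[OF dim ent])
  show "bilin_le ({..<n} \<times> {..<k}) ({..<n} \<times> {..<k})
         (\<lambda>(i, p) (j, q). f p q (x $$ (i, j)) - f p q (y $$ (i, j))) (cmat_norm (amplify k F x - amplify k F y))"
    by (rule bilin_le_cmat_norm_flat[OF dim ent])
qed

abbreviation eval_mat :: "('a \<Rightarrow> complex) mat \<Rightarrow> 'a \<Rightarrow> complex mat" where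
  "eval_mat G x \<equiv> map_mat (\<lambda>f. f x) G"

lemma lip_const_le:
  assumes G: "dim_row G = k" "dim_col G = k" and C: "0 \<le> C"
    and bound: "\<And>x y. x \<in> mats n X \<Longrightarrow> y \<in> mats n X \<Longrightarrow>
      bilin_le ({..<n} \<times> {..<k}) ({..<n} \<times> {..<k})
        (\<lambda>(i, p) (j, q). (G $$ (p, q)) (x $$ (i, j)) - (G $$ (p, q)) (y $$ (i, j))) (C * op_mat_norm (x - y))"
  shows "lip_const X n k (eval_mat G) \<le> C"
  unfolding lip_const_def
proof (rule cInf_lower)
  have "cmat_norm (amplify k (eval_mat G) x - amplify k (eval_mat G) y) \<le> C * op_mat_norm (x - y)"
    if "x \<in> mats n X" "y \<in> mats n X" for x y
    using bound[OF that] G C op_mat_norm_nonneg[of "x - y"]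
    by (intro cmat_norm_amplify_diff_le[OF that]) auto
  then show "C \<in> {C. 0 \<le> C \<and> (\<forall>x\<in>mats n X. \<forall>y\<in>mats n X.
      cmat_norm (amplify k (eval_mat G) x - amplify k (eval_mat G) y) \<le> C * op_mat_norm (x - y))}"
    using C by blast
qed (auto intro!: bdd_belowI)

text \<open>
  The infimum in the Lipschitz constant is attained. That it ranges over an inhabited set uses that
  the entries are Lipschitz functions: the sum of all their constants serves for the amplification,
  since the norm of an operator matrix dominates its entries.
\<close>

lemma lip_const_bound:
  assumes G: "G \<in> mats k (os_carrier (lip0_space X x0 n))"
    and x: "x \<in> mats n X" and y: "y \<in> mats n X"
  shows "bilin_le ({..<n} \<times> {..<k}) ({..<n} \<times> {..<k})
        (\<lambda>(i, p) (j, q). (G $$ (p, q)) (x $$ (i, j)) - (G $$ (p, q)) (y $$ (i, j)))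
        (lip_const X n k (eval_mat G) * op_mat_norm (x - y))"
proof -
  define S where "S = {C. 0 \<le> C \<and> (\<forall>x\<in>mats n X. \<forall>y\<in>mats n X.
      cmat_norm (amplify k (eval_mat G) x - amplify k (eval_mat G) y) \<le> C * op_mat_norm (x - y))}"
  have eval: "eval_mat G z $$ (p, q) = (G $$ (p, q)) z" if "p < k" "q < k" for z p q
    using that matsD[OF G] by simp
  have "\<exists>L :: nat \<Rightarrow> nat \<Rightarrow> real. \<forall>p q. p < k \<longrightarrow> q < k \<longrightarrow> (L p q)-lipschitz_on X (G $$ (p, q))"
  proof -
    have "\<exists>L. p < k \<longrightarrow> q < k \<longrightarrow> L-lipschitz_on X (G $$ (p, q))" for p q
      using matsD(3)[OF G, of p q] by (auto simp: lip0_space_def)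
    then show ?thesis by metis
  qed
  then obtain L where L: "\<And>p q. p < k \<Longrightarrow> q < k \<Longrightarrow> (L p q)-lipschitz_on X (G $$ (p, q))" by blast
  have L0: "0 \<le> L p q" if "p < k" "q < k" for p q using L[OF that] by (rule lipschitz_on_nonneg)
  define K where "K = (\<Sum>i<n. \<Sum>p<k. \<Sum>j<n. \<Sum>q<k. L p q)"
  have K0: "0 \<le> K" unfolding K_def using L0 by (intro sum_nonneg) auto
  have K: "cmat_norm (amplify k (eval_mat G) x - amplify k (eval_mat G) y) \<le> K * op_mat_norm (x - y)"
    if x: "x \<in> mats n X" and y: "y \<in> mats n X" for x y
  proof (rule cmat_norm_amplify_diff_le[OF x y eval])
    let ?A = "\<lambda>(i, p) (j, q). (G $$ (p, q)) (x $$ (i, j)) - (G $$ (p, q)) (y $$ (i, j))"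
    have "(\<Sum>P\<in>{..<n} \<times> {..<k}. \<Sum>Q\<in>{..<n} \<times> {..<k}. cmod (?A P Q))
        = (\<Sum>i<n. \<Sum>p<k. \<Sum>j<n. \<Sum>q<k. cmod ((G $$ (p, q)) (x $$ (i, j)) - (G $$ (p, q)) (y $$ (i, j))))"
      by (simp add: sum.cartesian_product')
    also have "\<dots> \<le> (\<Sum>i<n. \<Sum>p<k. \<Sum>j<n. \<Sum>q<k. L p q * op_mat_norm (x - y))"
    proof (intro sum_mono)
      fix i p j q assume *: "i \<in> {..<n}" "p \<in> {..<k}" "j \<in> {..<n}" "q \<in> {..<k}"
      have "cmod ((G $$ (p, q)) (x $$ (i, j)) - (G $$ (p, q)) (y $$ (i, j))) \<le> L p q * norm (x $$ (i, j) - y $$ (i, j))"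
        using lipschitz_onD[OF L] * matsD[OF x] matsD[OF y] by (simp add: dist_norm)
      also have "x $$ (i, j) - y $$ (i, j) = (x - y) $$ (i, j)"
        using * matsD[OF x] matsD[OF y] by simp
      also have "L p q * norm \<dots> \<le> L p q * op_mat_norm (x - y)"
        using * matsD[OF y] L0 by (intro mult_left_mono norm_entry_le_op_mat_norm) auto
      finally show "cmod ((G $$ (p, q)) (x $$ (i, j)) - (G $$ (p, q)) (y $$ (i, j))) \<le> L p q * op_mat_norm (x - y)" .
    qed
    also have "\<dots> = K * op_mat_norm (x - y)"
      unfolding K_def by (simp only: sum_distrib_right)
    finally show "bilin_le ({..<n} \<times> {..<k}) ({..<n} \<times> {..<k}) ?A (K * op_mat_norm (x - y))"
      by (rule bilin_le_mono[OF bilin_le_sum_entries, rotated 2]) auto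
  qed (use K0 op_mat_norm_nonneg in \<open>auto intro: mult_nonneg_nonneg\<close>)
  have S: "S \<noteq> {}" using K K0 unfolding S_def by blast
  have "cmat_norm (amplify k (eval_mat G) x - amplify k (eval_mat G) y)
      \<le> lip_const X n k (eval_mat G) * op_mat_norm (x - y)"
  proof (cases "op_mat_norm (x - y) = 0")
    case True
    then show ?thesis using K[OF x y] by simp
  next
    case False
    then have pos: "0 < op_mat_norm (x - y)" using op_mat_norm_nonneg[of "x - y"] by simp
    have "cmat_norm (amplify k (eval_mat G) x - amplify k (eval_mat G) y) / op_mat_norm (x - y) \<le> Inf S"
      using x y pos by (intro cInf_greatest[OF S]) (auto simp: S_def field_simps)
    then show ?thesis using pos by (simp add: lip_const_def S_def field_simps)
  qed
  from bilin_le_mono[OF bilin_le_amplify_diff[OF x y eval] this] show ?thesis .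
qed

lemma diag_block_mat_dim:
  assumes B: "\<And>l. l < N \<Longrightarrow> B l \<in> carrier_mat n n"
  shows "diag_block_mat (map B [0..<N]) \<in> carrier_mat (N * n) (N * n)"
proof -
  have "sum_list (map f (map B [0..<N])) = N * n" if "\<And>l. l < N \<Longrightarrow> f (B l) = n" for f
  proof -
    have "map f (map B [0..<N]) = map (\<lambda>_. n) [0..<N]" using that by simp
    then show ?thesis by (simp only: sum_list_triv) simp
  qed
  from this[of dim_row] this[of dim_col] show ?thesis
    using B unfolding carrier_mat_def mem_Collect_eq dim_diag_block_mat by auto
qed

lemma diag_block_mat_index:
  assumes B: "\<And>l. l < N \<Longrightarrow> B l \<in> carrier_mat n n"
    and "l < N" "l' < N" "i < n" "j < n"
  shows "diag_block_mat (map B [0..<N]) $$ (l * n + i, l' * n + j) = (if l = l' then B l $$ (i, j) else 0)"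
  using assms
proof (induction N)
  case (Suc N)
  let ?D = "diag_block_mat (map B [0..<N])"
  have dim: "dim_row ?D = N * n" "dim_col ?D = N * n"
    using diag_block_mat_dim[of N B n] Suc.prems(1) by auto
  have BN: "B N \<in> carrier_mat n n" using Suc.prems(1) by simp
  have eq: "diag_block_mat (map B [0..<Suc N]) = four_block_mat ?D (0\<^sub>m (N * n) n) (0\<^sub>m n (N * n)) (B N)"
    using BN dim by (simp add: diag_block_mat_last Let_def)
  have small: "l * n + i < N * n + n" if "l < Suc N" "i < n" for l i
    using div_mod_less[OF that] by simp
  have lt: "l * n + i < N * n + n" "l' * n + j < N * n + n" using small Suc.prems by auto
  have idx: "diag_block_mat (map B [0..<Suc N]) $$ (l * n + i, l' * n + j)
    = (if l * n + i < N * n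
       then if l' * n + j < N * n then ?D $$ (l * n + i, l' * n + j)
         else 0\<^sub>m (N * n) n $$ (l * n + i, l' * n + j - N * n)
       else if l' * n + j < N * n then 0\<^sub>m n (N * n) $$ (l * n + i - N * n, l' * n + j)
         else B N $$ (l * n + i - N * n, l' * n + j - N * n))"
    unfolding eq using lt dim BN by (subst index_mat_four_block(1)) auto
  have row: "l * n + i < N * n \<longleftrightarrow> l < N"
    using div_mod_less[of l N i n] Suc.prems by (cases "l < N") (auto simp: less_Suc_eq)
  have col: "l' * n + j < N * n \<longleftrightarrow> l' < N"
    using div_mod_less[of l' N j n] Suc.prems by (cases "l' < N") (auto simp: less_Suc_eq)
  consider "l < N" "l' < N" | "l < N" "l' = N" | "l = N" "l' < N" | "l = N" "l' = N"
    using Suc.prems by linarith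
  then show ?case
  proof cases
    case 1
    then show ?thesis unfolding idx row col using Suc.IH Suc.prems by simp
  next
    case 2
    then show ?thesis unfolding idx row col using Suc.prems div_mod_less[of l N i n] by simp
  next
    case 3
    then show ?thesis unfolding idx row col using Suc.prems div_mod_less[of l' N j n] by simp
  next
    case 4
    then show ?thesis unfolding idx row col by simp
  qed
qed simp

lemma scalar_mult_diag_block_mat_index:
  assumes B: "\<And>l. l < N \<Longrightarrow> B l \<in> carrier_mat n n"
    and \<alpha>: "\<alpha> \<in> carrier_mat m (N * n)" and \<beta>: "\<beta> \<in> carrier_mat (N * n) m"
    and ab: "a < m" "b < m"
  shows "((\<alpha> \<cdot>\<^sub>l diag_block_mat (map B [0..<N])) \<cdot>\<^sub>r \<beta>) $$ (a, b)
    = (\<Sum>l<N. \<Sum>i<n. \<Sum>j<n. scaleF (\<alpha> $$ (a, l * n + i) * \<beta> $$ (l * n + j, b)) (B l $$ (i, j)))"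
proof -
  let ?D = "diag_block_mat (map B [0..<N])"
  have D: "?D \<in> carrier_mat (N * n) (N * n)" by (rule diag_block_mat_dim[OF B])
  have "((\<alpha> \<cdot>\<^sub>l ?D) \<cdot>\<^sub>r \<beta>) $$ (a, b)
      = (\<Sum>q<N * n. scaleF (\<beta> $$ (q, b)) (\<Sum>p<N * n. scaleF (\<alpha> $$ (a, p)) (?D $$ (p, q))))"
    using \<alpha> \<beta> D ab by (simp add: scalar_mult_left_def scalar_mult_right_def)
  also have "\<dots> = (\<Sum>l<N. \<Sum>j<n. \<Sum>l'<N. \<Sum>i<n.
      scaleF (\<alpha> $$ (a, l' * n + i) * \<beta> $$ (l * n + j, b)) (?D $$ (l' * n + i, l * n + j)))"
    unfolding sum_div_mod by (simp add: cfun.scale_sum_right mult.commute)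
  also have "\<dots> = (\<Sum>l<N. \<Sum>j<n. \<Sum>l'<N. if l' = l then \<Sum>i<n.
      scaleF (\<alpha> $$ (a, l * n + i) * \<beta> $$ (l * n + j, b)) (B l $$ (i, j)) else 0)"
  proof (intro sum.cong refl)
    fix l j l' assume "l \<in> {..<N}" "j \<in> {..<n}" "l' \<in> {..<N}"
    then have "?D $$ (l' * n + i, l * n + j) = (if l' = l then B l $$ (i, j) else 0)" if "i < n" for i
      using diag_block_mat_index[of N B n l' l i j] B that by auto
    then show "(\<Sum>i<n. scaleF (\<alpha> $$ (a, l' * n + i) * \<beta> $$ (l * n + j, b)) (?D $$ (l' * n + i, l * n + j)))
        = (if l' = l then \<Sum>i<n. scaleF (\<alpha> $$ (a, l * n + i) * \<beta> $$ (l * n + j, b)) (B l $$ (i, j)) else 0)"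
      by (cases "l' = l") (auto intro!: sum.neutral sum.cong)
  qed
  also have "\<dots> = (\<Sum>l<N. \<Sum>j<n. \<Sum>i<n. scaleF (\<alpha> $$ (a, l * n + i) * \<beta> $$ (l * n + j, b)) (B l $$ (i, j)))"
    by (rule sum.cong[OF refl], rule sum.cong[OF refl]) simp
  also have "\<dots> = (\<Sum>l<N. \<Sum>i<n. \<Sum>j<n. scaleF (\<alpha> $$ (a, l * n + i) * \<beta> $$ (l * n + j, b)) (B l $$ (i, j)))"
    by (intro sum.cong refl sum.swap)
  finally show ?thesis .
qed

section \<open>The norm of the Lipschitz-free operator space\<close>

context
  fixes X :: "('h::complex_hilbert_space \<Rightarrow>\<^sub>L 'h) set" and x0 :: "'h \<Rightarrow>\<^sub>L 'h" and n :: nat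
begin

abbreviation "E \<equiv> lip0_space X x0 n"
abbreviation "\<delta> \<equiv> delta X x0 n"

lemma lip0_os_norm: "os_norm E G = lip_const X n (dim_row G) (eval_mat G)"
  by (simp add: lip0_space_def)

lemma free_os_norm: "os_norm (lip_free_space X x0 n) \<mu> =
  Sup {cmat_norm (amplify (dim_row \<mu>) (eval_mat \<mu>) G) | G k.
        1 \<le> k \<and> G \<in> mats k (os_carrier E) \<and> os_norm E G \<le> 1}"
  by (simp add: lip_free_space_def dual_space_def Let_def)

lemma delta_apply: "f \<in> os_carrier E \<Longrightarrow> \<delta> x f = f x"
  by (simp add: delta_def)

lemma delta_base: "\<delta> x0 = 0"
proof
  fix f show "\<delta> x0 f = 0 f" by (cases "f \<in> os_carrier E") (simp_all add: delta_def, simp add: lip0_space_def)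
qed

lemma molecule_index:
  assumes "x \<in> mats n X" "y \<in> mats n X" "i < n" "j < n"
  shows "molecule_mat X x0 n c x y $$ (i, j) = scaleF c (\<delta> (x $$ (i, j)) - \<delta> (y $$ (i, j)))"
  using assms(3,4) matsD(1,2)[OF assms(1)] matsD(1,2)[OF assms(2)] by (simp add: molecule_mat_def)

lemma molecule_carrier:
  assumes "x \<in> mats n X" "y \<in> mats n X"
  shows "molecule_mat X x0 n c x y \<in> carrier_mat n n"
  using matsD(1,2)[OF assms(2)] by (intro carrier_matI) (simp_all add: molecule_mat_def)

definition is_representation ::
    "((('h \<Rightarrow>\<^sub>L 'h) \<Rightarrow> complex) \<Rightarrow> complex) mat \<Rightarrow> nat \<Rightarrow> nat \<Rightarrow> complex mat \<Rightarrow> complex mat \<Rightarrow>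
     (nat \<Rightarrow> complex) \<Rightarrow> (nat \<Rightarrow> ('h \<Rightarrow>\<^sub>L 'h) mat) \<Rightarrow> (nat \<Rightarrow> ('h \<Rightarrow>\<^sub>L 'h) mat) \<Rightarrow> bool" where
  "is_representation \<mu> m N \<alpha> \<beta> c x y \<longleftrightarrow>
     1 \<le> N \<and> \<alpha> \<in> carrier_mat m (N * n) \<and> \<beta> \<in> carrier_mat (N * n) m \<and>
     (\<forall>l<N. x l \<in> mats n X \<and> y l \<in> mats n X) \<and>
     \<mu> = (\<alpha> \<cdot>\<^sub>l diag_block_mat (map (\<lambda>l. molecule_mat X x0 n (c l) (x l) (y l)) [0..<N])) \<cdot>\<^sub>r \<beta>"

definition representation_cost ::
    "nat \<Rightarrow> complex mat \<Rightarrow> complex mat \<Rightarrow>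
     (nat \<Rightarrow> complex) \<Rightarrow> (nat \<Rightarrow> ('h \<Rightarrow>\<^sub>L 'h) mat) \<Rightarrow> (nat \<Rightarrow> ('h \<Rightarrow>\<^sub>L 'h) mat) \<Rightarrow> real" where
  "representation_cost N \<alpha> \<beta> c x y =
     cmat_norm \<alpha> * cmat_norm \<beta> * Max ((\<lambda>l. cmod (c l) * op_mat_norm (x l - y l)) ` {..<N})"

lemma representation_entry:
  assumes "is_representation \<mu> m N \<alpha> \<beta> c x y" "a < m" "b < m"
  shows "\<mu> $$ (a, b) = (\<Sum>l<N. \<Sum>i<n. \<Sum>j<n. scaleF (\<alpha> $$ (a, l * n + i) * \<beta> $$ (l * n + j, b))
      (scaleF (c l) (\<delta> (x l $$ (i, j)) - \<delta> (y l $$ (i, j)))))"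
proof -
  let ?B = "\<lambda>l. molecule_mat X x0 n (c l) (x l) (y l)"
  have "\<mu> $$ (a, b) = (\<Sum>l<N. \<Sum>i<n. \<Sum>j<n. scaleF (\<alpha> $$ (a, l * n + i) * \<beta> $$ (l * n + j, b)) (?B l $$ (i, j)))"
    using assms molecule_carrier unfolding is_representation_def
    by (auto intro!: scalar_mult_diag_block_mat_index)
  also have "\<dots> = (\<Sum>l<N. \<Sum>i<n. \<Sum>j<n. scaleF (\<alpha> $$ (a, l * n + i) * \<beta> $$ (l * n + j, b))
      (scaleF (c l) (\<delta> (x l $$ (i, j)) - \<delta> (y l $$ (i, j)))))"
    using assms(1) unfolding is_representation_def
    by (intro sum.cong refl arg_cong2[where f = scaleF] molecule_index) auto
  finally show ?thesis .
qed

lemma representation_cost_nonneg: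
  assumes "1 \<le> N"
  shows "0 \<le> Max ((\<lambda>l. cmod (c l) * op_mat_norm (x l - y l)) ` {..<N})"
    and "0 \<le> representation_cost N \<alpha> \<beta> c x y"
proof -
  have "0 \<le> cmod (c 0) * op_mat_norm (x 0 - y 0)"
    by (intro mult_nonneg_nonneg op_mat_norm_nonneg) simp
  also have "\<dots> \<le> Max ((\<lambda>l. cmod (c l) * op_mat_norm (x l - y l)) ` {..<N})"
    using assms by (intro Max_ge) auto
  finally show "0 \<le> Max ((\<lambda>l. cmod (c l) * op_mat_norm (x l - y l)) ` {..<N})" .
  then show "0 \<le> representation_cost N \<alpha> \<beta> c x y"
    unfolding representation_cost_def by (intro mult_nonneg_nonneg cmat_norm_nonneg)
qed

text \<open>
  Written out, the bilinear form of \<open>\<mu>(G)\<close> at \<open>\<eta>\<close> and \<open>\<xi>\<close> is the form of the block diagonal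
  matrix with blocks \<open>Q l\<close>, of norm at most \<open>K\<close>, at the vectors \<open>\<eta>'\<close> and \<open>\<xi>'\<close> that arise from
  \<open>\<eta>\<close> and \<open>\<xi>\<close> through the amplifications of \<open>\<alpha>\<close> and \<open>\<beta>\<close>.
\<close>

lemma evaluation_le_cost:
  assumes rep: "is_representation \<mu> m N \<alpha> \<beta> c x y"
    and G: "G \<in> mats k (os_carrier E)" and lip: "os_norm E G \<le> 1"
  shows "cmat_norm (amplify m (eval_mat \<mu>) G) \<le> representation_cost N \<alpha> \<beta> c x y"
proof -
  define K where "K = Max ((\<lambda>l. cmod (c l) * op_mat_norm (x l - y l)) ` {..<N})"
  have N: "1 \<le> N" and \<alpha>: "dim_row \<alpha> = m" "dim_col \<alpha> = N * n" and \<beta>: "dim_row \<beta> = N * n" "dim_col \<beta> = m"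
    and xy: "\<And>l. l < N \<Longrightarrow> x l \<in> mats n X" "\<And>l. l < N \<Longrightarrow> y l \<in> mats n X"
    and \<mu>: "dim_row \<mu> = m" "dim_col \<mu> = m"
    using rep by (auto simp: is_representation_def scalar_mult_left_def scalar_mult_right_def)
  have K: "0 \<le> K" unfolding K_def by (rule representation_cost_nonneg(1)[OF N])
  define Q where "Q l = (\<lambda>(i, p) (j, q). c l * ((G $$ (p, q)) (x l $$ (i, j)) - (G $$ (p, q)) (y l $$ (i, j))))" for l
  have Q: "bilin_le ({..<n} \<times> {..<k}) ({..<n} \<times> {..<k}) (Q l) K" if l: "l < N" for l
  proof -
    have "bilin_le ({..<n} \<times> {..<k}) ({..<n} \<times> {..<k})
        (\<lambda>(i, p) (j, q). (G $$ (p, q)) (x l $$ (i, j)) - (G $$ (p, q)) (y l $$ (i, j))) (1 * op_mat_norm (x l - y l))"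
      using lip matsD(1)[OF G] op_mat_norm_nonneg
      by (intro bilin_le_mono[OF lip_const_bound[OF G xy[OF l]]] mult_right_mono) (simp_all add: lip0_os_norm)
    from bilin_le_scale[OF this, of "c l"]
    have "bilin_le ({..<n} \<times> {..<k}) ({..<n} \<times> {..<k}) (Q l) (cmod (c l) * op_mat_norm (x l - y l))"
      by (simp add: Q_def case_prod_unfold)
    then show ?thesis
      by (rule bilin_le_mono) (use l in \<open>auto simp: K_def intro!: Max_ge\<close>)
  qed
  have entry: "(\<mu> $$ (a, b)) (G $$ (p, q)) = (\<Sum>(l, i, j)\<in>{..<N} \<times> {..<n} \<times> {..<n}.
      \<alpha> $$ (a, l * n + i) * \<beta> $$ (l * n + j, b) * Q l (i, p) (j, q))"
    if "a < m" "b < m" "p < k" "q < k" for a b p q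
    using that matsD(3)[OF G]
    by (simp add: representation_entry[OF rep] sum_fun_apply scaleF_def delta_apply Q_def
        sum.cartesian_product' mult.assoc)
  have main: "bilin_le ({..<k} \<times> {..<m}) ({..<k} \<times> {..<m}) (\<lambda>(p, a) (q, b). (\<mu> $$ (a, b)) (G $$ (p, q)))
      (representation_cost N \<alpha> \<beta> c x y)"
    unfolding bilin_le_def
  proof (intro allI)
    fix \<eta> \<xi> :: "nat \<times> nat \<Rightarrow> complex"
    define \<eta>' where "\<eta>' l = (\<lambda>(i, p). \<Sum>a<m. \<alpha> $$ (a, l * n + i) * \<eta> (p, a))" for l
    define \<xi>' where "\<xi>' l = (\<lambda>(j, q). \<Sum>b<m. \<beta> $$ (l * n + j, b) * \<xi> (q, b))" for l
    have "(\<Sum>P\<in>{..<k} \<times> {..<m}. \<Sum>R\<in>{..<k} \<times> {..<m}.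
        \<eta> P * (\<lambda>(p, a) (q, b). (\<mu> $$ (a, b)) (G $$ (p, q))) P R * \<xi> R)
      = (\<Sum>p<k. \<Sum>a<m. \<Sum>q<k. \<Sum>b<m. \<eta> (p, a) * (\<mu> $$ (a, b)) (G $$ (p, q)) * \<xi> (q, b))"
      by (simp add: sum.cartesian_product')
    also have "\<dots> = (\<Sum>p<k. \<Sum>q<k. \<Sum>a<m. \<Sum>b<m. \<eta> (p, a) * (\<mu> $$ (a, b)) (G $$ (p, q)) * \<xi> (q, b))"
      by (intro sum.cong refl sum.swap)
    also have "\<dots> = (\<Sum>p<k. \<Sum>q<k. \<Sum>a<m. \<Sum>b<m. \<Sum>(l, i, j)\<in>{..<N} \<times> {..<n} \<times> {..<n}.
        (\<alpha> $$ (a, l * n + i) * \<eta> (p, a)) * Q l (i, p) (j, q) * (\<beta> $$ (l * n + j, b) * \<xi> (q, b)))"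
      by (intro sum.cong refl) (simp add: entry sum_distrib_left sum_distrib_right case_prod_unfold mult_ac)
    also have "\<dots> = (\<Sum>p<k. \<Sum>q<k. \<Sum>(l, i, j)\<in>{..<N} \<times> {..<n} \<times> {..<n}. \<Sum>a<m. \<Sum>b<m.
        (\<alpha> $$ (a, l * n + i) * \<eta> (p, a)) * Q l (i, p) (j, q) * (\<beta> $$ (l * n + j, b) * \<xi> (q, b)))"
      unfolding case_prod_unfold by (intro sum.cong refl sum_swap_triple)
    also have "\<dots> = (\<Sum>p<k. \<Sum>q<k. \<Sum>(l, i, j)\<in>{..<N} \<times> {..<n} \<times> {..<n}.
        \<eta>' l (i, p) * Q l (i, p) (j, q) * \<xi>' l (j, q))"
      by (intro sum.cong refl) (simp add: \<eta>'_def \<xi>'_def case_prod_unfold sum_product sum_distrib_left sum_distrib_right mult_ac)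
    also have "\<dots> = (\<Sum>(l, i, j)\<in>{..<N} \<times> {..<n} \<times> {..<n}. \<Sum>p<k. \<Sum>q<k.
        \<eta>' l (i, p) * Q l (i, p) (j, q) * \<xi>' l (j, q))"
      unfolding case_prod_unfold by (rule sum_swap_triple)
    also have "\<dots> = (\<Sum>l<N. \<Sum>i<n. \<Sum>j<n. \<Sum>p<k. \<Sum>q<k. \<eta>' l (i, p) * Q l (i, p) (j, q) * \<xi>' l (j, q))"
      by (simp only: sum.cartesian_product' prod.case)
    also have "\<dots> = (\<Sum>l<N. \<Sum>i<n. \<Sum>p<k. \<Sum>j<n. \<Sum>q<k. \<eta>' l (i, p) * Q l (i, p) (j, q) * \<xi>' l (j, q))"
      by (intro sum.cong refl sum.swap)
    also have "\<dots> = (\<Sum>l<N. \<Sum>P\<in>{..<n} \<times> {..<k}. \<Sum>R\<in>{..<n} \<times> {..<k}. \<eta>' l P * Q l P R * \<xi>' l R)"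
      by (simp only: sum.cartesian_product')
    finally have eq: "(\<Sum>P\<in>{..<k} \<times> {..<m}. \<Sum>R\<in>{..<k} \<times> {..<m}.
        \<eta> P * (\<lambda>(p, a) (q, b). (\<mu> $$ (a, b)) (G $$ (p, q))) P R * \<xi> R)
      = (\<Sum>l<N. \<Sum>P\<in>{..<n} \<times> {..<k}. \<Sum>R\<in>{..<n} \<times> {..<k}. \<eta>' l P * Q l P R * \<xi>' l R)" .
    have "cmod (\<Sum>P\<in>{..<k} \<times> {..<m}. \<Sum>R\<in>{..<k} \<times> {..<m}.
        \<eta> P * (\<lambda>(p, a) (q, b). (\<mu> $$ (a, b)) (G $$ (p, q))) P R * \<xi> R)
      \<le> K * l2 ({..<N} \<times> {..<n} \<times> {..<k}) (\<lambda>(l, P). \<eta>' l P) * l2 ({..<N} \<times> {..<n} \<times> {..<k}) (\<lambda>(l, P). \<xi>' l P)"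
      unfolding eq by (rule bilin_le_block_diag) (use Q K in auto)
    also have "\<dots> \<le> K * (cmat_norm \<alpha> * l2 ({..<k} \<times> {..<m}) \<eta>) * (cmat_norm \<beta> * l2 ({..<k} \<times> {..<m}) \<xi>)"
    proof -
      have "l2 ({..<N} \<times> {..<n} \<times> {..<k}) (\<lambda>(l, P). \<eta>' l P) \<le> cmat_norm \<alpha> * l2 ({..<k} \<times> {..<m}) \<eta>"
        using bilin_le_row[OF bilin_le_transpose[OF bilin_le_cmat_norm[of \<alpha>]] cmat_norm_nonneg] \<alpha>
          l2_amplified[where N = N and n = n and m = m and k = k and M = "\<lambda>r a. \<alpha> $$ (a, r)" and C = "cmat_norm \<alpha>" and \<eta> = \<eta>] cmat_norm_nonneg
        by (simp add: \<eta>'_def case_prod_unfold)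
      moreover have "l2 ({..<N} \<times> {..<n} \<times> {..<k}) (\<lambda>(l, P). \<xi>' l P) \<le> cmat_norm \<beta> * l2 ({..<k} \<times> {..<m}) \<xi>"
        using bilin_le_row[OF bilin_le_cmat_norm[of \<beta>] cmat_norm_nonneg] \<beta>
          l2_amplified[where N = N and n = n and m = m and k = k and M = "\<lambda>r a. \<beta> $$ (r, a)" and C = "cmat_norm \<beta>" and \<eta> = \<xi>] cmat_norm_nonneg
        by (simp add: \<xi>'_def case_prod_unfold)
      ultimately show ?thesis using K
        by (intro mult_mono mult_nonneg_nonneg cmat_norm_nonneg L2_set_nonneg order_refl)
    qed
    finally show "cmod (\<Sum>P\<in>{..<k} \<times> {..<m}. \<Sum>R\<in>{..<k} \<times> {..<m}.
        \<eta> P * (\<lambda>(p, a) (q, b). (\<mu> $$ (a, b)) (G $$ (p, q))) P R * \<xi> R)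
      \<le> representation_cost N \<alpha> \<beta> c x y * l2 ({..<k} \<times> {..<m}) \<eta> * l2 ({..<k} \<times> {..<m}) \<xi>"
      unfolding representation_cost_def K_def[symmetric] by (simp only: mult_ac)
  qed
  have ent: "amplify m (eval_mat \<mu>) G $$ (p * m + a, q * m + b) = (\<mu> $$ (a, b)) (G $$ (p, q))"
    if "p < k" "a < m" "q < k" "b < m" for p a q b
    using that matsD(1,2)[OF G] \<mu> by (simp add: amplify_index)
  show ?thesis
    by (rule cmat_norm_flat_le[OF _ _ ent main representation_cost_nonneg(2)[OF N]])
      (use matsD(1,2)[OF G] in auto)
qed

definition molecules :: "(nat \<Rightarrow> nat \<Rightarrow> (('h \<Rightarrow>\<^sub>L 'h) \<Rightarrow> complex) \<Rightarrow> complex) set" where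
  "molecules = {D. \<exists>c x y. x \<in> mats n X \<and> y \<in> mats n X \<and> cmod c * op_mat_norm (x - y) \<le> 1 \<and>
     D = (\<lambda>i j. scaleF c (\<delta> (x $$ (i, j)) - \<delta> (y $$ (i, j))))}"

lemma molecules_in_span:
  assumes "D \<in> molecules" "i < n" "j < n"
  shows "D i j \<in> delta_span X x0 n"
proof -
  from assms(1) obtain c x y where xy: "x \<in> mats n X" "y \<in> mats n X"
    and D: "D = (\<lambda>i j. scaleF c (\<delta> (x $$ (i, j)) - \<delta> (y $$ (i, j))))"
    by (auto simp: molecules_def)
  have "x $$ (i, j) \<in> X" "y $$ (i, j) \<in> X" using matsD(3)[OF xy(1)] matsD(3)[OF xy(2)] assms by auto
  then show ?thesis unfolding D delta_span_def
    by (intro cfun.span_scale cfun.span_diff cfun.span_base imageI)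
qed

text \<open>
  The point \<open>x0\<close> is the zero of the free space. Hence a multiple of \<open>\<delta> z\<close> is the \<open>(0, 0)\<close>
  entry of the molecule of two matrices that differ in this entry only, one having \<open>z\<close> there and \<open>x0\<close>
  everywhere else, the other being constantly \<open>x0\<close>; scalar matrices move it to any position.
\<close>

lemma molecules_generate:
  assumes x0: "x0 \<in> X" and n: "1 \<le> n" and v: "v \<in> delta_span X x0 n" and ab: "a < m" "b < m"
  shows "\<exists>A B. sandwich_cone m n molecules A B (single_entry a b v)"
  using v unfolding delta_span_def
proof (induction rule: cfun.span_induct_alt)
  case base
  have "single_entry a b 0 = (0 :: nat \<Rightarrow> nat \<Rightarrow> (('h \<Rightarrow>\<^sub>L 'h) \<Rightarrow> complex) \<Rightarrow> complex)"
    by (auto simp: single_entry_def fun_eq_iff)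
  then show ?case using sandwich_cone.zero[of m n molecules] by metis
next
  case (step c w v)
  then obtain z where z: "z \<in> X" and w: "w = \<delta> z" by auto
  define x where "x = mat n n (\<lambda>(i, j). if i = 0 \<and> j = 0 then z else x0)"
  define y where "y = mat n n (\<lambda>(i :: nat, j :: nat). x0)"
  have xy: "x \<in> mats n X" "y \<in> mats n X" unfolding x_def y_def using x0 z by (auto intro!: matsI)
  \<comment> \<open>adding 1 keeps the normalising factor finite when \<open>z = x0\<close>\<close>
  define r where "r = 1 + op_mat_norm (x - y)"
  have r: "0 < r" "op_mat_norm (x - y) \<le> r" using op_mat_norm_nonneg[of "x - y"] by (auto simp: r_def)
  define D where "D = (\<lambda>i j. scaleF (of_real (1 / r)) (\<delta> (x $$ (i, j)) - \<delta> (y $$ (i, j))))"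
  have "cmod (of_real (1 / r)) * op_mat_norm (x - y) \<le> 1" using r by (simp add: norm_divide field_simps)
  then have D: "D \<in> molecules" unfolding molecules_def D_def using xy by blast
  have D00: "D 0 0 f = of_real (1 / r) * \<delta> z f" for f
    using n by (simp add: D_def x_def y_def scaleF_def delta_base)
  define \<alpha> where "\<alpha> = (\<lambda>(i :: nat) a'. if i = 0 \<and> a' = a then c * of_real r else 0)"
  define \<beta> where "\<beta> = (\<lambda>(i :: nat) b'. if i = 0 \<and> b' = b then 1 :: complex else 0)"
  have "sandwich m n \<alpha> D \<beta> = single_entry a b (scaleF c w)"
  proof (intro ext)
    fix a' b' f
    show "sandwich m n \<alpha> D \<beta> a' b' f = single_entry a b (scaleF c w) a' b' f"
    proof (cases "a' = a \<and> b' = b")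
      case True
      have "sandwich m n \<alpha> D \<beta> a' b' f = (\<Sum>i<n. \<Sum>j<n. \<alpha> i a' * \<beta> j b' * D i j f)"
        using True ab by (simp add: sandwich_def sum_fun_apply scaleF_def)
      also have "\<dots> = (\<Sum>i<n. \<Sum>j<n. if j = 0 then (if i = 0 then c * of_real r * D 0 0 f else 0) else 0)"
        using True by (intro sum.cong refl) (auto simp: \<alpha>_def \<beta>_def)
      also have "\<dots> = c * of_real r * D 0 0 f" using n by simp
      finally show ?thesis using True r by (simp add: D00 single_entry_def w scaleF_def)
    next
      case False
      have "(\<Sum>i<n. \<Sum>j<n. scaleF (\<alpha> i a' * \<beta> j b') (D i j)) f = 0"
        unfolding sum_fun_apply using False by (intro sum.neutral ballI) (auto simp: \<alpha>_def \<beta>_def scaleF_def)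
      then show ?thesis using False by (auto simp: sandwich_def single_entry_def)
    qed
  qed
  with sandwich_cone_single[OF D, of m n \<alpha> \<beta>]
  have 1: "sandwich_cone m n molecules (sqsum m {..<n} \<alpha>) (sqsum m {..<n} \<beta>) (single_entry a b (scaleF c w))"
    by metis
  obtain A B where 2: "sandwich_cone m n molecules A B (single_entry a b v)" using step by blast
  show ?case using sandwich_cone_add[OF 1 2] unfolding single_entry_add by blast
qed

text \<open>
  An element of the cone is put back into the shape \<open>\<alpha> D \<beta>\<close> with a block diagonal \<open>D\<close>, by
  placing the \<open>\<alpha>\<^sub>l\<close> next to each other and the \<open>\<beta>\<^sub>l\<close> below each other.
\<close>

lemma sandwich_cone_cost:
  assumes ne: "x0 \<in> X"
    and cone: "sandwich_cone m n molecules A B M"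
    and M: "\<And>a b. a < m \<Longrightarrow> b < m \<Longrightarrow> M a b = \<mu> $$ (a, b)" and \<mu>: "\<mu> \<in> carrier_mat m m"
    and st: "0 \<le> s" "0 \<le> t" "\<forall>\<xi>\<in>l2_ball m. A \<xi> \<le> s" "\<forall>\<xi>\<in>l2_ball m. B \<xi> \<le> t"
  shows "\<exists>N \<alpha> \<beta> c x y. is_representation \<mu> m N \<alpha> \<beta> c x y \<and>
     representation_cost N \<alpha> \<beta> c x y \<le> sqrt s * sqrt t"
proof -
  have "molecules \<noteq> {}"
  proof -
    have "mat n n (\<lambda>_. x0) \<in> mats n X" by (rule matsI) (rule ne)
    then have "(\<lambda>i j. scaleF 0 (\<delta> (mat n n (\<lambda>_. x0) $$ (i, j)) - \<delta> (mat n n (\<lambda>_. x0) $$ (i, j)))) \<in> molecules"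
      unfolding molecules_def mem_Collect_eq
      by (intro exI[of _ 0] exI[of _ "mat n n (\<lambda>_. x0)"] conjI) (auto intro: refl)
    then show ?thesis by blast
  qed
  from sandwich_cone_representation[OF cone this]
  obtain N :: nat and \<alpha>' D \<beta>' where N: "1 \<le> N" and D: "\<forall>l. D l \<in> molecules"
    and A: "A = (\<lambda>\<xi>. \<Sum>l<N. sqsum m {..<n} (\<alpha>' l) \<xi>)" and B: "B = (\<lambda>\<xi>. \<Sum>l<N. sqsum m {..<n} (\<beta>' l) \<xi>)"
    and Ms: "M = (\<lambda>a b. \<Sum>l<N. sandwich m n (\<alpha>' l) (D l) (\<beta>' l) a b)" by (elim exE conjE) (rule that)
  have "\<forall>l. \<exists>c x y. x \<in> mats n X \<and> y \<in> mats n X \<and> cmod c * op_mat_norm (x - y) \<le> 1 \<and>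
     D l = (\<lambda>i j. scaleF c (\<delta> (x $$ (i, j)) - \<delta> (y $$ (i, j))))"
    using D unfolding molecules_def by blast
  then have "\<exists>c x y. \<forall>l. x l \<in> mats n X \<and> y l \<in> mats n X \<and> cmod (c l) * op_mat_norm (x l - y l) \<le> 1 \<and>
     D l = (\<lambda>i j. scaleF (c l) (\<delta> (x l $$ (i, j)) - \<delta> (y l $$ (i, j))))"
    by (simp only: choice_iff)
  then obtain c x y where cxy: "\<forall>l. x l \<in> mats n X \<and> y l \<in> mats n X \<and> cmod (c l) * op_mat_norm (x l - y l) \<le> 1 \<and>
     D l = (\<lambda>i j. scaleF (c l) (\<delta> (x l $$ (i, j)) - \<delta> (y l $$ (i, j))))"
    by (elim exE) (rule that)
  have xy: "x l \<in> mats n X" "y l \<in> mats n X" and c: "cmod (c l) * op_mat_norm (x l - y l) \<le> 1"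
    and D_eq: "D l = (\<lambda>i j. scaleF (c l) (\<delta> (x l $$ (i, j)) - \<delta> (y l $$ (i, j))))" for l
    using cxy by blast+
  define \<alpha> where "\<alpha> = mat m (N * n) (\<lambda>(a, r). \<alpha>' (r div n) (r mod n) a)"
  define \<beta> where "\<beta> = mat (N * n) m (\<lambda>(r, b). \<beta>' (r div n) (r mod n) b)"
  have \<alpha>: "\<alpha> $$ (a, l * n + i) = \<alpha>' l i a" if "a < m" "l < N" "i < n" for a l i
    using that div_mod_less[of l N i n] by (simp add: \<alpha>_def)
  have \<beta>: "\<beta> $$ (l * n + i, b) = \<beta>' l i b" if "b < m" "l < N" "i < n" for b l i
    using that div_mod_less[of l N i n] by (simp add: \<beta>_def)
  let ?B = "\<lambda>l. molecule_mat X x0 n (c l) (x l) (y l)"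
  let ?R = "(\<alpha> \<cdot>\<^sub>l diag_block_mat (map ?B [0..<N])) \<cdot>\<^sub>r \<beta>"
  have "\<mu> = ?R"
  proof (rule eq_matI)
    show "dim_row \<mu> = dim_row ?R" "dim_col \<mu> = dim_col ?R"
      using \<mu> by (simp_all add: scalar_mult_left_def scalar_mult_right_def \<alpha>_def \<beta>_def)
    fix a b assume "a < dim_row ?R" "b < dim_col ?R"
    then have ab: "a < m" "b < m" by (simp_all add: scalar_mult_left_def scalar_mult_right_def \<alpha>_def \<beta>_def)
    have "?R $$ (a, b) = (\<Sum>l<N. \<Sum>i<n. \<Sum>j<n. scaleF (\<alpha> $$ (a, l * n + i) * \<beta> $$ (l * n + j, b)) (?B l $$ (i, j)))"
      using ab by (intro scalar_mult_diag_block_mat_index molecule_carrier xy) (simp_all add: \<alpha>_def \<beta>_def)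
    also have "\<dots> = (\<Sum>l<N. \<Sum>i<n. \<Sum>j<n. scaleF (\<alpha>' l i a * \<beta>' l j b) (D l i j))"
      unfolding D_eq using ab by (intro sum.cong refl arg_cong2[where f = scaleF] molecule_index xy) (auto simp: \<alpha> \<beta>)
    also have "\<dots> = M a b" unfolding Ms sandwich_def using ab by simp
    finally show "\<mu> $$ (a, b) = ?R $$ (a, b)" using M[OF ab] by simp
  qed
  then have rep: "is_representation \<mu> m N \<alpha> \<beta> c x y"
    unfolding is_representation_def using N xy by (simp add: \<alpha>_def \<beta>_def)
  have "bilin_le {..<N * n} {..<m} (\<lambda>r a. \<alpha> $$ (a, r)) (sqrt s)"
  proof (rule bilin_le_sqrtI)
    fix \<xi> assume "\<xi> \<in> l2_ball m"
    then have "(\<Sum>l<N. \<Sum>i<n. (cmod (\<Sum>a<m. \<xi> a * \<alpha>' l i a))\<^sup>2) \<le> s"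
      using st(3) by (simp add: A sqsum_def pairing_def)
    then show "(\<Sum>r<N * n. (cmod (\<Sum>a<m. \<xi> a * \<alpha> $$ (a, r)))\<^sup>2) \<le> s"
      unfolding sum_div_mod by (simp add: \<alpha>)
  qed (rule st(1))
  then have ca: "cmat_norm \<alpha> \<le> sqrt s"
    using st(1) by (intro cmat_norm_le) (auto dest: bilin_le_transpose simp: \<alpha>_def)
  have "bilin_le {..<N * n} {..<m} (\<lambda>r b. \<beta> $$ (r, b)) (sqrt t)"
  proof (rule bilin_le_sqrtI)
    fix \<xi> assume "\<xi> \<in> l2_ball m"
    then have "(\<Sum>l<N. \<Sum>i<n. (cmod (\<Sum>a<m. \<xi> a * \<beta>' l i a))\<^sup>2) \<le> t"
      using st(4) by (simp add: B sqsum_def pairing_def)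
    then show "(\<Sum>r<N * n. (cmod (\<Sum>a<m. \<xi> a * \<beta> $$ (r, a)))\<^sup>2) \<le> t"
      unfolding sum_div_mod by (simp add: \<beta>)
  qed (rule st(2))
  then have cb: "cmat_norm \<beta> \<le> sqrt t"
    using st(2) by (intro cmat_norm_le) (auto simp: \<beta>_def)
  have "Max ((\<lambda>l. cmod (c l) * op_mat_norm (x l - y l)) ` {..<N}) \<le> 1"
    using c N by (intro Max.boundedI) (auto simp: lessThan_empty_iff)
  then have "representation_cost N \<alpha> \<beta> c x y \<le> (sqrt s * sqrt t) * 1"
    unfolding representation_cost_def using ca cb st
    by (intro mult_mono mult_nonneg_nonneg cmat_norm_nonneg representation_cost_nonneg[OF N]) auto
  then have "representation_cost N \<alpha> \<beta> c x y \<le> sqrt s * sqrt t" by simp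
  with rep show ?thesis by blast
qed

lemma mats_over_of_mat:
  assumes \<mu>: "\<mu> \<in> mats m V" and V: "cfun.subspace V"
  shows "(\<lambda>a b. if a < m \<and> b < m then \<mu> $$ (a, b) else 0) \<in> mats_over m V"
  using matsD(3)[OF \<mu>] cfun.subspace_0[OF V] by (auto simp: mats_over_def)

lemma representation_exists:
  assumes x0: "x0 \<in> X" and n: "1 \<le> n" and \<mu>: "\<mu> \<in> mats m (delta_span X x0 n)"
  shows "\<exists>N \<alpha> \<beta> c x y. is_representation \<mu> m N \<alpha> \<beta> c x y"
proof -
  have V: "cfun.subspace (delta_span X x0 n)" unfolding delta_span_def by (rule cfun.subspace_span)
  let ?M = "\<lambda>a b. if a < m \<and> b < m then \<mu> $$ (a, b) else 0"
  have "\<exists>A B. sandwich_cone m n molecules A B ?M"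
    by (rule sandwich_cone_exists[OF _ mats_over_of_mat[OF \<mu> V]]) (rule molecules_generate[OF x0 n])
  then obtain A B where cone: "sandwich_cone m n molecules A B ?M" by blast
  obtain s t where st: "\<forall>\<xi>\<in>l2_ball m. \<bar>A \<xi>\<bar> \<le> s" "\<forall>\<xi>\<in>l2_ball m. \<bar>B \<xi>\<bar> \<le> t"
    using sandwich_cone_bounded[OF cone] unfolding ball_bounded_def by blast
  have st': "\<forall>\<xi>\<in>l2_ball m. A \<xi> \<le> \<bar>s\<bar>" "\<forall>\<xi>\<in>l2_ball m. B \<xi> \<le> \<bar>t\<bar>"
    using st by force+
  have carr: "\<mu> \<in> carrier_mat m m" using \<mu> by (simp add: mats_def)
  have "\<exists>N \<alpha> \<beta> c x y. is_representation \<mu> m N \<alpha> \<beta> c x y \<and>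
      representation_cost N \<alpha> \<beta> c x y \<le> sqrt \<bar>s\<bar> * sqrt \<bar>t\<bar>"
    by (rule sandwich_cone_cost[OF x0 cone _ carr _ _ st']) simp_all
  then show ?thesis by blast
qed

text \<open>
  The map \<open>\<phi>\<close> of the matricial Hahn--Banach theorem, read off at the point evaluations, is the
  desired matrix of functions. Contractivity on the normalised molecules says that
  its \<open>n\<close>-th Lipschitz constant is at most 1; two matrices with distance 0 have equal entries. The
  individual entries are Lipschitz by testing on constant \<open>n \<times> n\<close> matrices.
\<close>

lemma norming_matrix_exists:
  fixes \<epsilon> :: real
  assumes x0: "x0 \<in> X" and n: "1 \<le> n" and \<mu>: "\<mu> \<in> mats m (delta_span X x0 n)"
    and c: "\<And>N \<alpha> \<beta> c' x y. is_representation \<mu> m N \<alpha> \<beta> c' x y \<Longrightarrow> c \<le> representation_cost N \<alpha> \<beta> c' x y"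
    and \<epsilon>: "0 < \<epsilon>"
  shows "\<exists>G. G \<in> mats m (os_carrier E) \<and> os_norm E G \<le> 1 \<and>
     c \<le> cmat_norm (amplify m (eval_mat \<mu>) G) * (1 + \<epsilon> * m)"
proof -
  let ?V = "delta_span X x0 n"
  have V: "cfun.subspace ?V" unfolding delta_span_def by (rule cfun.subspace_span)
  define M where "M = (\<lambda>a b. if a < m \<and> b < m then \<mu> $$ (a, b) else 0)"
  have M: "M \<in> mats_over m ?V" unfolding M_def by (rule mats_over_of_mat[OF \<mu> V])
  have carr: "\<mu> \<in> carrier_mat m m" using \<mu> by (simp add: mats_def)
  have cost: "2 * c \<le> s + t"
    if "sandwich_cone m n molecules A B M" "0 \<le> s" "0 \<le> t"
      "\<forall>\<xi>\<in>l2_ball m. A \<xi> \<le> s" "\<forall>\<xi>\<in>l2_ball m. B \<xi> \<le> t" for A B s t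
  proof -
    have "\<exists>N \<alpha> \<beta> c' x y. is_representation \<mu> m N \<alpha> \<beta> c' x y \<and>
        representation_cost N \<alpha> \<beta> c' x y \<le> sqrt s * sqrt t"
      by (rule sandwich_cone_cost[OF x0 that(1) _ carr that(2-5)]) (simp add: M_def)
    then have "c \<le> sqrt s * sqrt t" using c by (meson order_trans)
    moreover have "2 * (sqrt s * sqrt t) \<le> s + t"
      using arith_geo_mean_sqrt[of s t] that by (simp add: real_sqrt_mult)
    ultimately show ?thesis by simp
  qed
  have "\<exists>\<phi>. (\<forall>i j. \<forall>v\<in>?V. \<forall>w\<in>?V. \<phi> i j (v + w) = \<phi> i j v + \<phi> i j w) \<and>
     (\<forall>i j z. \<forall>v\<in>?V. \<phi> i j (scaleF z v) = z * \<phi> i j v) \<and>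
     (\<forall>D\<in>molecules. bilin_le ({..<n} \<times> {..<m}) ({..<n} \<times> {..<m}) (\<lambda>(k, i) (l, j). \<phi> i j (D k l)) 1) \<and>
     (\<forall>C\<ge>0. bilin_le ({..<m} \<times> {..<m}) ({..<m} \<times> {..<m}) (\<lambda>(k, i) (l, j). \<phi> i j (M k l)) C \<longrightarrow>
        c \<le> C * (1 + \<epsilon> * m))"
    by (rule matricial_hahn_banach[OF V _ _ M _ \<epsilon>])
      (erule molecules_in_span, assumption+, erule molecules_generate[OF x0 n], assumption+, rule cost)
  then obtain \<phi> where \<phi>_add: "\<forall>i j. \<forall>v\<in>?V. \<forall>w\<in>?V. \<phi> i j (v + w) = \<phi> i j v + \<phi> i j w"
    and \<phi>_scale: "\<forall>i j z. \<forall>v\<in>?V. \<phi> i j (scaleF z v) = z * \<phi> i j v"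
    and \<phi>_bound: "\<forall>D\<in>molecules. bilin_le ({..<n} \<times> {..<m}) ({..<n} \<times> {..<m}) (\<lambda>(k, i) (l, j). \<phi> i j (D k l)) 1"
    and \<phi>_norming: "\<forall>C\<ge>0. bilin_le ({..<m} \<times> {..<m}) ({..<m} \<times> {..<m}) (\<lambda>(k, i) (l, j). \<phi> i j (M k l)) C \<longrightarrow>
        c \<le> C * (1 + \<epsilon> * m)"
    by (elim exE conjE) (rule that)
  have \<delta>V: "\<delta> z \<in> ?V" if "z \<in> X" for z
    unfolding delta_span_def using that by (intro cfun.span_base imageI)
  have \<phi>_zero: "\<phi> i j 0 = 0" for i j
    using \<phi>_scale[rule_format, OF cfun.subspace_0[OF V], of i j 0] by (simp add: cfun.scale_zero_left)
  have \<phi>_diff: "\<phi> i j (v - w) = \<phi> i j v - \<phi> i j w" if "v \<in> ?V" "w \<in> ?V" for i j v w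
  proof -
    have "v - w \<in> ?V" using that by (rule cfun.subspace_diff[OF V])
    from \<phi>_add[rule_format, OF this that(2), of i j] show ?thesis unfolding diff_add_cancel by simp
  qed
  define g where "g p q = (\<lambda>z. if z \<in> X then \<phi> p q (\<delta> z) else 0)" for p q
  have g_bound: "bilin_le ({..<n} \<times> {..<m}) ({..<n} \<times> {..<m})
      (\<lambda>(i, p) (j, q). g p q (x $$ (i, j)) - g p q (y $$ (i, j))) (op_mat_norm (x - y))"
    if x: "x \<in> mats n X" and y: "y \<in> mats n X" for x y
  proof (cases "op_mat_norm (x - y) = 0")
    case True
    have "x $$ (i, j) = y $$ (i, j)" if "i < n" "j < n" for i j
      using norm_entry_le_op_mat_norm[of i "x - y" j] True that matsD(1,2)[OF y] matsD(1,2)[OF x] by simp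
    then have "bilin_le ({..<n} \<times> {..<m}) ({..<n} \<times> {..<m})
        (\<lambda>(i, p) (j, q). g p q (x $$ (i, j)) - g p q (y $$ (i, j))) 0
      = bilin_le ({..<n} \<times> {..<m}) ({..<n} \<times> {..<m}) (\<lambda>_ _. 0) 0"
      by (intro bilin_le_cong) auto
    then show ?thesis using True by (simp add: bilin_le_def)
  next
    case False
    then have pos: "0 < op_mat_norm (x - y)" using op_mat_norm_nonneg[of "x - y"] by simp
    let ?c = "of_real (1 / op_mat_norm (x - y)) :: complex"
    define D where "D = (\<lambda>i j. scaleF ?c (\<delta> (x $$ (i, j)) - \<delta> (y $$ (i, j))))"
    have "cmod ?c * op_mat_norm (x - y) \<le> 1" using pos by (simp add: norm_divide)
    then have "D \<in> molecules" unfolding molecules_def D_def using x y by blast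
    from bilin_le_scale[OF \<phi>_bound[rule_format, OF this], of "of_real (op_mat_norm (x - y))"]
    have "bilin_le ({..<n} \<times> {..<m}) ({..<n} \<times> {..<m})
        (\<lambda>P Q. of_real (op_mat_norm (x - y)) * (\<lambda>(k, i) (l, j). \<phi> i j (D k l)) P Q) (op_mat_norm (x - y))"
      using pos by simp
    also have "?this \<longleftrightarrow> ?thesis"
    proof (intro bilin_le_cong, clarsimp)
      fix i p j q assume "i < n" "j < n"
      then have *: "x $$ (i, j) \<in> X" "y $$ (i, j) \<in> X"
        using matsD(3)[OF x] matsD(3)[OF y] by auto
      then have "\<phi> p q (D i j) = ?c * (\<phi> p q (\<delta> (x $$ (i, j))) - \<phi> p q (\<delta> (y $$ (i, j))))"
        unfolding D_def using \<phi>_scale[rule_format, OF cfun.subspace_diff[OF V \<delta>V \<delta>V]] \<phi>_diff[OF \<delta>V \<delta>V] by simp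
      then show "of_real (op_mat_norm (x - y)) * \<phi> p q (D i j) = g p q (x $$ (i, j)) - g p q (y $$ (i, j))"
        using * pos by (simp add: g_def)
    qed
    finally show ?thesis .
  qed
  have g_lip: "g p q \<in> os_carrier E" if pq: "p < m" "q < m" for p q
  proof -
    have "(real (n * n))-lipschitz_on X (g p q)"
    proof (rule lipschitz_onI)
      fix z w assume zw: "z \<in> X" "w \<in> X"
      let ?x = "mat n n (\<lambda>_. z)" and ?y = "mat n n (\<lambda>_. w)"
      have xy: "?x \<in> mats n X" "?y \<in> mats n X" using zw by (auto intro!: matsI)
      have "(0, p) \<in> {..<n} \<times> {..<m}" "(0, q) \<in> {..<n} \<times> {..<m}" using pq n by auto
      from bilin_le_entry[OF g_bound[OF xy] _ _ this]
      have "cmod (g p q z - g p q w) \<le> op_mat_norm (?x - ?y)" using n by simp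
      also have "\<dots> \<le> (\<Sum>i<n. \<Sum>j<n. norm (z - w))"
        using op_mat_norm_le_sum[of "?x - ?y"] by simp
      finally show "dist (g p q z) (g p q w) \<le> real (n * n) * dist z w" by (simp add: dist_norm)
    qed simp
    moreover have "g p q x0 = 0" using x0 by (simp add: g_def delta_base \<phi>_zero)
    ultimately show ?thesis by (auto simp: lip0_space_def g_def)
  qed
  define G where "G = mat m m (\<lambda>(p, q). g p q)"
  have G: "G \<in> mats m (os_carrier E)" unfolding G_def using g_lip by (auto intro!: matsI)
  have G_entry: "G $$ (p, q) = g p q" if "p < m" "q < m" for p q using that by (simp add: G_def)
  have "os_norm E G \<le> 1"
    unfolding lip0_os_norm
  proof (rule lip_const_le)
    fix x y assume xy: "x \<in> mats n X" "y \<in> mats n X"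
    have "bilin_le ({..<n} \<times> {..<m}) ({..<n} \<times> {..<m})
        (\<lambda>(i, p) (j, q). (G $$ (p, q)) (x $$ (i, j)) - (G $$ (p, q)) (y $$ (i, j))) (op_mat_norm (x - y))
      = bilin_le ({..<n} \<times> {..<m}) ({..<n} \<times> {..<m})
        (\<lambda>(i, p) (j, q). g p q (x $$ (i, j)) - g p q (y $$ (i, j))) (op_mat_norm (x - y))"
      by (intro bilin_le_cong) (auto simp: G_entry)
    then show "bilin_le ({..<n} \<times> {..<dim_row G}) ({..<n} \<times> {..<dim_row G})
        (\<lambda>(i, p) (j, q). (G $$ (p, q)) (x $$ (i, j)) - (G $$ (p, q)) (y $$ (i, j))) (1 * op_mat_norm (x - y))"
      using g_bound[OF xy] by (simp add: G_def)
  qed (simp_all add: G_def)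
  moreover have "c \<le> cmat_norm (amplify m (eval_mat \<mu>) G) * (1 + \<epsilon> * m)"
  proof -
    have eval: "v (g p q) = \<phi> p q v" if v: "v \<in> ?V" and pq: "p < m" "q < m" for v p q
    proof -
      have "v (g p q) = \<phi> p q v \<and> v \<in> ?V"
        using v unfolding delta_span_def
      proof (induction rule: cfun.span_induct_alt)
        case base
        show ?case by (intro conjI cfun.span_zero) (rule trans[OF zero_fun_apply \<phi>_zero[symmetric]])
      next
        case (step z w v)
        then obtain t where t: "t \<in> X" and w: "w = \<delta> t" by auto
        have wV: "w \<in> ?V" and vV: "v \<in> ?V" using \<delta>V[OF t] w step by (auto simp: delta_span_def)
        have zw: "scaleF z w \<in> ?V" by (rule cfun.subspace_scale[OF V wV])
        have wg: "w (g p q) = \<phi> p q w"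
          using t by (simp add: w delta_apply[OF g_lip[OF pq]]) (simp add: g_def)
        have "(scaleF z w + v) (g p q) = z * w (g p q) + v (g p q)"
          by (simp add: scaleF_def)
        also have "\<dots> = z * \<phi> p q w + \<phi> p q v" using wg step by simp
        also have "\<dots> = \<phi> p q (scaleF z w + v)"
          using \<phi>_add[rule_format, OF zw vV, of p q] \<phi>_scale[rule_format, OF wV, of p q z] by simp
        finally show ?case
          using cfun.subspace_add[OF V zw vV] unfolding delta_span_def by (rule conjI)
      qed
      then show ?thesis by simp
    qed
    have dim: "dim_row (amplify m (eval_mat \<mu>) G) = m * m" "dim_col (amplify m (eval_mat \<mu>) G) = m * m"
      by (simp_all add: G_def)
    have ent: "amplify m (eval_mat \<mu>) G $$ (p * m + a, q * m + b) = \<phi> p q (M a b)"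
      if "p < m" "a < m" "q < m" "b < m" for p a q b
    proof -
      have "amplify m (eval_mat \<mu>) G $$ (p * m + a, q * m + b) = (\<mu> $$ (a, b)) (g p q)"
        using that matsD(1,2)[OF \<mu>] by (simp add: amplify_index G_def)
      also have "\<dots> = \<phi> p q (M a b)"
        using that eval[OF matsD(3)[OF \<mu>]] by (simp add: M_def)
      finally show ?thesis .
    qed
    have "bilin_le ({..<m} \<times> {..<m}) ({..<m} \<times> {..<m}) (\<lambda>(k, i) (l, j). \<phi> i j (M k l))
        (cmat_norm (amplify m (eval_mat \<mu>) G))"
      using bilin_le_cmat_norm_flat[OF dim ent] by (subst bilin_le_prod_swap)
    then show ?thesis using \<phi>_norming cmat_norm_nonneg by blast
  qed
  ultimately show ?thesis using G by blast
qed

end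

theorem theorem5p2:
  fixes X :: "('h::complex_hilbert_space \<Rightarrow>\<^sub>L 'h) set"
    and x0 :: "'h \<Rightarrow>\<^sub>L 'h"
    and n m :: nat
    and \<mu> :: "((('h \<Rightarrow>\<^sub>L 'h) \<Rightarrow> complex) \<Rightarrow> complex) mat"
  assumes "pointed_operator_metric_space X x0"
    and "1 \<le> n" and "1 \<le> m"
    and "\<mu> \<in> mats m (delta_span X x0 n)"
  shows "os_norm (lip_free_space X x0 n) \<mu> =
    Inf {cmat_norm \<alpha> * cmat_norm \<beta> * Max ((\<lambda>l. cmod (c l) * op_mat_norm (x l - y l)) ` {..<N})
      | (N::nat) (\<alpha>::complex mat) (\<beta>::complex mat) (c::nat \<Rightarrow> complex)
        (x::nat \<Rightarrow> ('h \<Rightarrow>\<^sub>L 'h) mat) (y::nat \<Rightarrow> ('h \<Rightarrow>\<^sub>L 'h) mat).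
        1 \<le> N \<and> \<alpha> \<in> carrier_mat m (N * n) \<and> \<beta> \<in> carrier_mat (N * n) m \<and>
        (\<forall>l<N. x l \<in> mats n X \<and> y l \<in> mats n X) \<and>
        \<mu> = (\<alpha> \<cdot>\<^sub>l diag_block_mat (map (\<lambda>l. molecule_mat X x0 n (c l) (x l) (y l)) [0..<N])) \<cdot>\<^sub>r \<beta>}"
proof -
  let ?S = "{cmat_norm (amplify (dim_row \<mu>) (eval_mat \<mu>) G) | G k.
        1 \<le> k \<and> G \<in> mats k (os_carrier (lip0_space X x0 n)) \<and> os_norm (lip0_space X x0 n) G \<le> 1}"
  let ?R = "{representation_cost N \<alpha> \<beta> c x y | N \<alpha> \<beta> c x y. is_representation X x0 n \<mu> m N \<alpha> \<beta> c x y}"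
  have x0: "x0 \<in> X" using assms(1) by (simp add: pointed_operator_metric_space_def)
  have dim: "dim_row \<mu> = m" using matsD(1)[OF assms(4)] .
  have upper: "v \<le> r" if "v \<in> ?S" "r \<in> ?R" for v r
    using that evaluation_le_cost unfolding dim by blast
  obtain r where r: "r \<in> ?R"
    using representation_exists[OF x0 assms(2,4)] by blast
  have zero_in: "\<exists>v\<in>?S. 0 \<le> v"
  proof -
    have cost0: "0 \<le> representation_cost N \<alpha> \<beta> c x y"
      if "is_representation X x0 n \<mu> m N \<alpha> \<beta> c x y" for N \<alpha> \<beta> c x y
      using that unfolding is_representation_def by (intro representation_cost_nonneg(2)) blast
    have "\<exists>G. G \<in> mats m (os_carrier (lip0_space X x0 n)) \<and> os_norm (lip0_space X x0 n) G \<le> 1 \<and>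
        0 \<le> cmat_norm (amplify m (eval_mat \<mu>) G) * (1 + 1 * real m)"
      by (rule norming_matrix_exists[OF x0 assms(2,4)]) (erule cost0, simp)
    then obtain G where "G \<in> mats m (os_carrier (lip0_space X x0 n))" "os_norm (lip0_space X x0 n) G \<le> 1"
      by blast
    then show ?thesis using cmat_norm_nonneg assms(3) by blast
  qed
  then have S_ne: "?S \<noteq> {}" by blast
  have bdd: "bdd_above ?S" using upper[OF _ r] by (rule bdd_aboveI)
  have S_nonneg: "0 \<le> Sup ?S"
  proof -
    obtain v where "v \<in> ?S" "0 \<le> v" using zero_in by blast
    then show ?thesis using cSup_upper[OF _ bdd] by (meson order_trans)
  qed
  have "Sup ?S \<le> Inf ?R"
  proof (rule cInf_greatest)
    show "?R \<noteq> {}" using r by blast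
    fix r' assume "r' \<in> ?R"
    then show "Sup ?S \<le> r'" using upper by (intro cSup_least[OF S_ne]) blast
  qed
  moreover have "Inf ?R \<le> Sup ?S"
  proof (rule field_le_epsilon)
    fix e :: real assume e: "0 < e"
    \<comment> \<open>chosen so that the factor \<open>1 + \<epsilon> m\<close> raises the supremum by at most \<open>e\<close>\<close>
    define \<epsilon> where "\<epsilon> = e / (Sup ?S * m + 1)"
    have pos: "0 < Sup ?S * m + 1" using S_nonneg by (simp add: add_nonneg_pos)
    have \<epsilon>: "0 < \<epsilon>" using e pos by (simp add: \<epsilon>_def)
    have low: "Inf ?R \<le> representation_cost N \<alpha> \<beta> c x y"
      if "is_representation X x0 n \<mu> m N \<alpha> \<beta> c x y" for N \<alpha> \<beta> c x y
    proof (rule cInf_lower)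
      show "representation_cost N \<alpha> \<beta> c x y \<in> ?R" using that by blast
      show "bdd_below ?R"
        using representation_cost_nonneg(2) unfolding is_representation_def by (intro bdd_belowI[of _ 0]) blast
    qed
    have "\<exists>G. G \<in> mats m (os_carrier (lip0_space X x0 n)) \<and> os_norm (lip0_space X x0 n) G \<le> 1 \<and>
        Inf ?R \<le> cmat_norm (amplify m (eval_mat \<mu>) G) * (1 + \<epsilon> * m)"
      by (rule norming_matrix_exists[OF x0 assms(2,4)]) (erule low, rule \<epsilon>)
    then obtain G where G: "G \<in> mats m (os_carrier (lip0_space X x0 n))" "os_norm (lip0_space X x0 n) G \<le> 1"
      and le: "Inf ?R \<le> cmat_norm (amplify m (eval_mat \<mu>) G) * (1 + \<epsilon> * m)"
      by blast
    have "cmat_norm (amplify m (eval_mat \<mu>) G) \<le> Sup ?S"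
      using G assms(3) dim by (intro cSup_upper[OF _ bdd]) blast
    then have "cmat_norm (amplify m (eval_mat \<mu>) G) * (1 + \<epsilon> * m) \<le> Sup ?S * (1 + \<epsilon> * m)"
      using \<epsilon> by (intro mult_right_mono) auto
    also have "\<dots> = Sup ?S + \<epsilon> * (Sup ?S * m)" by (simp add: algebra_simps)
    also have "\<epsilon> * (Sup ?S * m) \<le> \<epsilon> * (Sup ?S * m + 1)" using \<epsilon> by (intro mult_left_mono) auto
    also have "\<epsilon> * (Sup ?S * m + 1) = e" using pos by (simp add: \<epsilon>_def)
    finally show "Inf ?R \<le> Sup ?S + e" using le by simp
  qed
  ultimately have "Sup ?S = Inf ?R" by (rule antisym)
  then show ?thesis
    unfolding free_os_norm representation_cost_def is_representation_def .
qed

end
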